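(* Let $R>0$. For $Z_1\in\mathbb D^+_R$, $Z_2\in\mathbb D^-_R$, \begin{multline*} J_R'^{+-}\bigl(N(W)^{-2}\cdot W^+\bigr)(Z_1,Z_2)=-\sum_{l\ge0,m,n}\frac1{(2l+1)^2}f^{(1)}_{l,m,n}(Z_1)\cdot\tilde g^{(1)}_{l,m,n}(Z_2)\\ -\sum_{l\ge\frac12,m,n}\frac1{(2l)^2(2l+1)^2}f^{(2)}_{l,m,n}(Z_1)\cdot\tilde g^{(2)}_{l,m,n}(Z_2)-\sum_{l\ge1,m,n}\frac1{(2l)^2}f^{(3)}_{l,m,n}(Z_1)\cdot\tilde g^{(3)}_{l,m,n}(Z_2); \end{multline*} and for $Z_1\in\mathbb D^-_R$, $Z_2\in\mathbb D^+_R$, \begin{multline*} J_R'^{-+}\bigl(N(W)^{-2}\cdot W^+\bigr)(Z_1,Z_2)=-\sum_{l\ge0,m,n}\frac1{(2l+1)^2}\tilde f^{(1)}_{l,m,n}(Z_1)\cdot g^{(1)}_{l,m,n}(Z_2)\\ -\sum_{l\ge\frac12,m,n}\frac1{(2l)^2(2l+1)^2}\tilde f^{(2)}_{l,m,n}(Z_1)\cdot g^{(2)}_{l,m,n}(Z_2)-\sum_{l\ge1,m,n}\frac1{(2l)^2}\tilde f^{(3)}_{l,m,n}(Z_1)\cdot g^{(3)}_{l,m,n}(Z_2). \end{multline*}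
   Context: $\mathbb H_{\mathbb C}$ is identified with $2\times2$ complex matrices $Z=\bigl(\begin{smallmatrix}z_{11}&z_{12}\\ z_{21}&z_{22}\end{smallmatrix}\bigr)=z^0e_0+z^1e_1+z^2e_2+z^3e_3$, $e_0=1$, $e_1=\bigl(\begin{smallmatrix}0&-i\\-i&0\end{smallmatrix}\bigr)$, $e_2=\bigl(\begin{smallmatrix}0&-1\\1&0\end{smallmatrix}\bigr)$, $e_3=\bigl(\begin{smallmatrix}-i&0\\0&i\end{smallmatrix}\bigr)$; $Z^+$ is the adjugate matrix, $N(Z)=\det Z=ZZ^+$. $U(2)_R=\{RZ;Z\in U(2)\}$, $\mathbb D^+_R=\{Z;ZZ^*<R^2\}$, $\mathbb D^-_R=\{Z;ZZ^*>R^2\}$. For $F$ an $\mathbb H_{\mathbb C}$-valued function with entries in $\mathbb C[w_{11},w_{12},w_{21},w_{22},N(W)^{-1}]$, $$(J'_RF)(Z_1,Z_2)=\frac i{2\pi^3}\int_{W\in U(2)_R}\frac{W-Z_1}{N(W-Z_1)}\cdot F(W)\cdot\frac{W-Z_2}{N(W-Z_2)}\,dV,$$ $dV=dw^0\wedge dw^1\wedge dw^2\wedge dw^3$, with $U(2)_R$ oriented so that $\frac i{2\pi^3}\int_{U(2)_R}\frac{dV}{N(W)^2}=1$. $J_R'^{+-}F$ is this function on $\mathbb D^+_R\times\mathbb D^-_R$, $J_R'^{-+}F$ is this function on $\mathbb D^-_R\times\mathbb D^+_R$. In the series one sums first over all applicable $m,n$, then over $l\in\frac12\mathbb Z$ in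 increasing order. A column times a row is a $2\times2$ matrix. $t^l_{n\,\underline m}(Z)=\frac1{2\pi i}\oint(sz_{11}+z_{21})^{l-m}(sz_{12}+z_{22})^{l+m}s^{-l+n}\frac{ds}s$ for $l=0,\frac12,1,\dots$, $m,n\in\mathbb Z+l$, $-l\le m,n\le l$ (counterclockwise loop around $0$), and $t^l_{n\,\underline m}=0$ for out-of-range indices. For $l=0,\frac12,1,\dots$ (indices advance in steps of $1$): $f^{(1)}_{l,m,n}(Z)=\Bigl(\begin{smallmatrix}t^l_{n-1/2\,\underline m}(Z)\\-t^l_{n+1/2\,\underline m}(Z)\end{smallmatrix}\Bigr)$ and $\tilde g^{(1)}_{l,m,n}(Z)=\bigl((l+m+1)t^{l+1/2}_{m+1/2\,\underline n}(Z^{-1}),-(l-m+1)t^{l+1/2}_{m-1/2\,\underline n}(Z^{-1})\bigr)$, $|m|\le l$, $|n|\le l+\frac12$; $f^{(2)}_{l,m,n}(Z)=\Bigl(\begin{smallmatrix}(l-n+1/2)t^l_{n-1/2\,\underline m}(Z)\\(l+n+1/2)t^l_{n+1/2\,\underline m}(Z)\end{smallmatrix}\Bigr)$ and $\tilde g^{(2)}_{l,m,n}(Z)=N(Z)^{-1}\bigl(t^{l-1/2}_{m+1/2\,\underline n}(Z^{-1}),t^{l-1/2}_{m-1/2\,\underline n}(Z^{-1})\bigr)$, $|m|\le l$, $|n|\le l-\frac12$; $f^{(3)}_{l,m,n}(Z)=N(Z)\Bigl(\begin{smallmatrix}t^{l-1}_{n-1/2\,\underline m}(Z)\\-t^{l-1}_{n+1/2\,\underline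 m}(Z)\end{smallmatrix}\Bigr)$ and $\tilde g^{(3)}_{l,m,n}(Z)=N(Z)^{-1}\bigl((l+m)t^{l-1/2}_{m+1/2\,\underline n}(Z^{-1}),-(l-m)t^{l-1/2}_{m-1/2\,\underline n}(Z^{-1})\bigr)$, $|m|\le l-1$, $|n|\le l-\frac12$; $\tilde f^{(1)}_{l,m,n}(Z)=\Bigl(\begin{smallmatrix}t^{l+1/2}_{m\,\underline{n+1/2}}(Z^{-1})\\-t^{l+1/2}_{m\,\underline{n-1/2}}(Z^{-1})\end{smallmatrix}\Bigr)$ and $g^{(1)}_{l,m,n}(Z)=\bigl((l+m+\frac12)t^l_{n\,\underline{m-1/2}}(Z),-(l-m+\frac12)t^l_{n\,\underline{m+1/2}}(Z)\bigr)$, $|m|\le l+\frac12$, $|n|\le l$; $\tilde f^{(2)}_{l,m,n}(Z)=N(Z)^{-1}\Bigl(\begin{smallmatrix}(l-n)t^{l-1/2}_{m\,\underline{n+1/2}}(Z^{-1})\\(l+n)t^{l-1/2}_{m\,\underline{n-1/2}}(Z^{-1})\end{smallmatrix}\Bigr)$ and $g^{(2)}_{l,m,n}(Z)=\bigl(t^l_{n\,\underline{m-1/2}}(Z),t^l_{n\,\underline{m+1/2}}(Z)\bigr)$, $|m|\le l-\frac12$, $|n|\le l$; $\tilde f^{(3)}_{l,m,n}(Z)=N(Z)^{-1}\Bigl(\begin{smallmatrix}t^{l-1/2}_{m\,\underline{n+1/2}}(Z^{-1})\\-t^{l-1/2}_{m\,\underline{n-1/2}}(Z^{-1})\end{smallmatrix}\Bigr)$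 and $g^{(3)}_{l,m,n}(Z)=N(Z)\bigl((l+m-\frac12)t^{l-1}_{n\,\underline{m-1/2}}(Z),-(l-m-\frac12)t^{l-1}_{n\,\underline{m+1/2}}(Z)\bigr)$, $|m|\le l-\frac12$, $|n|\le l-1$. *)

theory Defs
  imports "HOL-Complex_Analysis.Complex_Analysis"
begin

no_notation fps_nth (infixl "$" 75)

subsection \<open>Complexified quaternions as complex two-by-two matrices\<close>

type_synonym HC = "complex^2^2"

definition mat2 :: "complex \<Rightarrow> complex \<Rightarrow> complex \<Rightarrow> complex \<Rightarrow> HC" where
  "mat2 a b c d = vector [vector [a, b], vector [c, d]]"

definition cscale :: "complex \<Rightarrow> HC \<Rightarrow> HC"  (infixr "\<cdot>\<^sub>c" 75) where
  "c \<cdot>\<^sub>c A = (\<chi> i j. c * A$i$j)"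

definition adjugate :: "HC \<Rightarrow> HC" where
  "adjugate Z = mat2 (Z$2$2) (- Z$1$2) (- Z$2$1) (Z$1$1)"

definition cadj :: "HC \<Rightarrow> HC" where
  "cadj Z = (\<chi> i j. cnj (Z$j$i))"

definition col_row :: "complex^2 \<Rightarrow> complex^2 \<Rightarrow> HC" where
  "col_row f g = (\<chi> i j. f$i * g$j)"

definition unit_e :: "nat \<Rightarrow> HC" where
  "unit_e \<mu> = [mat2 1 0 0 1, mat2 0 (-\<i>) (-\<i>) 0, mat2 0 (-1) 1 0, mat2 (-\<i>) 0 0 \<i>] ! \<mu>"

text \<open>The complex coordinates $z^0, z^1, z^2, z^3$ with respect to the basis
  \<^term>\<open>unit_e\<close>, stored at the indices 1, 2, 3, 4; see \<open>qcoord_expansion\<close> below.\<close>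

definition qcoord :: "HC \<Rightarrow> complex^4" where
  "qcoord Z = (\<chi> \<mu>. if \<mu> = 1 then (Z$1$1 + Z$2$2) / 2
                     else if \<mu> = 2 then \<i> * (Z$1$2 + Z$2$1) / 2
                     else if \<mu> = 3 then (Z$2$1 - Z$1$2) / 2
                     else \<i> * (Z$1$1 - Z$2$2) / 2)"

definition pos_def :: "HC \<Rightarrow> bool" where
  "pos_def A \<longleftrightarrow> cadj A = A \<and>
     (\<forall>v. v \<noteq> 0 \<longrightarrow> 0 < Re (\<Sum>i\<in>UNIV. cnj (v$i) * (A *v v)$i))"

definition Dplus :: "real \<Rightarrow> HC set" where
  "Dplus R = {Z. pos_def (mat (of_real (R\<^sup>2)) - Z ** cadj Z)}"

definition Dminus :: "real \<Rightarrow> HC set" where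
  "Dminus R = {Z. pos_def (Z ** cadj Z - mat (of_real (R\<^sup>2)))}"

definition U2 :: "real \<Rightarrow> HC set" where
  "U2 R = {of_real R \<cdot>\<^sub>c Z | Z. cadj Z ** Z = mat 1}"


subsection \<open>Integration of $F\,dV$ over the oriented manifold $U(2)_R$\<close>

text \<open>A chart of $U(2)_R$: the point $R e^{i\theta}(x^0e_0+x^1e_1+x^2e_2+x^3e_3)$, where
  $x$ runs through the real unit three-sphere in Hopf coordinates. It maps the box
  \<open>u2_box\<close> onto $U(2)_R$ and is injective on the interior of the box
  (\<open>u2_param_image\<close>, \<open>u2_param_inj\<close>). The order of the four parameters gives the orientation
  for which $\frac{i}{2\pi^3}\int dV/N(W)^2=1$ (\<open>u2_normalization\<close>).\<close>

fun u2_param :: "real \<Rightarrow> real \<times> real \<times> real \<times> real \<Rightarrow> HC" where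
  "u2_param R (\<theta>, \<psi>, \<alpha>, \<beta>) =
     (of_real R * cis \<theta>) \<cdot>\<^sub>c
       (of_real (cos \<psi> * cos \<alpha>) \<cdot>\<^sub>c unit_e 0 + of_real (sin \<psi> * cos \<beta>) \<cdot>\<^sub>c unit_e 1
      + of_real (sin \<psi> * sin \<beta>) \<cdot>\<^sub>c unit_e 2 + of_real (cos \<psi> * sin \<alpha>) \<cdot>\<^sub>c unit_e 3)"

definition u2_box :: "(real \<times> real \<times> real \<times> real) set" where
  "u2_box = cbox (0, 0, 0, 0) (pi, pi/2, 2*pi, 2*pi)"

text \<open>The density of the pull-back of $dw^0\wedge dw^1\wedge dw^2\wedge dw^3$ along the chart.\<close>

fun u2_jac :: "real \<Rightarrow> real \<times> real \<times> real \<times> real \<Rightarrow> complex" where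
  "u2_jac R (\<theta>, \<psi>, \<alpha>, \<beta>) = det (\<chi> \<mu> \<nu>.
     if \<nu> = 1 then vector_derivative (\<lambda>s. qcoord (u2_param R (s, \<psi>, \<alpha>, \<beta>)) $ \<mu>) (at \<theta>)
     else if \<nu> = 2 then vector_derivative (\<lambda>s. qcoord (u2_param R (\<theta>, s, \<alpha>, \<beta>)) $ \<mu>) (at \<psi>)
     else if \<nu> = 3 then vector_derivative (\<lambda>s. qcoord (u2_param R (\<theta>, \<psi>, s, \<beta>)) $ \<mu>) (at \<alpha>)
     else vector_derivative (\<lambda>s. qcoord (u2_param R (\<theta>, \<psi>, \<alpha>, s)) $ \<mu>) (at \<beta>) :: complex^4^4)"

definition u2_integral :: "real \<Rightarrow> (HC \<Rightarrow> HC) \<Rightarrow> HC" where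
  "u2_integral R F = integral u2_box (\<lambda>u. u2_jac R u \<cdot>\<^sub>c F (u2_param R u))"

definition J' :: "real \<Rightarrow> (HC \<Rightarrow> HC) \<Rightarrow> HC \<Rightarrow> HC \<Rightarrow> HC" where
  "J' R F Z1 Z2 = (\<i> / of_real (2 * pi ^ 3)) \<cdot>\<^sub>c u2_integral R (\<lambda>W.
     (1 / det (W - Z1)) \<cdot>\<^sub>c (W - Z1) ** F W ** (1 / det (W - Z2)) \<cdot>\<^sub>c (W - Z2))"


subsection \<open>Matrix coefficients and basis functions\<close>

text \<open>For \<open>a\<close> a nonnegative half-integer, the indices $-a, -a+1, \dots, a$.\<close>

definition hrange :: "real \<Rightarrow> real set" where
  "hrange a = {m. \<bar>m\<bar> \<le> a \<and> a - m \<in> \<int>}"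

text \<open>The first index of \<open>tcoef\<close> is the degree, the second the plain one and the third the
  underlined one. The exponents below are integers whenever the indices are in range.\<close>

definition tcoef :: "real \<Rightarrow> real \<Rightarrow> real \<Rightarrow> HC \<Rightarrow> complex" where
  "tcoef l n m Z =
    (if n \<in> hrange l \<and> m \<in> hrange l then
       1 / (2 * of_real pi * \<i>) * contour_integral (circlepath 0 1) (\<lambda>s.
         (s * Z$1$1 + Z$2$1) ^ nat \<lfloor>l - m\<rfloor> * (s * Z$1$2 + Z$2$2) ^ nat \<lfloor>l + m\<rfloor>
         * s powi \<lfloor>- l + n\<rfloor> / s)
     else 0)"

definition f1 :: "real \<Rightarrow> real \<Rightarrow> real \<Rightarrow> HC \<Rightarrow> complex^2" where
  "f1 l m n Z = vector [tcoef l (n - 1/2) m Z, - tcoef l (n + 1/2) m Z]"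

definition g1_tilde :: "real \<Rightarrow> real \<Rightarrow> real \<Rightarrow> HC \<Rightarrow> complex^2" where
  "g1_tilde l m n Z = vector
     [of_real (l + m + 1) * tcoef (l + 1/2) (m + 1/2) n (matrix_inv Z),
      - of_real (l - m + 1) * tcoef (l + 1/2) (m - 1/2) n (matrix_inv Z)]"

definition f2 :: "real \<Rightarrow> real \<Rightarrow> real \<Rightarrow> HC \<Rightarrow> complex^2" where
  "f2 l m n Z = vector
     [of_real (l - n + 1/2) * tcoef l (n - 1/2) m Z,
      of_real (l + n + 1/2) * tcoef l (n + 1/2) m Z]"

definition g2_tilde :: "real \<Rightarrow> real \<Rightarrow> real \<Rightarrow> HC \<Rightarrow> complex^2" where
  "g2_tilde l m n Z = inverse (det Z) *s vector
     [tcoef (l - 1/2) (m + 1/2) n (matrix_inv Z),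
      tcoef (l - 1/2) (m - 1/2) n (matrix_inv Z)]"

definition f3 :: "real \<Rightarrow> real \<Rightarrow> real \<Rightarrow> HC \<Rightarrow> complex^2" where
  "f3 l m n Z = det Z *s vector
     [tcoef (l - 1) (n - 1/2) m Z, - tcoef (l - 1) (n + 1/2) m Z]"

definition g3_tilde :: "real \<Rightarrow> real \<Rightarrow> real \<Rightarrow> HC \<Rightarrow> complex^2" where
  "g3_tilde l m n Z = inverse (det Z) *s vector
     [of_real (l + m) * tcoef (l - 1/2) (m + 1/2) n (matrix_inv Z),
      - of_real (l - m) * tcoef (l - 1/2) (m - 1/2) n (matrix_inv Z)]"

definition f1_tilde :: "real \<Rightarrow> real \<Rightarrow> real \<Rightarrow> HC \<Rightarrow> complex^2" where
  "f1_tilde l m n Z = vector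
     [tcoef (l + 1/2) m (n + 1/2) (matrix_inv Z),
      - tcoef (l + 1/2) m (n - 1/2) (matrix_inv Z)]"

definition g1 :: "real \<Rightarrow> real \<Rightarrow> real \<Rightarrow> HC \<Rightarrow> complex^2" where
  "g1 l m n Z = vector
     [of_real (l + m + 1/2) * tcoef l n (m - 1/2) Z,
      - of_real (l - m + 1/2) * tcoef l n (m + 1/2) Z]"

definition f2_tilde :: "real \<Rightarrow> real \<Rightarrow> real \<Rightarrow> HC \<Rightarrow> complex^2" where
  "f2_tilde l m n Z = inverse (det Z) *s vector
     [of_real (l - n) * tcoef (l - 1/2) m (n + 1/2) (matrix_inv Z),
      of_real (l + n) * tcoef (l - 1/2) m (n - 1/2) (matrix_inv Z)]"

definition g2 :: "real \<Rightarrow> real \<Rightarrow> real \<Rightarrow> HC \<Rightarrow> complex^2" where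
  "g2 l m n Z = vector [tcoef l n (m - 1/2) Z, tcoef l n (m + 1/2) Z]"

definition f3_tilde :: "real \<Rightarrow> real \<Rightarrow> real \<Rightarrow> HC \<Rightarrow> complex^2" where
  "f3_tilde l m n Z = inverse (det Z) *s vector
     [tcoef (l - 1/2) m (n + 1/2) (matrix_inv Z),
      - tcoef (l - 1/2) m (n - 1/2) (matrix_inv Z)]"

definition g3 :: "real \<Rightarrow> real \<Rightarrow> real \<Rightarrow> HC \<Rightarrow> complex^2" where
  "g3 l m n Z = det Z *s vector
     [of_real (l + m - 1/2) * tcoef (l - 1) n (m - 1/2) Z,
      - of_real (l - m - 1/2) * tcoef (l - 1) n (m + 1/2) Z]"

text \<open>Summation over the half-integers $l = l_0, l_0+\frac12, l_0+1, \dots$ in increasing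
  order.\<close>

definition half_sums :: "real \<Rightarrow> (real \<Rightarrow> HC) \<Rightarrow> HC \<Rightarrow> bool" where
  "half_sums l0 a S \<longleftrightarrow> (\<lambda>k. a (l0 + real k / 2)) sums S"


subsection \<open>Properties of the coordinates and of the chart\<close>

lemma mat2_nth [simp]:
  "mat2 a b c d $ 1 $ 1 = a" "mat2 a b c d $ 1 $ 2 = b"
  "mat2 a b c d $ 2 $ 1 = c" "mat2 a b c d $ 2 $ 2 = d"
  by (simp_all add: mat2_def)

lemma cscale_nth [simp]: "(c \<cdot>\<^sub>c A) $ i $ j = c * A $ i $ j"
  by (simp add: cscale_def)

lemma HC_eq_iff:
  "(A::HC) = B \<longleftrightarrow> A$1$1 = B$1$1 \<and> A$1$2 = B$1$2 \<and> A$2$1 = B$2$1 \<and> A$2$2 = B$2$2"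
  by (auto simp: vec_eq_iff forall_2)

lemma unit_e_simps [simp]:
  "unit_e 0 = mat2 1 0 0 1" "unit_e 1 = mat2 0 (-\<i>) (-\<i>) 0" "unit_e (Suc 0) = mat2 0 (-\<i>) (-\<i>) 0"
  "unit_e 2 = mat2 0 (-1) 1 0" "unit_e 3 = mat2 (-\<i>) 0 0 \<i>"
  by (simp_all add: unit_e_def)

lemma qcoord_expansion:
  "Z = qcoord Z $ 1 \<cdot>\<^sub>c unit_e 0 + qcoord Z $ 2 \<cdot>\<^sub>c unit_e 1
     + qcoord Z $ 3 \<cdot>\<^sub>c unit_e 2 + qcoord Z $ 4 \<cdot>\<^sub>c unit_e 3"
  by (simp add: HC_eq_iff qcoord_def field_simps)

lemma adjugate_det: "Z ** adjugate Z = mat (det Z)" "adjugate Z ** Z = mat (det Z)"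
  by (simp_all add: HC_eq_iff adjugate_def det_2 matrix_matrix_mult_def sum_2 mat_def algebra_simps)

lemma u2_param_eq:
  "u2_param R (\<theta>, \<psi>, \<alpha>, \<beta>) = (of_real R * cis \<theta>) \<cdot>\<^sub>c
     mat2 (of_real (cos \<psi>) * cis (-\<alpha>)) (- \<i> * of_real (sin \<psi>) * cis (-\<beta>))
          (- \<i> * of_real (sin \<psi>) * cis \<beta>) (of_real (cos \<psi>) * cis \<alpha>)"
proof -
  have 1: "cis x = of_real (cos x) + \<i> * of_real (sin x)" for x
    by (simp add: complex_eq_iff)
  show ?thesis
    unfolding u2_param.simps
    by (simp add: HC_eq_iff 1[of \<alpha>] 1[of \<beta>] 1[of "-\<alpha>"] 1[of "-\<beta>"] algebra_simps)
qed


lemma cis_mult_cancel: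
  "cnj (cis x) = cis (-x)" "cis x * cis (-x) = 1" "cis (-x) * cis x = 1"
  "cis x * (cis (-x) * y) = y" "cis (-x) * (cis x * y) = y"
  by (simp_all add: cis_cnj cis_mult mult.assoc [symmetric])

lemma u2_param_in_U2: "u2_param R u \<in> U2 R"
proof -
  obtain \<theta> \<psi> \<alpha> \<beta> where u: "u = (\<theta>, \<psi>, \<alpha>, \<beta>)" by (metis prod_cases4)
  define c s where "c = complex_of_real (cos \<psi>)" and "s = complex_of_real (sin \<psi>)"
  define Z where "Z = cis \<theta> \<cdot>\<^sub>c
     mat2 (c * cis (-\<alpha>)) (- \<i> * s * cis (-\<beta>)) (- \<i> * s * cis \<beta>) (c * cis \<alpha>)"
  have sc: "c * c + s * s = 1" "s * s + c * c = 1"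
    using sin_cos_squared_add3[of \<psi>] unfolding c_def s_def
    by (metis add.commute of_real_1 of_real_add of_real_mult)+
  have cc: "cnj c = c" "cnj s = s" by (simp_all add: c_def s_def)
  have "cadj Z ** Z = mat 1"
    using sc by (simp add: HC_eq_iff matrix_matrix_mult_def sum_2 mat_def Z_def cadj_def
        cc cis_mult_cancel mult_ac)
  moreover have "u2_param R u = of_real R \<cdot>\<^sub>c Z"
    by (simp only: u u2_param_eq) (simp add: Z_def HC_eq_iff c_def s_def)
  ultimately show ?thesis by (auto simp: U2_def)
qed

lemma polar_angle:
  obtains a where "0 \<le> a" "a < 2 * pi" "z = of_real (cmod z) * cis a"
  using Arg2pi[of z] by (metis cis_conv_exp is_Arg_def)

lemma U2_subset_image:
  assumes "W \<in> U2 R"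
  shows "W \<in> u2_param R ` u2_box"
proof -
  obtain Z where W: "W = of_real R \<cdot>\<^sub>c Z" and Z: "cadj Z ** Z = mat 1"
    using assms by (auto simp: U2_def)
  have "cnj (det Z) * det Z = 1"
  proof -
    have "det (cadj Z) = cnj (det Z)" by (simp add: det_2 cadj_def mult.commute)
    then show ?thesis using Z by (metis det_I det_mul)
  qed
  then have nd: "cmod (det Z) = 1"
    by (metis complex_norm_square mult.commute norm_ge_zero of_real_eq_1_iff power2_eq_1_iff
        norm_not_less_zero neg_less_0_iff_less zero_less_one norm_one power_one norm_of_real)
  obtain t where t: "0 \<le> t" "t < 2 * pi" "det Z = cis t"
    using polar_angle[of "det Z"] nd by auto
  define X where "X = cis (- t/2) \<cdot>\<^sub>c Z"
  have cc: "cis (-t/2) * cis (-t/2) = cis (-t)" by (simp add: cis_mult)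
  have dX: "det X = 1"
  proof -
    have "det X = cis (-t/2) * cis (-t/2) * det Z"
      by (simp add: X_def det_2 algebra_simps)
    then show ?thesis by (simp add: cc t cis_mult)
  qed
  have uX: "cadj X ** X = mat 1"
  proof -
    have "cadj X ** X = (cnj (cis (-t/2)) * cis (-t/2)) \<cdot>\<^sub>c (cadj Z ** Z)"
      by (simp add: HC_eq_iff X_def cadj_def matrix_matrix_mult_def sum_2 algebra_simps)
    also have "\<dots> = mat 1"
      by (simp add: Z cis_cnj cis_mult HC_eq_iff)
    finally show ?thesis .
  qed
  have "cadj X = adjugate X"
  proof -
    have "cadj X = cadj X ** (X ** adjugate X)"
      by (simp add: adjugate_det dX)
    also have "\<dots> = adjugate X" by (simp add: matrix_mul_assoc uX)
    finally show ?thesis .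
  qed
  then have X2: "X$1$1 = cnj (X$2$2)" "X$1$2 = - cnj (X$2$1)"
    by (auto simp: HC_eq_iff cadj_def adjugate_def)
  define a b where "a = X$2$2" and "b = \<i> * X$2$1"
  have ab: "(cmod a)\<^sup>2 + (cmod b)\<^sup>2 = 1"
  proof -
    have "complex_of_real ((cmod a)\<^sup>2 + (cmod b)\<^sup>2) = a * cnj a + b * cnj b"
      by (simp only: of_real_add complex_norm_square)
    also have "\<dots> = det X" using X2 by (simp add: det_2 a_def b_def algebra_simps)
    finally show ?thesis using dX by (metis of_real_eq_1_iff)
  qed
  obtain \<psi> where psi: "0 \<le> \<psi>" "\<psi> \<le> pi/2" "cmod a = cos \<psi>" "cmod b = sin \<psi>"
    using sincos_total_pi_half[of "cmod a" "cmod b"] ab by auto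
  obtain \<alpha> where al: "0 \<le> \<alpha>" "\<alpha> < 2 * pi" "a = of_real (cmod a) * cis \<alpha>" by (rule polar_angle)
  obtain \<beta> where be: "0 \<le> \<beta>" "\<beta> < 2 * pi" "b = of_real (cmod b) * cis \<beta>" by (rule polar_angle)
  have a': "X$2$2 = of_real (cos \<psi>) * cis \<alpha>" using al psi a_def by simp
  have b': "X$2$1 = - \<i> * of_real (sin \<psi>) * cis \<beta>"
  proof -
    have "X$2$1 = - \<i> * b" by (simp add: b_def)
    then show ?thesis using be psi by simp
  qed
  have "W = u2_param R (t/2, \<psi>, \<alpha>, \<beta>)"
  proof -
    have "Z = cis (t/2) \<cdot>\<^sub>c X" by (simp add: X_def HC_eq_iff cis_mult mult.assoc [symmetric])
    then show ?thesis
      unfolding u2_param_eq W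
      by (simp add: HC_eq_iff X2 a' b' cis_cnj del: complex_cnj_cnj)
  qed
  moreover have "(t/2, \<psi>, \<alpha>, \<beta>) \<in> u2_box"
    using t psi al be by (simp add: u2_box_def cbox_Pair_eq)
  ultimately show ?thesis by blast
qed

lemma u2_param_image: "u2_param R ` u2_box = U2 R"
  using u2_param_in_U2 U2_subset_image by blast

lemma det_u2_param: "det (u2_param R (\<theta>, \<psi>, \<alpha>, \<beta>)) = of_real R ^ 2 * cis (2 * \<theta>)"
proof -
  have "det (u2_param R (\<theta>, \<psi>, \<alpha>, \<beta>)) = (of_real R)\<^sup>2 * (cis \<theta> * cis \<theta>)
      * (of_real (cos \<psi>) * of_real (cos \<psi>) * (cis (-\<alpha>) * cis \<alpha>)
        + of_real (sin \<psi>) * of_real (sin \<psi>) * (cis (-\<beta>) * cis \<beta>))"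
    unfolding u2_param_eq by (simp add: det_2 algebra_simps power2_eq_square)
  also have "\<dots> = (of_real R)\<^sup>2 * (cis \<theta> * cis \<theta>)
      * (of_real (cos \<psi>) * of_real (cos \<psi>) + of_real (sin \<psi>) * of_real (sin \<psi>))"
    by (simp add: cis_mult)
  also have "complex_of_real (cos \<psi>) * of_real (cos \<psi>) + of_real (sin \<psi>) * of_real (sin \<psi>) = 1"
    using sin_cos_squared_add3[of \<psi>] by (metis of_real_1 of_real_add of_real_mult)
  finally show ?thesis by (simp add: cis_mult)
qed

lemma cis_eq_imp:
  assumes "cis a = cis b" "0 < a" "a < 2 * pi" "0 < b" "b < 2 * pi"
  shows "a = b"
proof -
  have "sin a = sin b \<and> cos a = cos b" using assms(1) by (simp add: complex_eq_iff)
  then obtain n::int where n: "a = b + 2 * pi * n" using sin_cos_eq_iff by blast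
  have p: "0 < 2 * pi" by simp
  have "2 * pi * real_of_int n < 2 * pi * 1" "2 * pi * (-1) < 2 * pi * real_of_int n"
    using n assms(2-5) by linarith+
  then have "real_of_int n < 1" "-1 < real_of_int n"
    by (simp_all only: mult_less_cancel_left_pos[OF p])
  then have "n = 0" by linarith
  with n show ?thesis by simp
qed

lemma u2_param_inj:
  assumes "R > 0"
  shows "inj_on (u2_param R) ({0<..<pi} \<times> {0<..<pi/2} \<times> {0<..<2*pi} \<times> {0<..<2*pi})"
proof (rule inj_onI)
  fix u v :: "real \<times> real \<times> real \<times> real"
  assume uv: "u \<in> {0<..<pi} \<times> {0<..<pi/2} \<times> {0<..<2*pi} \<times> {0<..<2*pi}"
    "v \<in> {0<..<pi} \<times> {0<..<pi/2} \<times> {0<..<2*pi} \<times> {0<..<2*pi}" and eq: "u2_param R u = u2_param R v"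
  obtain t p a b where u: "u = (t, p, a, b)" by (metis prod_cases4)
  obtain t' p' a' b' where v: "v = (t', p', a', b')" by (metis prod_cases4)
  have r: "0 < t" "t < pi" "0 < p" "p < pi/2" "0 < a" "a < 2*pi" "0 < b" "b < 2*pi"
      "0 < t'" "t' < pi" "0 < p'" "p' < pi/2" "0 < a'" "a' < 2*pi" "0 < b'" "b' < 2*pi"
    using uv by (auto simp: u v)
  have "cis (2 * t) = cis (2 * t')"
    using det_u2_param[of R t p a b] det_u2_param[of R t' p' a' b'] eq assms by (simp add: u v del: u2_param.simps)
  then have t: "t = t'" using cis_eq_imp[of "2*t" "2*t'"] r by auto
  have R: "of_real R * cis t \<noteq> (0::complex)" using assms by simp
  from eq have 1: "of_real (cos p) * cis a = of_real (cos p') * cis a'"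
      "of_real (sin p) * cis b = of_real (sin p') * cis b'"
    using R unfolding u v u2_param_eq t by (auto simp: HC_eq_iff)
  have pos: "cos p > 0" "cos p' > 0" "sin p > 0" "sin p' > 0"
    using r by (auto intro!: cos_gt_zero sin_gt_zero)
  have "cmod (of_real (cos p) * cis a) = cos p" "cmod (of_real (cos p') * cis a') = cos p'"
    using pos by (auto simp: norm_mult)
  then have cp: "cos p = cos p'" using 1 by simp
  have "cmod (of_real (sin p) * cis b) = sin p" "cmod (of_real (sin p') * cis b') = sin p'"
    using pos by (auto simp: norm_mult)
  then have sp: "sin p = sin p'" using 1 by simp
  have p: "p = p'" using cp r cos_inj_pi[of p p'] by auto
  have "cis a = cis a'" "cis b = cis b'" using 1 cp sp pos by auto
  then show "u = v" using cis_eq_imp r t p by (simp add: u v)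
qed

lemma det_4:
  "det (A::'a::comm_ring_1^4^4) =
     A$1$1 * (A$2$2 * (A$3$3 * A$4$4)) - A$1$1 * (A$2$2 * (A$3$4 * A$4$3)) +
     (A$1$1 * (A$2$3 * (A$3$4 * A$4$2)) - A$1$1 * (A$2$3 * (A$3$2 * A$4$4)) +
      (A$1$1 * (A$2$4 * (A$3$2 * A$4$3)) - A$1$1 * (A$2$4 * (A$3$3 * A$4$2)))) +
     (A$1$2 * (A$2$1 * (A$3$4 * A$4$3)) - A$1$2 * (A$2$1 * (A$3$3 * A$4$4)) +
      (A$1$2 * (A$2$3 * (A$3$1 * A$4$4)) - A$1$2 * (A$2$3 * (A$3$4 * A$4$1)) +
       (A$1$2 * (A$2$4 * (A$3$3 * A$4$1)) - A$1$2 * (A$2$4 * (A$3$1 * A$4$3)))) +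
      (A$1$3 * (A$2$2 * (A$3$4 * A$4$1)) - A$1$3 * (A$2$2 * (A$3$1 * A$4$4)) +
       (A$1$3 * (A$2$1 * (A$3$2 * A$4$4)) - A$1$3 * (A$2$1 * (A$3$4 * A$4$2)) +
        (A$1$3 * (A$2$4 * (A$3$1 * A$4$2)) - A$1$3 * (A$2$4 * (A$3$2 * A$4$1)))) +
       (A$1$4 * (A$2$2 * (A$3$1 * A$4$3)) - A$1$4 * (A$2$2 * (A$3$3 * A$4$1)) +
        (A$1$4 * (A$2$3 * (A$3$2 * A$4$1)) - A$1$4 * (A$2$3 * (A$3$1 * A$4$2)) +
         (A$1$4 * (A$2$1 * (A$3$3 * A$4$2)) - A$1$4 * (A$2$1 * (A$3$2 * A$4$3)))))))"
proof -
  have f: "finite {2::4, 3, 4}" "1 \<notin> {2::4, 3, 4}" "finite {3::4, 4}" "2 \<notin> {3::4, 4}"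
    "finite {4::4}" "3 \<notin> {4::4}"
    by auto
  show ?thesis
    unfolding det_def UNIV_4
    unfolding sum_over_permutations_insert[OF f(1,2)]
    unfolding sum_over_permutations_insert[OF f(3,4)]
    unfolding sum_over_permutations_insert[OF f(5,6)]
    unfolding permutes_sing
    by (simp add: sign_swap_id permutation_swap_id sign_compose swap_id_eq permutation_compose)
qed


lemma qcoord_u2_param:
  "qcoord (u2_param R (\<theta>, \<psi>, \<alpha>, \<beta>)) $ 1 = of_real R * cis \<theta> * of_real (cos \<psi> * cos \<alpha>)"
  "qcoord (u2_param R (\<theta>, \<psi>, \<alpha>, \<beta>)) $ 2 = of_real R * cis \<theta> * of_real (sin \<psi> * cos \<beta>)"
  "qcoord (u2_param R (\<theta>, \<psi>, \<alpha>, \<beta>)) $ 3 = of_real R * cis \<theta> * of_real (sin \<psi> * sin \<beta>)"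
  "qcoord (u2_param R (\<theta>, \<psi>, \<alpha>, \<beta>)) $ 4 = of_real R * cis \<theta> * of_real (cos \<psi> * sin \<alpha>)"
  by (simp_all add: qcoord_def field_simps)

lemma vector_derivative_cis: "vector_derivative (\<lambda>s. c * cis s * d) (at t) = c * (\<i> * cis t) * d"
proof (rule vector_derivative_at)
  have "((\<lambda>z. c * exp (\<i> * z) * d) has_field_derivative c * (\<i> * exp (\<i> * of_real t)) * d)
      (at (of_real t))"
    by (auto intro!: derivative_eq_intros)
  then show "((\<lambda>s. c * cis s * d) has_vector_derivative c * (\<i> * cis t) * d) (at t)"
    unfolding cis_conv_exp by (rule has_vector_derivative_real_field)
qed

lemma vector_derivative_cmult_real:
  assumes "(f has_real_derivative D) (at t)"
  shows "vector_derivative (\<lambda>s. c * complex_of_real (f s)) (at t) = c * of_real D"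
proof (rule vector_derivative_at)
  show "((\<lambda>s. c * complex_of_real (f s)) has_vector_derivative c * of_real D) (at t)"
    by (intro has_vector_derivative_mult_right has_vector_derivative_of_real assms)
qed

lemma vector_derivative_products:
  "vector_derivative (\<lambda>s. c * complex_of_real (cos s * d)) (at t) = c * of_real (- sin t * d)"
  "vector_derivative (\<lambda>s. c * complex_of_real (sin s * d)) (at t) = c * of_real (cos t * d)"
  "vector_derivative (\<lambda>s. c * complex_of_real (d * cos s)) (at t) = c * of_real (d * - sin t)"
  "vector_derivative (\<lambda>s. c * complex_of_real (d * sin s)) (at t) = c * of_real (d * cos t)"
  by (rule vector_derivative_cmult_real; auto intro!: derivative_eq_intros)+

lemma u2_jac_eq:
  "u2_jac R (\<theta>, \<psi>, \<alpha>, \<beta>) = - \<i> * of_real R ^ 4 * cis (4 * \<theta>) * of_real (cos \<psi> * sin \<psi>)"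
proof -
  define k where "k = of_real R * cis \<theta>"
  define cp sp ca sa cb sb where "cp = complex_of_real (cos \<psi>)" "sp = complex_of_real (sin \<psi>)"
    "ca = complex_of_real (cos \<alpha>)" "sa = complex_of_real (sin \<alpha>)"
    "cb = complex_of_real (cos \<beta>)" "sb = complex_of_real (sin \<beta>)"
  note d = this
  have sq: "cp\<^sup>2 + sp\<^sup>2 = 1" "ca\<^sup>2 + sa\<^sup>2 = 1" "cb\<^sup>2 + sb\<^sup>2 = 1"
    unfolding d by (metis of_real_1 of_real_add of_real_power sin_cos_squared_add2)+
  have k4: "k ^ 4 = of_real R ^ 4 * cis (4 * \<theta>)"
    by (simp add: k_def power_mult_distrib Complex.DeMoivre)
  have "u2_jac R (\<theta>, \<psi>, \<alpha>, \<beta>) = det (\<chi> \<mu> \<nu>.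
      if \<mu> = 1 then (if \<nu> = 1 then \<i> * k * (cp * ca) else if \<nu> = 2 then - k * (sp * ca)
                     else if \<nu> = 3 then - k * (cp * sa) else 0)
      else if \<mu> = 2 then (if \<nu> = 1 then \<i> * k * (sp * cb) else if \<nu> = 2 then k * (cp * cb)
                     else if \<nu> = 3 then 0 else - k * (sp * sb))
      else if \<mu> = 3 then (if \<nu> = 1 then \<i> * k * (sp * sb) else if \<nu> = 2 then k * (cp * sb)
                     else if \<nu> = 3 then 0 else k * (sp * cb))
      else (if \<nu> = 1 then \<i> * k * (cp * sa) else if \<nu> = 2 then - k * (sp * sa)
                     else if \<nu> = 3 then k * (cp * ca) else 0) :: complex^4^4)"
    unfolding u2_jac.simps
    apply (rule arg_cong[where f = det])
    apply (simp only: vec_eq_iff forall_4 vec_lambda_beta)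
    apply (simp only: qcoord_u2_param vector_derivative_cis vector_derivative_products
        vector_derivative_const_at if_True if_False simp_thms)
    apply (simp add: qcoord_u2_param vector_derivative_cis vector_derivative_products d k_def
        del: u2_param.simps)
    done
  also have "\<dots> = - \<i> * k ^ 4 * (cp * sp) * ((cp\<^sup>2 + sp\<^sup>2) * (ca\<^sup>2 + sa\<^sup>2) * (cb\<^sup>2 + sb\<^sup>2))"
    by (simp add: det_4) algebra
  also have "\<dots> = - \<i> * of_real R ^ 4 * cis (4 * \<theta>) * (cp * sp)"
    unfolding sq k4 by simp
  finally show ?thesis by (simp add: d del: u2_jac.simps)
qed


lemma u2_normalization:
  assumes "R > 0"
  shows "\<i> / of_real (2 * pi ^ 3) *
    integral u2_box (\<lambda>u. u2_jac R u / (det (u2_param R u))\<^sup>2) = 1"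
proof -
  define h :: "real \<times> real \<times> real \<times> real \<Rightarrow> complex"
    where "h = (\<lambda>u. - \<i> * of_real (cos (fst (snd u)) * sin (fst (snd u))))"
  have "u2_jac R u / (det (u2_param R u))\<^sup>2 = h u" for u
  proof -
    obtain t p a b where u: "u = (t, p, a, b)" by (metis prod_cases4)
    have "(cis (2 * t))\<^sup>2 = cis (4 * t)" by (simp add: Complex.DeMoivre)
    then have "(of_real R ^ 2 * cis (2 * t))\<^sup>2 = of_real R ^ 4 * cis (4 * t)"
      by (simp add: power_mult_distrib flip: power_mult)
    moreover have "of_real R ^ 4 * cis (4 * t) \<noteq> 0" using assms by simp
    ultimately show ?thesis
      unfolding u u2_jac_eq det_u2_param h_def by simp
  qed
  then have "integral u2_box (\<lambda>u. u2_jac R u / (det (u2_param R u))\<^sup>2) = integral u2_box h"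
    by simp
  also have "\<dots> = integral (cbox 0 pi) (\<lambda>t. integral (cbox (0, 0, 0) (pi/2, 2*pi, 2*pi)) (\<lambda>v. h (t, v)))"
    unfolding u2_box_def
    by (rule integral_prod_continuous) (auto simp: h_def intro!: continuous_intros)
  also have "\<dots> = integral (cbox 0 pi) (\<lambda>t. integral (cbox 0 (pi/2)) (\<lambda>p.
      integral (cbox (0, 0) (2*pi, 2*pi)) (\<lambda>v. h (t, p, v))))"
    by (subst integral_prod_continuous) (auto simp: h_def intro!: continuous_intros)
  also have "\<dots> = integral (cbox 0 pi) (\<lambda>t. integral (cbox 0 (pi/2)) (\<lambda>p.
      of_real (4 * pi ^ 2 * (cos p * sin p)) * - \<i>))"
    by (simp add: h_def content_Pair power2_eq_square scaleR_conv_of_real mult_ac)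
  also have "integral (cbox 0 (pi/2)) (\<lambda>p. of_real (4 * pi ^ 2 * (cos p * sin p)) * - \<i>)
      = of_real (2 * pi ^ 2) * - \<i>"
  proof -
    have "((\<lambda>p. 4 * pi ^ 2 * (cos p * sin p)) has_integral
        2 * pi ^ 2 * (sin (pi/2)) ^ 2 - 2 * pi ^ 2 * (sin 0) ^ 2) {0..pi/2}"
      by (rule fundamental_theorem_of_calculus)
        (auto intro!: derivative_eq_intros simp flip: has_real_derivative_iff_has_vector_derivative)
    then have "((\<lambda>p. 4 * pi ^ 2 * (cos p * sin p)) has_integral 2 * pi ^ 2) {0..pi/2}"
      by simp
    then have "((\<lambda>p. complex_of_real (4 * pi ^ 2 * (cos p * sin p)) * - \<i>) has_integral
        of_real (2 * pi ^ 2) * - \<i>) {0..pi/2}"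
      by (intro has_integral_mult_left has_integral_of_real)
    then show ?thesis by (simp only: cbox_interval integral_unique)
  qed
  also have "integral (cbox 0 pi) (\<lambda>t::real. of_real (2 * pi ^ 2) * - \<i>) = - \<i> * of_real (2 * pi ^ 3)"
    by (simp add: scaleR_conv_of_real power2_eq_square power3_eq_cube)
  finally show ?thesis by simp
qed

end

theory Submission
  imports Defs
begin

text \<open>
  Let $X$ be the variable in $\mathbb D^+_R$, let $Y$ be the inverse of the variable in
  $\mathbb D^-_R$, and put $A = X^+$, $B = Y^+$, $p = \mathrm{tr}(XY)$, $d = \det(XY)$.

  \<^emph>\<open>The integral.\<close> A point $W$ of $U(2)_R$ satisfies $W^+ = R V^*$ with $V$ unitary, and
  the volume form divided by $N(W)^2$ is a multiple of Haar measure. The kernel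
  $(W - Z)/N(W - Z)$ is the inverse of $(W - Z)^+ = W^+ - Z^+$. Therefore the integrand is, up to a constant and a rescaling that
  absorbs $R$, equal to $(1 - VA)^{-1} B (1 - V^*B)^{-1}$ (\<open>cauchy_kernel_neumann\<close>), and two
  Neumann series reduce the claim to the means of $(VA)^j B (V^*B)^k$ (\<open>haar_mean_neumann\<close>).

  \<^emph>\<open>The means.\<close> The functions $t^l_{nm}$ are the matrix coefficients of $\mathrm{Sym}^{2l}$.
  Schur orthogonality for $\det^a \otimes \mathrm{Sym}^k$ (\<open>schur_orthogonal_haar_unitary\<close>) is proved
  by integrating powers of linear forms over the three-sphere and polarizing. A power $M^k$ is not
  of one type: if $h_k$ denotes the character of $\mathrm{Sym}^k$ and $\Phi_k(M)$ the matrix for which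
  $\mathrm{tr}(\Phi_k(M)E)$ is the derivative of $h_k(M + \epsilon ME)$ at $\epsilon = 0$, then
  $k M^k = \Phi_k(M) - \det M\,(h_{k-2}(M) + \Phi_{k-2}(M))$, where the two summands belong to
  $\mathrm{Sym}^k$ and $\det \otimes \mathrm{Sym}^{k-2}$ (\<open>trace_mpow_sym_pair\<close>). Hence the mean vanishes
  for $j \neq k$, and for $j = k$ it is given by second derivatives of $h_k(AB)$ and by $h_{k-2}(AB)$
  with its derivatives up to order two. Since $h_k$ is the coefficient of $\tau^k$ in $1/D$ with
  $D = 1 - p\tau + d\tau^2$, such derivatives are coefficients of $1/D^2$ and $1/D^3$, and the relations between these leave an
  expression in the coefficients of $1/D^2$ alone (\<open>haar_mean_power_product\<close>).

  \<^emph>\<open>The basis functions.\<close> The factors such as $l + m + 1$ are the ones that differentiation of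
  $t^{l+1/2}$ produces. By multiplicativity of $\mathrm{Sym}^k$, the sums over $m, n$ of the products
  $f \cdot g$ are therefore the gradients of $h_{2l+1}(XY)$ in $X$ and of $h_{2l}(XY)$ in $Y$
  (\<open>char_grad_left\<close>, \<open>char_grad_right\<close>), the same for both halves of the theorem. They match
  the means term by term with $k = 2l$.

  \<^emph>\<open>The second half\<close> is the transpose of the first one, because $V^T$ satisfies the same
  orthogonality relations as $V$. The three series converge separately: the roots of
  $\tau^2 - p\tau + d$ are the eigenvalues of $AB$ and have modulus less than $1$, so the
  coefficients of $1/D^2$ are absolutely summable (\<open>summable_lucas2_contraction\<close>).
\<close>

section \<open>Coefficients of the powers of a quadratic\<close>

text \<open>With $D = 1 - p\tau + d\tau^2$, the coefficients of $\tau^n$ in $1/D$, $1/D^2$, $1/D^3$ are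
  \<open>lucas p d (n + 1)\<close>, \<open>lucas2 p d (n + 2)\<close> and \<open>lucas3 p d (n + 3)\<close>. The shifts provide the
  zero coefficients of negative index and let each sequence feed the next one at the same index.\<close>

fun lucas :: "complex \<Rightarrow> complex \<Rightarrow> nat \<Rightarrow> complex" where
  "lucas p d 0 = 0"
| "lucas p d (Suc 0) = 1"
| "lucas p d (Suc (Suc n)) = p * lucas p d (Suc n) - d * lucas p d n"

fun lucas2 :: "complex \<Rightarrow> complex \<Rightarrow> nat \<Rightarrow> complex" where
  "lucas2 p d 0 = 0"
| "lucas2 p d (Suc 0) = 0"
| "lucas2 p d (Suc (Suc n)) = p * lucas2 p d (Suc n) - d * lucas2 p d n + lucas p d (Suc n)"

fun lucas3 :: "complex \<Rightarrow> complex \<Rightarrow> nat \<Rightarrow> complex" where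
  "lucas3 p d 0 = 0"
| "lucas3 p d (Suc 0) = 0"
| "lucas3 p d (Suc (Suc n)) = p * lucas3 p d (Suc n) - d * lucas3 p d n + lucas2 p d (Suc n)"

text \<open>This is $(\tau/D)' = (1 - d\tau^2)/D^2$, read off at $\tau^n$.\<close>

lemma lucas_eq_lucas2:
  "of_nat (n + 1) * lucas p d (n + 1) = lucas2 p d (n + 2) - d * lucas2 p d n"
proof (induction n rule: induct_nat_012)
  case (ge2 n)
  then show ?case by (simp add: algebra_simps) algebra
qed auto

text \<open>This is $(1/D)' = (p - 2d\tau)/D^2$, read off at $\tau^n$.\<close>

lemma lucas_eq_lucas2':
  "of_nat (n + 1) * lucas p d (n + 2) = p * lucas2 p d (n + 2) - 2 * d * lucas2 p d (n + 1)"
  using lucas_eq_lucas2[of "n + 1" p d] by (simp add: algebra_simps)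

text \<open>This is $(\tau^2/D^2)' = 2\tau(1 - d\tau^2)/D^3$, read off at $\tau^n$.\<close>

lemma lucas2_eq_lucas3:
  "of_nat (n + 1) * lucas2 p d (n + 1) = 2 * (lucas3 p d (n + 2) - d * lucas3 p d n)"
proof (induction n rule: induct_nat_012)
  case (ge2 n)
  have "of_nat (n + 1) * lucas p d (n + 2) = p * lucas2 p d (n + 2) - 2 * d * lucas2 p d (n + 1)"
    by (rule lucas_eq_lucas2')
  with ge2 lucas_eq_lucas2[of "n + 1" p d] show ?case by (simp add: algebra_simps) algebra
qed auto

text \<open>This is $(1/D^2)' = 2(p - 2d\tau)/D^3$, read off at $\tau^{n-1}$.\<close>

lemma lucas2_eq_lucas3':
  "of_nat n * lucas2 p d (n + 2) = 2 * p * lucas3 p d (n + 2) - 4 * d * lucas3 p d (n + 1)"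
  using lucas2_eq_lucas3[of "n + 1" p d] by (simp add: algebra_simps)

text \<open>Here $\partial_p(1/D) = \tau/D^2$ and $\partial_d(1/D) = -\tau^2/D^2$; the shifts of the indices
  absorb the powers of $\tau$.\<close>

lemma lucas_has_derivative:
  assumes "(p has_field_derivative p') (at x)" "(d has_field_derivative d') (at x)"
  shows "((\<lambda>x. lucas (p x) (d x) n) has_field_derivative
           lucas2 (p x) (d x) n * p' - lucas2 (p x) (d x) (n - 1) * d') (at x)"
proof (induction n rule: induct_nat_012)
  case (ge2 n)
  have "((\<lambda>x. p x * lucas (p x) (d x) (Suc n) - d x * lucas (p x) (d x) n) has_field_derivative
      (p' * lucas (p x) (d x) (Suc n) + (lucas2 (p x) (d x) (Suc n) * p' - lucas2 (p x) (d x) (Suc n - 1) * d') * p x)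
     - (d' * lucas (p x) (d x) n + (lucas2 (p x) (d x) n * p' - lucas2 (p x) (d x) (n - 1) * d') * d x)) (at x)"
    by (intro DERIV_diff DERIV_mult assms ge2)
  then show ?case by (cases n) (simp_all add: algebra_simps)
qed auto

lemma lucas2_has_derivative:
  assumes "(p has_field_derivative p') (at x)" "(d has_field_derivative d') (at x)"
  shows "((\<lambda>x. lucas2 (p x) (d x) n) has_field_derivative
           2 * (lucas3 (p x) (d x) n * p' - lucas3 (p x) (d x) (n - 1) * d')) (at x)"
proof (induction n rule: induct_nat_012)
  case (ge2 n)
  have "((\<lambda>x. p x * lucas2 (p x) (d x) (Suc n) - d x * lucas2 (p x) (d x) n + lucas (p x) (d x) (Suc n)) has_field_derivative
      (p' * lucas2 (p x) (d x) (Suc n) + 2 * (lucas3 (p x) (d x) (Suc n) * p' - lucas3 (p x) (d x) (Suc n - 1) * d') * p x)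
     - (d' * lucas2 (p x) (d x) n + 2 * (lucas3 (p x) (d x) n * p' - lucas3 (p x) (d x) (n - 1) * d') * d x)
     + (lucas2 (p x) (d x) (Suc n) * p' - lucas2 (p x) (d x) (Suc n - 1) * d')) (at x)"
    by (intro DERIV_diff DERIV_mult DERIV_add assms ge2 lucas_has_derivative)
  then show ?case by (cases n) (simp_all add: algebra_simps)
qed auto

section \<open>Symmetric powers of two-by-two matrices\<close>

text \<open>Entry $(i, j)$ of $\mathrm{Sym}^k(Z)$ in the basis of monomials $s^j$: the row $(s, 1)Z$ has the entries
  $s z_{11} + z_{21}$ and $s z_{12} + z_{22}$. The number $t^l_{nm}(Z)$ is the entry with $k = 2l$,
  $i = l - n$, $j = l - m$ (\<open>tcoef_eq\<close> below).\<close>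

definition symcoef :: "nat \<Rightarrow> HC \<Rightarrow> nat \<Rightarrow> nat \<Rightarrow> complex" where
  "symcoef k Z i j = coeff ([:Z$2$1, Z$1$1:] ^ j * [:Z$2$2, Z$1$2:] ^ (k - j)) i"

lemma degree_linear_powers:
  fixes a b c d :: "'a::comm_semiring_1"
  shows "degree ([:a, b:] ^ j * [:c, d:] ^ m) \<le> j + m"
proof (rule order_trans[OF degree_mult_le add_mono])
  show "degree ([:a, b:] ^ j) \<le> j" 
    using degree_power_le[of "[:a, b:]" j] by (simp split: if_splits)
  show "degree ([:c, d:] ^ m) \<le> m"
    using degree_power_le[of "[:c, d:]" m] by (simp split: if_splits)
qed

lemma symcoef_eq_0: "j \<le> k \<Longrightarrow> k < i \<Longrightarrow> symcoef k Z i j = 0"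
  unfolding symcoef_def
  by (rule coeff_eq_0, rule le_less_trans[OF degree_linear_powers]) simp

lemma coeff_linear_mult:
  "coeff ([:b, a:] * P) (Suc i) = a * coeff P i + b * coeff P (Suc i)"
  by (simp add: add.commute)

text \<open>The sum over \<open>l\<close> substitutes $u, v$ for the variables of the binary form of degree $k$ with
  dehomogenization $P$; a linear factor of the form is substituted separately.\<close>

lemma binary_form_linear_mult:
  fixes u v :: "'a::comm_ring_1 poly"
  assumes "degree P \<le> k"
  shows "(\<Sum>l\<le>Suc k. smult (coeff ([:b, a:] * P) l) (u ^ l * v ^ (Suc k - l)))
    = (smult a u + smult b v) * (\<Sum>l\<le>k. smult (coeff P l) (u ^ l * v ^ (k - l)))"
proof -
  have P0: "coeff P (Suc k) = 0" using assms by (intro coeff_eq_0) simp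
  have "(\<Sum>l\<le>Suc k. smult (coeff ([:b, a:] * P) l) (u ^ l * v ^ (Suc k - l)))
     = (\<Sum>l\<le>Suc k. smult (b * coeff P l) (u ^ l * v ^ (Suc k - l)))
     + (\<Sum>l\<le>Suc k. smult (coeff (pCons 0 (smult a P)) l) (u ^ l * v ^ (Suc k - l)))"
    by (simp add: smult_add_left sum.distrib del: sum.atMost_Suc)
  also have "(\<Sum>l\<le>Suc k. smult (b * coeff P l) (u ^ l * v ^ (Suc k - l)))
     = (\<Sum>l\<le>k. smult b v * smult (coeff P l) (u ^ l * v ^ (k - l)))"
    by (simp add: P0) (rule sum.cong, auto simp: Suc_diff_le mult_ac)
  also have "(\<Sum>l\<le>Suc k. smult (coeff (pCons 0 (smult a P)) l) (u ^ l * v ^ (Suc k - l)))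
     = (\<Sum>l\<le>k. smult a u * smult (coeff P l) (u ^ l * v ^ (k - l)))"
    by (subst sum.atMost_Suc_shift) (simp add: mult_ac)
  finally show ?thesis by (simp only: sum_distrib_left distrib_right sum.distrib add.commute)
qed

lemma binary_form_linear_powers:
  fixes u v :: "'a::comm_ring_1 poly"
  shows
  "(\<Sum>l\<le>j + m. smult (coeff ([:b, a:] ^ j * [:d, c:] ^ m) l) (u ^ l * v ^ (j + m - l)))
    = (smult a u + smult b v) ^ j * (smult c u + smult d v) ^ m"
proof (induction j)
  case 0
  show ?case
  proof (induction m)
    case (Suc m)
    have "degree ([:d, c:] ^ m) \<le> m" using degree_linear_powers[of _ _ 0 d c m] by simp
    from binary_form_linear_mult[OF this, where b = d and a = c and u = u and v = v] Suc show ?case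
      by (simp del: sum.atMost_Suc mult_pCons_left)
  qed auto
next
  case (Suc j)
  from binary_form_linear_mult[OF degree_linear_powers[of b a j d c m], where b = b and a = a and u = u and v = v] Suc show ?case
    by (simp del: sum.atMost_Suc mult_pCons_left add: mult.assoc)
qed

text \<open>A column of $\mathrm{Sym}^k(Y)$ is a binary form, and substituting the row $(s, 1)X$ into it gives
  the corresponding column of $\mathrm{Sym}^k(XY)$.\<close>

lemma symcoef_mult:
  assumes "j \<le> k"
  shows "symcoef k (X ** Y) i j = (\<Sum>l\<le>k. symcoef k X i l * symcoef k Y l j)"
proof -
  define u v where "u = [:X$2$1, X$1$1:]" and "v = [:X$2$2, X$1$2:]"
  have "[:(X ** Y)$2$1, (X ** Y)$1$1:] = smult (Y$1$1) u + smult (Y$2$1) v"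
    "[:(X ** Y)$2$2, (X ** Y)$1$2:] = smult (Y$1$2) u + smult (Y$2$2) v"
    by (simp_all add: u_def v_def matrix_matrix_mult_def sum_2 mult.commute)
  then have "symcoef k (X ** Y) i j = coeff ((smult (Y$1$1) u + smult (Y$2$1) v) ^ j
      * (smult (Y$1$2) u + smult (Y$2$2) v) ^ (k - j)) i"
    by (simp add: symcoef_def)
  also have "\<dots> = coeff (\<Sum>l\<le>k. smult (symcoef k Y l j) (u ^ l * v ^ (k - l))) i"
    using binary_form_linear_powers[where j = j and m = "k - j" and u = u and v = v, symmetric] assms
    by (simp add: symcoef_def)
  also have "\<dots> = (\<Sum>l\<le>k. symcoef k X i l * symcoef k Y l j)"
    by (simp add: coeff_sum symcoef_def u_def v_def mult.commute)
  finally show ?thesis .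
qed

text \<open>Splitting off one linear factor of a column expresses $\mathrm{Sym}^{k+1}$ through $\mathrm{Sym}^k$. For
  the trace this brings in the sum $w$ of the entries below the diagonal, which satisfies a similar
  recursion; eliminating $w$ leaves the recursion of the coefficients of
  $1/(1 - \mathrm{tr}(Z)\tau + \det(Z)\tau^2)$.\<close>

lemma trace_symcoef:
  "(\<Sum>i\<le>k. symcoef k Z i i) = lucas (trace Z) (det Z) (Suc k)"
proof -
  define c where "c k = (\<Sum>i\<le>k. symcoef k Z i i)" for k
  define w where "w k = (\<Sum>i<k. symcoef k Z (Suc i) i)" for k
  have first: "symcoef (Suc k) Z (Suc i) (Suc j)
      = Z$1$1 * symcoef k Z i j + Z$2$1 * symcoef k Z (Suc i) j" for k i j
    by (simp add: symcoef_def mult.assoc coeff_linear_mult del: mult_pCons_left)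
  have second: "symcoef (Suc k) Z (Suc i) j = Z$1$2 * symcoef k Z i j + Z$2$2 * symcoef k Z (Suc i) j"
    if "j \<le> k" for k i j
    using that by (simp add: symcoef_def Suc_diff_le mult.left_commute[of "_ ^ j"] coeff_linear_mult
        del: mult_pCons_left mult_pCons_right)
  have corner: "symcoef k Z 0 0 = Z$2$2 ^ k" for k
    by (simp add: symcoef_def coeff_0_power)
  have w': "(\<Sum>i\<le>k. symcoef k Z (Suc i) i) = w k" for k
    by (simp add: w_def symcoef_eq_0 flip: lessThan_Suc_atMost)
  have c: "c (Suc k) = Z$2$2 ^ Suc k + Z$1$1 * c k + Z$2$1 * w k" for k
  proof -
    have "c (Suc k) = symcoef (Suc k) Z 0 0 + (\<Sum>i\<le>k. symcoef (Suc k) Z (Suc i) (Suc i))"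
      unfolding c_def by (rule sum.atMost_Suc_shift)
    then show ?thesis unfolding w'[symmetric] 
      by (simp add: corner first c_def sum.distrib sum_distrib_left)
  qed
  have w: "w (Suc k) = Z$1$2 * c k + Z$2$2 * w k" for k
  proof -
    have "w (Suc k) = (\<Sum>i\<le>k. symcoef (Suc k) Z (Suc i) i)" by (simp add: w_def lessThan_Suc_atMost)
    also have "\<dots> = (\<Sum>i\<le>k. Z$1$2 * symcoef k Z i i + Z$2$2 * symcoef k Z (Suc i) i)"
      by (rule sum.cong) (auto simp: second)
    finally show ?thesis unfolding w'[symmetric] by (simp add: c_def sum.distrib sum_distrib_left)
  qed
  have "c k = lucas (trace Z) (det Z) (Suc k)"
  proof (induction k rule: induct_nat_012)
    case 0 show ?case by (simp add: c_def corner)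
  next
    case 1
    have "c 0 = 1" "w 0 = 0" by (simp_all add: c_def w_def corner)
    then show ?case using c[of 0] by (simp add: trace_def sum_2)
  next
    case (ge2 k)
    have "c (Suc (Suc k)) = trace Z * c (Suc k) - det Z * c k"
      unfolding c[of "Suc k"] w[of k] using c[of k] by (simp add: trace_def sum_2 det_2 algebra_simps)
    then show ?case using ge2 by simp
  qed
  then show ?thesis by (simp add: c_def)
qed

lemma trace_symcoef_mult:
  "(\<Sum>i\<le>k. \<Sum>j\<le>k. symcoef k X i j * symcoef k Y j i) = lucas (trace (X ** Y)) (det X * det Y) (Suc k)"
  using trace_symcoef[of k "X ** Y"] by (simp add: det_mul symcoef_mult)

section \<open>Derivatives of the character\<close>

text \<open>The derivative of \<open>symcoef k\<close> at \<open>Z\<close> in the direction \<open>E\<close>, by the product rule. At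
  \<open>j = 0\<close> and at \<open>j = k\<close> one of the two terms has the factor zero, so the truncated exponent
  there is harmless.\<close>

definition dsymcoef :: "nat \<Rightarrow> HC \<Rightarrow> HC \<Rightarrow> nat \<Rightarrow> nat \<Rightarrow> complex" where
  "dsymcoef k Z E i j =
     of_nat j * coeff ([:E$2$1, E$1$1:] * ([:Z$2$1, Z$1$1:] ^ (j - 1) * [:Z$2$2, Z$1$2:] ^ (k - j))) i
   + of_nat (k - j) * coeff ([:E$2$2, E$1$2:] * ([:Z$2$1, Z$1$1:] ^ j * [:Z$2$2, Z$1$2:] ^ (k - j - 1))) i"

text \<open>Differentiability of a polynomial-valued function is meant coefficient by coefficient.\<close>

definition has_poly_derivative :: "(complex \<Rightarrow> complex poly) \<Rightarrow> complex poly \<Rightarrow> complex \<Rightarrow> bool" where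
  "has_poly_derivative f f' x \<longleftrightarrow> (\<forall>i. ((\<lambda>e. coeff (f e) i) has_field_derivative coeff f' i) (at x))"

lemma has_poly_derivative_mult:
  assumes "has_poly_derivative f f' x" "has_poly_derivative g g' x"
  shows "has_poly_derivative (\<lambda>e. f e * g e) (f' * g x + f x * g') x"
  unfolding has_poly_derivative_def
proof
  fix i
  have "((\<lambda>e. \<Sum>l\<le>i. coeff (f e) l * coeff (g e) (i - l)) has_field_derivative
     (\<Sum>l\<le>i. coeff f' l * coeff (g x) (i - l) + coeff g' (i - l) * coeff (f x) l)) (at x)"
    using assms by (intro DERIV_sum DERIV_mult) (auto simp: has_poly_derivative_def)
  also have "(\<Sum>l\<le>i. coeff f' l * coeff (g x) (i - l) + coeff g' (i - l) * coeff (f x) l)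
      = coeff (f' * g x + f x * g') i"
    by (simp add: coeff_mult sum.distrib mult.commute[of "coeff g' _"])
  finally show "((\<lambda>e. coeff (f e * g e) i) has_field_derivative coeff (f' * g x + f x * g') i) (at x)"
    by (simp only: coeff_mult)
qed

lemma has_poly_derivative_power:
  assumes "has_poly_derivative f f' x"
  shows "has_poly_derivative (\<lambda>e. f e ^ n) (smult (of_nat n) (f' * f x ^ (n - 1))) x"
proof (induction n)
  case 0 show ?case by (simp add: has_poly_derivative_def)
next
  case (Suc n)
  have "f' * f x ^ n + f x * smult (of_nat n) (f' * f x ^ (n - 1)) = smult (of_nat (Suc n)) (f' * f x ^ n)"
    unfolding of_nat_Suc smult_add_left by (cases n) (simp_all add: mult_ac)
  with has_poly_derivative_mult[OF assms Suc] show ?case by simp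
qed

lemma has_poly_derivative_linear:
  "has_poly_derivative (\<lambda>e. [:a + e * a', b + e * b':]) [:a', b':] x"
  unfolding has_poly_derivative_def
  by (auto simp: coeff_pCons split: nat.split intro!: derivative_eq_intros)

lemma symcoef_has_derivative:
  "((\<lambda>e. symcoef k (Z + e \<cdot>\<^sub>c E) i j) has_field_derivative dsymcoef k Z E i j) (at 0)"
proof -
  have "has_poly_derivative (\<lambda>e. [:Z$2$1 + e * E$2$1, Z$1$1 + e * E$1$1:] ^ j
        * [:Z$2$2 + e * E$2$2, Z$1$2 + e * E$1$2:] ^ (k - j))
     (smult (of_nat j) ([:E$2$1, E$1$1:] * [:Z$2$1 + 0 * E$2$1, Z$1$1 + 0 * E$1$1:] ^ (j - 1))
        * [:Z$2$2 + 0 * E$2$2, Z$1$2 + 0 * E$1$2:] ^ (k - j)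
     + [:Z$2$1 + 0 * E$2$1, Z$1$1 + 0 * E$1$1:] ^ j * smult (of_nat (k - j))
        ([:E$2$2, E$1$2:] * [:Z$2$2 + 0 * E$2$2, Z$1$2 + 0 * E$1$2:] ^ (k - j - 1))) 0"
    by (intro has_poly_derivative_mult has_poly_derivative_power has_poly_derivative_linear)
  then have "((\<lambda>e. symcoef k (Z + e \<cdot>\<^sub>c E) i j) has_field_derivative
     coeff (smult (of_nat j) ([:E$2$1, E$1$1:] * [:Z$2$1 + 0 * E$2$1, Z$1$1 + 0 * E$1$1:] ^ (j - 1))
        * [:Z$2$2 + 0 * E$2$2, Z$1$2 + 0 * E$1$2:] ^ (k - j)
     + [:Z$2$1 + 0 * E$2$1, Z$1$1 + 0 * E$1$1:] ^ j * smult (of_nat (k - j))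
        ([:E$2$2, E$1$2:] * [:Z$2$2 + 0 * E$2$2, Z$1$2 + 0 * E$1$2:] ^ (k - j - 1))) i) (at 0)"
    by (simp add: has_poly_derivative_def symcoef_def del: mult_pCons_left mult_pCons_right)
  also have "coeff (smult (of_nat j) ([:E$2$1, E$1$1:] * [:Z$2$1 + 0 * E$2$1, Z$1$1 + 0 * E$1$1:] ^ (j - 1))
        * [:Z$2$2 + 0 * E$2$2, Z$1$2 + 0 * E$1$2:] ^ (k - j)
     + [:Z$2$1 + 0 * E$2$1, Z$1$1 + 0 * E$1$1:] ^ j * smult (of_nat (k - j))
        ([:E$2$2, E$1$2:] * [:Z$2$2 + 0 * E$2$2, Z$1$2 + 0 * E$1$2:] ^ (k - j - 1))) i
     = dsymcoef k Z E i j"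
    by (simp add: dsymcoef_def mult_ac del: mult_pCons_left mult_pCons_right)
  finally show ?thesis .
qed

text \<open>Differentiate the character $h_k(XY)$ (\<open>trace_symcoef_mult\<close>) with respect to $X$.\<close>

lemma sum_dsymcoef_symcoef:
  "(\<Sum>i\<le>k. \<Sum>j\<le>k. dsymcoef k X E i j * symcoef k Y j i)
   = lucas2 (trace (X ** Y)) (det X * det Y) (Suc k) * trace (E ** Y)
   - lucas2 (trace (X ** Y)) (det X * det Y) k * (det Y * trace (adjugate X ** E))"
proof (rule DERIV_unique)
  let ?X = "\<lambda>e. X + e \<cdot>\<^sub>c E"
  show "((\<lambda>e. \<Sum>i\<le>k. \<Sum>j\<le>k. symcoef k (?X e) i j * symcoef k Y j i) has_field_derivative
     (\<Sum>i\<le>k. \<Sum>j\<le>k. dsymcoef k X E i j * symcoef k Y j i)) (at 0)"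
    by (intro DERIV_sum DERIV_cmult_right symcoef_has_derivative)
  have p: "((\<lambda>e. trace (?X e ** Y)) has_field_derivative trace (E ** Y)) (at 0)"
    unfolding trace_def matrix_matrix_mult_def
    by (auto simp: sum_2 intro!: derivative_eq_intros)
  have d: "((\<lambda>e. det (?X e) * det Y) has_field_derivative det Y * trace (adjugate X ** E)) (at 0)"
    unfolding trace_def matrix_matrix_mult_def det_2 adjugate_def
    by (auto simp: sum_2 algebra_simps intro!: derivative_eq_intros)
  have 0: "?X 0 = X" by (simp add: HC_eq_iff)
  show "((\<lambda>e. \<Sum>i\<le>k. \<Sum>j\<le>k. symcoef k (?X e) i j * symcoef k Y j i) has_field_derivative
   lucas2 (trace (X ** Y)) (det X * det Y) (Suc k) * trace (E ** Y)
   - lucas2 (trace (X ** Y)) (det X * det Y) k * (det Y * trace (adjugate X ** E))) (at 0)"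
    unfolding trace_symcoef_mult
    using lucas_has_derivative[OF p d, of "Suc k"] by (simp only: 0 diff_Suc_1)
qed

text \<open>Differentiate the preceding identity with respect to the second matrix. The truncated index
  \<open>k - 1\<close> is correct also for \<open>k = 0\<close>, where \<open>lucas3\<close> vanishes.\<close>

lemma sum_dsymcoef_dsymcoef:
  fixes A B :: HC and k :: nat
  defines "p \<equiv> trace (A ** B)" and "d \<equiv> det A * det B"
  shows "(\<Sum>i\<le>k. \<Sum>j\<le>k. dsymcoef k A E i j * dsymcoef k B F j i)
   = lucas2 p d (Suc k) * trace (E ** F)
   - lucas2 p d k * (trace (adjugate B ** F) * trace (adjugate A ** E))
   + 2 * trace (E ** B) * (lucas3 p d (Suc k) * trace (A ** F) - lucas3 p d k * (det A * trace (adjugate B ** F)))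
   - 2 * (det B * trace (adjugate A ** E)) * (lucas3 p d k * trace (A ** F) - lucas3 p d (k - 1) * (det A * trace (adjugate B ** F)))"
proof (rule DERIV_unique)
  let ?B = "\<lambda>e. B + e \<cdot>\<^sub>c F"
  show "((\<lambda>e. \<Sum>i\<le>k. \<Sum>j\<le>k. dsymcoef k A E i j * symcoef k (?B e) j i) has_field_derivative
     (\<Sum>i\<le>k. \<Sum>j\<le>k. dsymcoef k A E i j * dsymcoef k B F j i)) (at 0)"
    by (intro DERIV_sum DERIV_cmult symcoef_has_derivative)
  have p: "((\<lambda>e. trace (A ** ?B e)) has_field_derivative trace (A ** F)) (at 0)"
    unfolding trace_def matrix_matrix_mult_def
    by (auto simp: sum_2 intro!: derivative_eq_intros)
  have p': "((\<lambda>e. trace (E ** ?B e)) has_field_derivative trace (E ** F)) (at 0)"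
    unfolding trace_def matrix_matrix_mult_def
    by (auto simp: sum_2 intro!: derivative_eq_intros)
  have d': "((\<lambda>e. det (?B e) * c) has_field_derivative trace (adjugate B ** F) * c) (at 0)" for c
    unfolding trace_def matrix_matrix_mult_def det_2 adjugate_def
    by (auto simp: sum_2 algebra_simps intro!: derivative_eq_intros)
  have d: "((\<lambda>e. det A * det (?B e)) has_field_derivative det A * trace (adjugate B ** F)) (at 0)"
    using d'[of "det A"] by (simp add: mult.commute)
  have 0: "?B 0 = B" by (simp add: HC_eq_iff)
  note L1 = lucas2_has_derivative[OF p d, of "Suc k", unfolded 0]
    and L2 = lucas2_has_derivative[OF p d, of k, unfolded 0]
  show "((\<lambda>e. \<Sum>i\<le>k. \<Sum>j\<le>k. dsymcoef k A E i j * symcoef k (?B e) j i) has_field_derivative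
   lucas2 p d (Suc k) * trace (E ** F)
   - lucas2 p d k * (trace (adjugate B ** F) * trace (adjugate A ** E))
   + 2 * trace (E ** B) * (lucas3 p d (Suc k) * trace (A ** F) - lucas3 p d k * (det A * trace (adjugate B ** F)))
   - 2 * (det B * trace (adjugate A ** E)) * (lucas3 p d k * trace (A ** F) - lucas3 p d (k - 1) * (det A * trace (adjugate B ** F)))) (at 0)"
    unfolding sum_dsymcoef_symcoef
    using DERIV_diff[OF DERIV_mult[OF L1 p'] DERIV_mult[OF L2 d'[of "trace (adjugate A ** E)"]]]
    by (simp add: 0 p_def d_def algebra_simps)
qed

section \<open>The basis functions in integer indices\<close>

text \<open>The basis functions evaluate $t^l$ with indices that leave the range by one step, where the
  value is zero. Integer indices make this uniform.\<close>

definition symcoef_ext :: "nat \<Rightarrow> int \<Rightarrow> int \<Rightarrow> HC \<Rightarrow> complex" where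
  "symcoef_ext k i j Z = (if i \<in> {0..int k} \<and> j \<in> {0..int k} then symcoef k Z (nat i) (nat j) else 0)"

lemma symcoef_ext_symcoef: "i \<le> k \<Longrightarrow> j \<le> k \<Longrightarrow> symcoef_ext k (int i) (int j) Z = symcoef k Z i j"
  by (simp add: symcoef_ext_def)

text \<open>The integrand is $P(s)/s^{i+1}$, so Cauchy's formula for the $i$-th derivative at $0$ applies. At
  $s = 0$ both sides of the rewriting are zero by convention, so it holds everywhere.\<close>

lemma contour_integral_poly_coeff:
  "contour_integral (circlepath 0 1) (\<lambda>s. poly P s * s powi (- int i) / s) = 2 * of_real pi * \<i> * coeff P i"
proof -
  have deriv: "(deriv ^^ n) (poly P) = poly ((pderiv ^^ n) P)" for n
  proof (induction n)
    case (Suc n)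
    have "deriv (poly Q) = poly (pderiv Q)" for Q :: "complex poly"
      by (rule ext, rule DERIV_imp_deriv, rule poly_DERIV)
    with Suc show ?case by simp
  qed simp
  have "(\<lambda>s. poly P s * s powi (- int i) / s) = (\<lambda>s. poly P s / (s - 0) ^ Suc i)"
    by (simp add: fun_eq_iff power_int_minus field_simps)
  moreover have "contour_integral (circlepath 0 1) (\<lambda>s. poly P s / (s - 0) ^ Suc i)
      = of_real (2 * pi) * \<i> * (deriv ^^ i) (poly P) 0 / fact i"
  proof (rule Cauchy_contour_integral_circlepath)
    show "continuous_on (cball 0 1) (poly P)" using continuous_on_poly[of _ "\<lambda>x. x" P] by simp
    show "poly P holomorphic_on ball 0 1" unfolding holomorphic_on_open[OF open_ball] using poly_DERIV by blast
  qed simp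
  moreover have "(deriv ^^ i) (poly P) 0 = fact i * coeff P i"
    by (simp add: deriv poly_0_coeff_0 coeff_higher_pderiv pochhammer_fact)
  ultimately show ?thesis by simp
qed

lemma half_minus_mem_hrange: "real k / 2 - of_int i \<in> hrange (real k / 2) \<longleftrightarrow> i \<in> {0..int k}"
proof -
  have "\<bar>real k / 2 - of_int i\<bar> \<le> real k / 2 \<longleftrightarrow> 0 \<le> real_of_int i \<and> real_of_int i \<le> real_of_int (int k)"
    unfolding abs_le_iff by (safe; linarith)
  then show ?thesis unfolding hrange_def by (simp only: of_int_le_iff of_int_0_le_iff) auto
qed

lemma tcoef_eq:
  "tcoef (real k / 2) (real k / 2 - of_int i) (real k / 2 - of_int j) Z = symcoef_ext k i j Z"
proof (cases "i \<in> {0..int k} \<and> j \<in> {0..int k}")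
  case True
  then obtain a b where ab: "i = int a" "j = int b" "a \<le> k" "b \<le> k"
    by (metis atLeastAtMost_iff nonneg_int_cases of_nat_le_iff)
  define P where "P = [:Z$2$1, Z$1$1:] ^ b * [:Z$2$2, Z$1$2:] ^ (k - b)"
  have "real k / 2 + (real k / 2 - real b) = real (k - b)" "real k / 2 - (real k / 2 - real b) = real b"
    "- (real k / 2) + (real k / 2 - real a) = real_of_int (- int a)"
    using ab by (simp_all add: of_nat_diff)
  then have floors: "nat \<lfloor>real k / 2 + (real k / 2 - real b)\<rfloor> = k - b" "nat \<lfloor>real k / 2 - (real k / 2 - real b)\<rfloor> = b"
    "\<lfloor>- (real k / 2) + (real k / 2 - real a)\<rfloor> = - int a"
    by (simp_all only: floor_of_nat floor_of_int nat_int)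
  have "tcoef (real k / 2) (real k / 2 - of_int i) (real k / 2 - of_int j) Z
     = 1 / (2 * of_real pi * \<i>) * contour_integral (circlepath 0 1) (\<lambda>s.
        (s * Z$1$1 + Z$2$1) ^ b * (s * Z$1$2 + Z$2$2) ^ (k - b) * s powi (- int a) / s)"
    using True half_minus_mem_hrange[of k "int a"] half_minus_mem_hrange[of k "int b"] unfolding tcoef_def ab
    by (simp only: of_int_of_nat_eq floors simp_thms if_True)
  also have "(\<lambda>s. (s * Z$1$1 + Z$2$1) ^ b * (s * Z$1$2 + Z$2$2) ^ (k - b) * s powi (- int a) / s)
     = (\<lambda>s. poly P s * s powi (- int a) / s)"
    by (simp add: P_def fun_eq_iff poly_power add.commute)
  finally show ?thesis
    using ab unfolding contour_integral_poly_coeff by (simp add: symcoef_ext_def symcoef_def P_def)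
qed (auto simp: tcoef_def half_minus_mem_hrange symcoef_ext_def)

lemma sum_hrange: "(\<Sum>m\<in>hrange (real k / 2). g m) = (\<Sum>j\<le>k. g (real k / 2 - real j))"
proof -
  have "hrange (real k / 2) = (\<lambda>j. real k / 2 - real j) ` {..k}"
  proof (intro equalityI subsetI)
    fix m assume m: "m \<in> hrange (real k / 2)"
    then obtain i where i: "real k / 2 - m = of_int i" by (auto simp: hrange_def Ints_def)
    then have "m = real k / 2 - of_int i" by simp
    with m half_minus_mem_hrange[of k i] have "i \<in> {0..int k}" by simp
    then show "m \<in> (\<lambda>j. real k / 2 - real j) ` {..k}"
      using i by (intro image_eqI[of _ _ "nat i"]) auto
  next
    fix m assume "m \<in> (\<lambda>j. real k / 2 - real j) ` {..k}"
    then show "m \<in> hrange (real k / 2)" using half_minus_mem_hrange[of k "int _"] by auto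
  qed
  then show ?thesis by (simp add: sum.reindex inj_on_def)
qed

text \<open>The partial derivatives of $t^{l+1/2}$ in the four entries of $Z$ are $t^l$ with shifted indices
  and the factors $l \pm m$ that occur in the basis functions.\<close>

lemma dsymcoef_units:
  assumes "i \<le> Suc k" "j \<le> Suc k"
  shows "dsymcoef (Suc k) Z (mat2 1 0 0 0) i j = of_nat j * symcoef_ext k (int i - 1) (int j - 1) Z"
    and "dsymcoef (Suc k) Z (mat2 0 0 1 0) i j = of_nat j * symcoef_ext k (int i) (int j - 1) Z"
    and "dsymcoef (Suc k) Z (mat2 0 1 0 0) i j = of_nat (Suc k - j) * symcoef_ext k (int i - 1) (int j) Z"
    and "dsymcoef (Suc k) Z (mat2 0 0 0 1) i j = of_nat (Suc k - j) * symcoef_ext k (int i) (int j) Z"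
proof -
  have col_in_range: "symcoef_ext k (int i) (int j) Z = symcoef k Z i j" if "j \<le> k" "i \<le> Suc k" for i j
    using that symcoef_eq_0[of j k i Z] by (simp add: symcoef_ext_def)
  have col_shifted: "symcoef_ext k (int i - 1) (int j) Z = coeff (pCons 0 ([:Z$2$1, Z$1$1:] ^ j * [:Z$2$2, Z$1$2:] ^ (k - j))) i"
    if "j \<le> k" "i \<le> Suc k" for i j
    using that by (cases i) (simp_all add: symcoef_ext_def symcoef_def)
  show "dsymcoef (Suc k) Z (mat2 1 0 0 0) i j = of_nat j * symcoef_ext k (int i - 1) (int j - 1) Z"
  proof (cases j)
    case (Suc l)
    then show ?thesis using col_shifted[of l i] assms by (simp add: dsymcoef_def)
  qed (simp add: dsymcoef_def)
  show "dsymcoef (Suc k) Z (mat2 0 0 1 0) i j = of_nat j * symcoef_ext k (int i) (int j - 1) Z"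
  proof (cases j)
    case (Suc l)
    then show ?thesis using col_in_range[of l i] assms by (simp add: dsymcoef_def symcoef_def)
  qed (simp add: dsymcoef_def)
  show "dsymcoef (Suc k) Z (mat2 0 1 0 0) i j = of_nat (Suc k - j) * symcoef_ext k (int i - 1) (int j) Z"
  proof (cases "j = Suc k")
    case False
    then show ?thesis using col_shifted[of j i] assms by (simp add: dsymcoef_def Suc_diff_le)
  qed (simp add: dsymcoef_def)
  show "dsymcoef (Suc k) Z (mat2 0 0 0 1) i j = of_nat (Suc k - j) * symcoef_ext k (int i) (int j) Z"
  proof (cases "j = Suc k")
    case False
    then show ?thesis using col_in_range[of j i] assms by (simp add: dsymcoef_def symcoef_def Suc_diff_le)
  qed (simp add: dsymcoef_def)
qed

text \<open>The index ranges of the basis functions and of their derivatives differ by one vanishing end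
  term.\<close>

lemma sum_Suc_eq:
  fixes g :: "nat \<Rightarrow> 'a::comm_monoid_add"
  shows "g (Suc k) = 0 \<Longrightarrow> (\<Sum>i\<le>Suc k. g i) = (\<Sum>i\<le>k. g i)"
    "g 0 = 0 \<Longrightarrow> (\<Sum>i\<le>Suc k. g i) = (\<Sum>i\<le>k. g (Suc i))"
  by (simp, subst sum.atMost_Suc_shift, simp)

section \<open>Bilinear sums of basis functions\<close>

text \<open>With $h_k$ the character of $\mathrm{Sym}^k$, this is the gradient of $h_{k+1}(XY)$ in $X$, arranged as
  $\bigl(\begin{smallmatrix}\partial_{22}&-\partial_{21}\cr
  -\partial_{12}&\partial_{11}\end{smallmatrix}\bigr)$.\<close>

definition char_grad_left :: "nat \<Rightarrow> HC \<Rightarrow> HC \<Rightarrow> HC" where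
  "char_grad_left k X Y = lucas2 (trace (X ** Y)) (det X * det Y) (k + 2) \<cdot>\<^sub>c adjugate Y
     - (lucas2 (trace (X ** Y)) (det X * det Y) (k + 1) * det Y) \<cdot>\<^sub>c X"

text \<open>This is $N(Y)$ times the gradient of $h_k(XY)$ in $Y$, arranged as
  $\bigl(\begin{smallmatrix}\partial_{11}&\partial_{21}\cr
  \partial_{12}&\partial_{22}\end{smallmatrix}\bigr)$.\<close>

definition char_grad_right :: "nat \<Rightarrow> HC \<Rightarrow> HC \<Rightarrow> HC" where
  "char_grad_right k X Y = (lucas2 (trace (X ** Y)) (det X * det Y) (k + 1) * det Y) \<cdot>\<^sub>c X
     - (lucas2 (trace (X ** Y)) (det X * det Y) k * det X * det Y) \<cdot>\<^sub>c adjugate Y"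

lemma trace_units:
  "trace (mat2 1 0 0 0 ** Z) = Z$1$1" "trace (Z ** mat2 1 0 0 0) = Z$1$1"
  "trace (mat2 0 1 0 0 ** Z) = Z$2$1" "trace (Z ** mat2 0 1 0 0) = Z$2$1"
  "trace (mat2 0 0 1 0 ** Z) = Z$1$2" "trace (Z ** mat2 0 0 1 0) = Z$1$2"
  "trace (mat2 0 0 0 1 ** Z) = Z$2$2" "trace (Z ** mat2 0 0 0 1) = Z$2$2"
  by (simp_all add: trace_def sum_2 matrix_matrix_mult_def)

lemma char_grad_entries:
  defines "S \<equiv> \<lambda>k X E Y. \<Sum>i\<le>Suc k. \<Sum>j\<le>Suc k. dsymcoef (Suc k) X E i j * symcoef (Suc k) Y j i"
  shows "char_grad_left k X Y = mat2 (S k X (mat2 0 0 0 1) Y) (- S k X (mat2 0 0 1 0) Y)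
     (- S k X (mat2 0 1 0 0) Y) (S k X (mat2 1 0 0 0) Y)"
    and "char_grad_right (Suc k) X Y = det Y \<cdot>\<^sub>c mat2 (S k Y (mat2 1 0 0 0) X) (S k Y (mat2 0 0 1 0) X)
     (S k Y (mat2 0 1 0 0) X) (S k Y (mat2 0 0 0 1) X)"
proof -
  show "char_grad_left k X Y = mat2 (S k X (mat2 0 0 0 1) Y) (- S k X (mat2 0 0 1 0) Y)
     (- S k X (mat2 0 1 0 0) Y) (S k X (mat2 1 0 0 0) Y)"
    unfolding S_def sum_dsymcoef_symcoef char_grad_left_def
    by (simp add: HC_eq_iff adjugate_def trace_units del: lucas2.simps)
  have c: "trace (Y ** X) = trace (X ** Y)" "det Y * det X = det X * det Y"
    by (rule trace_mul_sym, rule mult.commute)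
  show "char_grad_right (Suc k) X Y = det Y \<cdot>\<^sub>c mat2 (S k Y (mat2 1 0 0 0) X) (S k Y (mat2 0 0 1 0) X)
     (S k Y (mat2 0 1 0 0) X) (S k Y (mat2 0 0 0 1) X)"
    unfolding S_def sum_dsymcoef_symcoef char_grad_right_def c
    by (simp add: HC_eq_iff adjugate_def trace_units algebra_simps del: lucas2.simps)
qed

lemma half_shift:
  "real k / 2 + 1/2 = real (Suc k) / 2" "real (Suc k) / 2 - 1/2 = real k / 2"
  by (simp_all add: field_simps)

text \<open>The following lemmas insert $l = k/2$, $m = k/2 - j$ and the like: half-integer indices become
  integers, and the coefficients become the factors of \<open>dsymcoef_units\<close>.\<close>

lemma f1_eq: "f1 (real k / 2) (real k / 2 - real j) (real (Suc k) / 2 - real i) Z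
    = vector [symcoef_ext k (int i) (int j) Z, - symcoef_ext k (int i - 1) (int j) Z]"
proof -
  have "real (Suc k) / 2 - real i - 1/2 = real k / 2 - of_int (int i)"
    "real (Suc k) / 2 - real i + 1/2 = real k / 2 - of_int (int i - 1)"
    "real k / 2 - real j = real k / 2 - of_int (int j)"
    by (simp_all add: field_simps)
  then show ?thesis unfolding f1_def by (simp only: tcoef_eq)
qed

lemma g1_tilde_eq: "j \<le> Suc k \<Longrightarrow> g1_tilde (real k / 2) (real k / 2 - real j) (real (Suc k) / 2 - real i) Z
    = vector [of_nat (Suc k - j) * symcoef_ext (Suc k) (int j) (int i) (matrix_inv Z),
        - of_nat (Suc j) * symcoef_ext (Suc k) (int (Suc j)) (int i) (matrix_inv Z)]"
proof -
  have "real k / 2 - real j + 1/2 = real (Suc k) / 2 - of_int (int j)"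
    "real k / 2 - real j - 1/2 = real (Suc k) / 2 - of_int (int (Suc j))"
    "real (Suc k) / 2 - real i = real (Suc k) / 2 - of_int (int i)"
    "real k / 2 + (real k / 2 - real j) + 1 = real (Suc k) - real j"
    "real k / 2 - (real k / 2 - real j) + 1 = real (Suc j)"
    by (simp_all add: field_simps)
  then show "j \<le> Suc k \<Longrightarrow> ?thesis" unfolding g1_tilde_def half_shift(1)
    by (simp only: tcoef_eq) (simp add: of_nat_diff)
qed

lemma f2_eq: "i \<le> Suc k \<Longrightarrow> f2 (real (Suc k) / 2) (real (Suc k) / 2 - real j) (real k / 2 - real i) Z
    = vector [of_nat (Suc i) * symcoef_ext (Suc k) (int (Suc i)) (int j) Z,
        of_nat (Suc k - i) * symcoef_ext (Suc k) (int i) (int j) Z]"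
proof -
  have "real k / 2 - real i - 1/2 = real (Suc k) / 2 - of_int (int (Suc i))"
    "real k / 2 - real i + 1/2 = real (Suc k) / 2 - of_int (int i)"
    "real (Suc k) / 2 - real j = real (Suc k) / 2 - of_int (int j)"
    "real (Suc k) / 2 - (real k / 2 - real i) + 1/2 = real (Suc i)"
    "real (Suc k) / 2 + (real k / 2 - real i) + 1/2 = real (Suc k) - real i"
    by (simp_all add: field_simps)
  then show "i \<le> Suc k \<Longrightarrow> ?thesis" unfolding f2_def by (simp only: tcoef_eq) (simp add: of_nat_diff)
qed

lemma g2_tilde_eq: "g2_tilde (real (Suc k) / 2) (real (Suc k) / 2 - real j) (real k / 2 - real i) Z
    = inverse (det Z) *s vector [symcoef_ext k (int j - 1) (int i) (matrix_inv Z), symcoef_ext k (int j) (int i) (matrix_inv Z)]"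
proof -
  have "real (Suc k) / 2 - real j + 1/2 = real k / 2 - of_int (int j - 1)"
    "real (Suc k) / 2 - real j - 1/2 = real k / 2 - of_int (int j)"
    "real k / 2 - real i = real k / 2 - of_int (int i)"
    by (simp_all add: field_simps)
  then show ?thesis unfolding g2_tilde_def half_shift(2) by (simp only: tcoef_eq)
qed

lemma f1_tilde_eq: "f1_tilde (real k / 2) (real (Suc k) / 2 - real j) (real k / 2 - real i) Z
    = vector [symcoef_ext (Suc k) (int j) (int i) (matrix_inv Z), - symcoef_ext (Suc k) (int j) (int (Suc i)) (matrix_inv Z)]"
proof -
  have "real k / 2 - real i + 1/2 = real (Suc k) / 2 - of_int (int i)"
    "real k / 2 - real i - 1/2 = real (Suc k) / 2 - of_int (int (Suc i))"
    "real (Suc k) / 2 - real j = real (Suc k) / 2 - of_int (int j)"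
    by (simp_all add: field_simps)
  then show ?thesis unfolding f1_tilde_def half_shift(1) by (simp only: tcoef_eq)
qed

lemma g1_eq: "j \<le> Suc k \<Longrightarrow> g1 (real k / 2) (real (Suc k) / 2 - real j) (real k / 2 - real i) Z
    = vector [of_nat (Suc k - j) * symcoef_ext k (int i) (int j) Z, - of_nat j * symcoef_ext k (int i) (int j - 1) Z]"
proof -
  have "real (Suc k) / 2 - real j - 1/2 = real k / 2 - of_int (int j)"
    "real (Suc k) / 2 - real j + 1/2 = real k / 2 - of_int (int j - 1)"
    "real k / 2 - real i = real k / 2 - of_int (int i)"
    "real k / 2 + (real (Suc k) / 2 - real j) + 1/2 = real (Suc k) - real j"
    "real k / 2 - (real (Suc k) / 2 - real j) + 1/2 = real j"
    by (simp_all add: field_simps)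
  then show "j \<le> Suc k \<Longrightarrow> ?thesis" unfolding g1_def by (simp only: tcoef_eq) (simp add: of_nat_diff)
qed

lemma f2_tilde_eq: "i \<le> Suc k \<Longrightarrow> f2_tilde (real (Suc k) / 2) (real k / 2 - real j) (real (Suc k) / 2 - real i) Z
    = inverse (det Z) *s vector [of_nat i * symcoef_ext k (int j) (int i - 1) (matrix_inv Z),
        of_nat (Suc k - i) * symcoef_ext k (int j) (int i) (matrix_inv Z)]"
proof -
  have "real (Suc k) / 2 - real i + 1/2 = real k / 2 - of_int (int i - 1)"
    "real (Suc k) / 2 - real i - 1/2 = real k / 2 - of_int (int i)"
    "real k / 2 - real j = real k / 2 - of_int (int j)"
    "real (Suc k) / 2 - (real (Suc k) / 2 - real i) = real i"
    "real (Suc k) / 2 + (real (Suc k) / 2 - real i) = real (Suc k) - real i"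
    by (simp_all add: field_simps)
  then show "i \<le> Suc k \<Longrightarrow> ?thesis" unfolding f2_tilde_def half_shift(2) by (simp only: tcoef_eq) (simp add: of_nat_diff)
qed

lemma g2_eq: "g2 (real (Suc k) / 2) (real k / 2 - real j) (real (Suc k) / 2 - real i) Z
    = vector [symcoef_ext (Suc k) (int i) (int (Suc j)) Z, symcoef_ext (Suc k) (int i) (int j) Z]"
proof -
  have "real k / 2 - real j - 1/2 = real (Suc k) / 2 - of_int (int (Suc j))"
    "real k / 2 - real j + 1/2 = real (Suc k) / 2 - of_int (int j)"
    "real (Suc k) / 2 - real i = real (Suc k) / 2 - of_int (int i)"
    by (simp_all add: field_simps)
  then show ?thesis unfolding g2_def by (simp only: tcoef_eq)
qed

text \<open>Here the derivatives of \<open>char_grad_entries\<close> are written out, so that each entry is a double sum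
  of the kind that occurs in the theorem.\<close>

lemma char_grad_left_eq:
  fixes k :: nat and X Y :: HC
  defines "S \<equiv> \<lambda>g. \<Sum>j\<le>Suc k. \<Sum>i\<le>Suc k. g i j * symcoef_ext (Suc k) (int j) (int i) Y"
  shows "char_grad_left k X Y = mat2 (S (\<lambda>i j. of_nat (Suc k - j) * symcoef_ext k (int i) (int j) X))
     (- S (\<lambda>i j. of_nat j * symcoef_ext k (int i) (int j - 1) X))
     (- S (\<lambda>i j. of_nat (Suc k - j) * symcoef_ext k (int i - 1) (int j) X))
     (S (\<lambda>i j. of_nat j * symcoef_ext k (int i - 1) (int j - 1) X))"
proof -
  have S: "(\<Sum>i\<le>Suc k. \<Sum>j\<le>Suc k. dsymcoef (Suc k) X E i j * symcoef (Suc k) Y j i) = S g"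
    if "\<And>i j. i \<le> Suc k \<Longrightarrow> j \<le> Suc k \<Longrightarrow> dsymcoef (Suc k) X E i j = g i j" for E g
    unfolding S_def by (subst sum.swap) (intro sum.cong refl, auto simp: that symcoef_ext_symcoef)
  show ?thesis
    unfolding char_grad_entries
    by (intro arg_cong4[where f = mat2] arg_cong[where f = uminus] S dsymcoef_units)
qed

lemma char_grad_right_eq:
  fixes k :: nat and X Y :: HC
  defines "S \<equiv> \<lambda>g. \<Sum>j\<le>Suc k. \<Sum>i\<le>Suc k. g j i * symcoef_ext (Suc k) (int i) (int j) X"
  shows "char_grad_right (Suc k) X Y = det Y \<cdot>\<^sub>c mat2 (S (\<lambda>j i. of_nat i * symcoef_ext k (int j - 1) (int i - 1) Y))
     (S (\<lambda>j i. of_nat i * symcoef_ext k (int j) (int i - 1) Y))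
     (S (\<lambda>j i. of_nat (Suc k - i) * symcoef_ext k (int j - 1) (int i) Y))
     (S (\<lambda>j i. of_nat (Suc k - i) * symcoef_ext k (int j) (int i) Y))"
proof -
  have S: "(\<Sum>i\<le>Suc k. \<Sum>j\<le>Suc k. dsymcoef (Suc k) Y E i j * symcoef (Suc k) X j i) = S g"
    if "\<And>i j. i \<le> Suc k \<Longrightarrow> j \<le> Suc k \<Longrightarrow> dsymcoef (Suc k) Y E i j = g i j" for E g
    unfolding S_def by (intro sum.cong refl) (auto simp: that symcoef_ext_symcoef)
  show ?thesis
    unfolding char_grad_entries
    by (intro arg_cong4[where f = mat2] arg_cong[where f = "cscale _"] S dsymcoef_units)
qed

lemma int_Suc_diff: "int (Suc i) - 1 = int i"
  by simp

lemma sum_col_row_nth: "(\<Sum>j\<in>J. \<Sum>i\<in>I. col_row (f j i) (g j i)) $ a $ b = (\<Sum>j\<in>J. \<Sum>i\<in>I. f j i $ a * g j i $ b)"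
  by (simp add: col_row_def)

text \<open>Entry by entry, the left side is the double sum of \<open>char_grad_left_eq\<close> with an end term dropped
  or an index shifted.\<close>

lemma sum_f1_g1_tilde:
  "(\<Sum>m\<in>hrange (real k / 2). \<Sum>n\<in>hrange (real k / 2 + 1/2).
      col_row (f1 (real k / 2) m n X) (g1_tilde (real k / 2) m n Z)) = char_grad_left k X (matrix_inv Z)"
  unfolding half_shift sum_hrange f1_eq char_grad_left_eq HC_eq_iff sum_col_row_nth mat2_nth
  by (simp add: g1_tilde_eq sum_Suc_eq symcoef_ext_def int_Suc_diff sum_negf mult_ac
      del: sum.atMost_Suc of_nat_Suc cong: sum.cong_simp)

lemma sum_f1_tilde_g1:
  "(\<Sum>m\<in>hrange (real k / 2 + 1/2). \<Sum>n\<in>hrange (real k / 2).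
      col_row (f1_tilde (real k / 2) m n Z) (g1 (real k / 2) m n X)) = char_grad_left k X (matrix_inv Z)"
  unfolding half_shift sum_hrange f1_tilde_eq char_grad_left_eq HC_eq_iff sum_col_row_nth mat2_nth
  by (simp add: g1_eq sum_Suc_eq symcoef_ext_def int_Suc_diff sum_negf mult_ac
      del: sum.atMost_Suc of_nat_Suc cong: sum.cong_simp)

lemma matrix_inv_mult:
  fixes Z :: HC
  assumes "det Z \<noteq> 0"
  shows "Z ** matrix_inv Z = mat 1" "matrix_inv Z ** Z = mat 1"
proof -
  have "\<exists>A. Z ** A = mat 1 \<and> A ** Z = mat 1"
    using assms by (simp add: invertible_det_nz flip: invertible_def)
  from someI_ex[OF this] show "Z ** matrix_inv Z = mat 1" "matrix_inv Z ** Z = mat 1"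
    by (simp_all add: matrix_inv_def)
qed

lemma det_matrix_inv: "det Z \<noteq> 0 \<Longrightarrow> det (matrix_inv Z) = inverse (det Z)" for Z :: HC
proof -
  assume "det Z \<noteq> 0"
  then have "Z ** matrix_inv Z = mat 1" by (rule matrix_inv_mult)
  then have "det Z * det (matrix_inv Z) = 1" by (metis det_I det_mul)
  then show ?thesis by (metis inverse_unique)
qed

lemma sum_f2_g2_tilde:
  assumes "det Z \<noteq> 0"
  shows "(\<Sum>m\<in>hrange (real (Suc k) / 2). \<Sum>n\<in>hrange (real (Suc k) / 2 - 1/2).
      col_row (f2 (real (Suc k) / 2) m n X) (g2_tilde (real (Suc k) / 2) m n Z)) = char_grad_right (Suc k) X (matrix_inv Z)"
  unfolding half_shift sum_hrange g2_tilde_eq char_grad_right_eq HC_eq_iff sum_col_row_nth mat2_nth cscale_nth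
    det_matrix_inv[OF assms]
  by (simp add: f2_eq sum_Suc_eq symcoef_ext_def int_Suc_diff sum_distrib_left mult_ac
      del: sum.atMost_Suc of_nat_Suc cong: sum.cong_simp)

lemma sum_f2_tilde_g2:
  assumes "det Z \<noteq> 0"
  shows "(\<Sum>m\<in>hrange (real (Suc k) / 2 - 1/2). \<Sum>n\<in>hrange (real (Suc k) / 2).
      col_row (f2_tilde (real (Suc k) / 2) m n Z) (g2 (real (Suc k) / 2) m n X)) = char_grad_right (Suc k) X (matrix_inv Z)"
  unfolding half_shift sum_hrange g2_eq char_grad_right_eq HC_eq_iff sum_col_row_nth mat2_nth cscale_nth
    det_matrix_inv[OF assms]
  by (simp add: f2_tilde_eq sum_Suc_eq symcoef_ext_def int_Suc_diff sum_distrib_left mult_ac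
      del: sum.atMost_Suc of_nat_Suc cong: sum.cong_simp)

lemma col_row_scale: "col_row (a *s f) (b *s g) = (a * b) \<cdot>\<^sub>c col_row f g"
  by (simp add: HC_eq_iff col_row_def)

lemma sum_cscale: "(\<Sum>i\<in>I. c \<cdot>\<^sub>c A i) = c \<cdot>\<^sub>c (\<Sum>i\<in>I. A i)"
  by (simp add: HC_eq_iff sum_distrib_left)

text \<open>The third family is $N(X)$, respectively $N(Y)$, times the first one with $l - 1$ in place of
  $l$.\<close>

lemma sum_f3_g3_tilde:
  assumes "det Z \<noteq> 0"
  shows "(\<Sum>m\<in>hrange (real k / 2). \<Sum>n\<in>hrange (real k / 2 + 1/2).
      col_row (f3 (real k / 2 + 1) m n X) (g3_tilde (real k / 2 + 1) m n Z))
     = (det X * det (matrix_inv Z)) \<cdot>\<^sub>c char_grad_left k X (matrix_inv Z)"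
proof -
  have "f3 (real k / 2 + 1) m n X = det X *s f1 (real k / 2) m n X"
    "g3_tilde (real k / 2 + 1) m n Z = inverse (det Z) *s g1_tilde (real k / 2) m n Z" for m n
    by (simp_all add: f3_def f1_def g3_tilde_def g1_tilde_def add.commute add.left_commute add_diff_eq)
  then show ?thesis
    by (simp only: col_row_scale sum_cscale sum_f1_g1_tilde det_matrix_inv[OF assms])
qed

lemma sum_f3_tilde_g3:
  assumes "det Z \<noteq> 0"
  shows "(\<Sum>m\<in>hrange (real k / 2 + 1/2). \<Sum>n\<in>hrange (real k / 2).
      col_row (f3_tilde (real k / 2 + 1) m n Z) (g3 (real k / 2 + 1) m n X))
     = (det X * det (matrix_inv Z)) \<cdot>\<^sub>c char_grad_left k X (matrix_inv Z)"
proof -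
  have "g3 (real k / 2 + 1) m n X = det X *s g1 (real k / 2) m n X"
    "f3_tilde (real k / 2 + 1) m n Z = inverse (det Z) *s f1_tilde (real k / 2) m n Z" for m n
    by (simp_all add: g3_def g1_def f3_tilde_def f1_tilde_def add.commute add.left_commute add_diff_eq)
  then show ?thesis
    by (simp only: col_row_scale sum_cscale sum_f1_tilde_g1 det_matrix_inv[OF assms] mult.commute)
qed

section \<open>The mean over the unitary group\<close>

type_synonym angles = "real \<times> real \<times> real \<times> real"

text \<open>The pull-back of $\frac{i}{2\pi^3}\,dV/N(W)^2$ along the chart; it has total mass one and is
  independent of $R$.\<close>

definition haar_weight :: "angles \<Rightarrow> complex" where
  "haar_weight u = of_real (cos (fst (snd u)) * sin (fst (snd u)) / (2 * pi ^ 3))"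

definition haar_mean :: "(angles \<Rightarrow> complex) \<Rightarrow> complex" where
  "haar_mean f = integral u2_box (\<lambda>u. haar_weight u * f u)"

lemma continuous_haar_weight: "continuous_on S haar_weight"
  unfolding haar_weight_def by (intro continuous_intros) auto

lemma haar_integrable:
  "continuous_on UNIV f \<Longrightarrow> (\<lambda>u. haar_weight u * f u) integrable_on u2_box"
  unfolding u2_box_def
  by (intro integrable_continuous continuous_intros continuous_haar_weight) (auto intro: continuous_on_subset)

lemma haar_mean_sum:
  assumes "finite I" "\<And>i. i \<in> I \<Longrightarrow> continuous_on UNIV (f i)"
  shows "haar_mean (\<lambda>u. \<Sum>i\<in>I. f i u) = (\<Sum>i\<in>I. haar_mean (f i))"
  unfolding haar_mean_def sum_distrib_left
  by (intro integral_sum assms haar_integrable)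

lemma haar_mean_cmult: "haar_mean (\<lambda>u. c * f u) = c * haar_mean f"
  unfolding haar_mean_def by (simp add: mult.left_commute[of _ c])

lemma integral_box_mult:
  fixes f :: "'a::euclidean_space \<Rightarrow> complex" and g :: "'b::euclidean_space \<Rightarrow> complex"
  assumes "continuous_on UNIV f" "continuous_on UNIV g"
  shows "integral (cbox (a, c) (b, d)) (\<lambda>u. f (fst u) * g (snd u)) = integral (cbox a b) f * integral (cbox c d) g"
proof -
  have "continuous_on (cbox (a, c) (b, d)) (\<lambda>u. f (fst u) * g (snd u))"
    by (intro continuous_intros continuous_on_compose2[OF assms(1)] continuous_on_compose2[OF assms(2)]) auto
  then show ?thesis by (simp add: integral_prod_continuous)
qed

lemma integral_cis_period:
  assumes "m \<noteq> 0" "cis (m * c) = 1" "c \<ge> 0"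
  shows "integral (cbox 0 c) (\<lambda>x. cis (m * x)) = 0"
proof -
  have "((\<lambda>x. cis (m * x)) has_integral cis (m * c) / (\<i> * m) - cis (m * 0) / (\<i> * m)) {0..c}"
  proof (rule fundamental_theorem_of_calculus[OF assms(3)])
    fix x
    have "((\<lambda>z. exp (\<i> * (of_real m * z)) / (\<i> * m)) has_field_derivative exp (\<i> * (of_real m * of_real x)))
        (at (of_real x))"
      using assms(1) by (auto intro!: derivative_eq_intros simp: mult_ac)
    from has_vector_derivative_real_field[OF this]
    have "((\<lambda>x. cis (m * x) / (\<i> * m)) has_vector_derivative cis (m * x)) (at x)"
      by (simp add: cis_conv_exp)
    then show "((\<lambda>x. cis (m * x) / (\<i> * m)) has_vector_derivative cis (m * x)) (at x within {0..c})"
      by (rule has_vector_derivative_at_within)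
  qed
  then show ?thesis using assms(2) by (simp add: cbox_interval integral_unique)
qed

lemma integral_cis_2pi:
  "integral (cbox 0 (2 * pi)) (\<lambda>x. cis (of_int m * x)) = (if m = 0 then of_real (2 * pi) else 0)"
  using integral_cis_period[of "of_int m" "2 * pi"] cis_multiple_2pi[of "of_int m"]
  by (auto simp: mult_ac scaleR_conv_of_real)

lemma integral_cis_pi:
  assumes "even m"
  shows "integral (cbox 0 pi) (\<lambda>x. cis (of_int m * x)) = (if m = 0 then of_real pi else 0)"
proof -
  from assms obtain k where m: "m = 2 * k" by auto
  then have "cis (of_int m * pi) = 1" using cis_multiple_2pi[of "of_int k"] by (simp add: mult_ac)
  then show ?thesis using integral_cis_period[of "of_int m" pi] by (auto simp: scaleR_conv_of_real)
qed

text \<open>Integration by parts lowers the exponent of the sine and raises that of the cosine, down to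
  \<open>b = 0\<close>.\<close>

lemma integral_cos_sin_powers:
  "((\<lambda>x. cos x ^ (2 * a + 1) * sin x ^ (2 * b + 1)) has_integral fact a * fact b / (2 * fact (a + b + 1))) {0..pi/2}"
proof (induction b arbitrary: a)
  case 0
  have "((\<lambda>x. (2 * real a + 2) * (cos x ^ (2 * a + 1) * sin x)) has_integral
      - (cos (pi/2) ^ Suc (2 * a + 1)) - - (cos 0 ^ Suc (2 * a + 1))) {0..pi/2}"
  proof (rule fundamental_theorem_of_calculus)
    fix x
    show "((\<lambda>x. - (cos x ^ Suc (2 * a + 1))) has_vector_derivative (2 * real a + 2) * (cos x ^ (2 * a + 1) * sin x))
        (at x within {0..pi/2})"
      unfolding has_real_derivative_iff_has_vector_derivative[symmetric]
      by (rule derivative_eq_intros DERIV_power_Suc refl)+ (simp add: algebra_simps)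
  qed simp
  from has_integral_mult_right[OF this, of "1 / (2 * real a + 2)"]
  have "((\<lambda>x. cos x ^ (2 * a + 1) * sin x) has_integral 1 / (2 * real a + 2)) {0..pi/2}"
    by (simp del: power_Suc add: add_nonneg_eq_0_iff)
  also have "1 / (2 * real a + 2) = fact a * fact 0 / (2 * fact (a + 0 + 1))"
    by (simp add: divide_simps)
  finally show ?case by simp
next
  case (Suc b)
  have "((\<lambda>x. (2 * real b + 2) * (cos x ^ (2 * a + 3) * sin x ^ (2 * b + 1))
        - (2 * real a + 2) * (cos x ^ (2 * a + 1) * sin x ^ (2 * b + 3))) has_integral
      cos (pi/2) ^ Suc (2 * a + 1) * sin (pi/2) ^ Suc (2 * b + 1) - cos 0 ^ Suc (2 * a + 1) * sin 0 ^ Suc (2 * b + 1)) {0..pi/2}"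
  proof (rule fundamental_theorem_of_calculus)
    fix x
    show "((\<lambda>x. cos x ^ Suc (2 * a + 1) * sin x ^ Suc (2 * b + 1)) has_vector_derivative
       (2 * real b + 2) * (cos x ^ (2 * a + 3) * sin x ^ (2 * b + 1))
        - (2 * real a + 2) * (cos x ^ (2 * a + 1) * sin x ^ (2 * b + 3))) (at x within {0..pi/2})"
      unfolding has_real_derivative_iff_has_vector_derivative[symmetric]
      by (rule derivative_eq_intros DERIV_power_Suc refl)+
        (simp add: algebra_simps power_add power3_eq_cube)
  qed simp
  then have *: "((\<lambda>x. (2 * real b + 2) * (cos x ^ (2 * a + 3) * sin x ^ (2 * b + 1))
        - (2 * real a + 2) * (cos x ^ (2 * a + 1) * sin x ^ (2 * b + 3))) has_integral 0) {0..pi/2}"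
    by simp
  define I :: real where "I = fact (a + 1) * fact b / (2 * fact (a + 1 + b + 1))"
  have "((\<lambda>x. cos x ^ (2 * a + 3) * sin x ^ (2 * b + 1)) has_integral I) {0..pi/2}"
    using Suc[of "a + 1"] unfolding I_def by (simp only: distrib_left numeral_3_eq_3) (simp add: add_ac)
  from has_integral_diff[OF has_integral_mult_right[OF this, of "2 * real b + 2"] *]
  have "((\<lambda>x. (2 * real a + 2) * (cos x ^ (2 * a + 1) * sin x ^ (2 * b + 3))) has_integral
      (2 * real b + 2) * I) {0..pi/2}"
    by (simp only: diff_diff_eq2 add_diff_cancel_left' diff_zero)
  from has_integral_mult_right[OF this, of "1 / (2 * real a + 2)"]
  have "((\<lambda>x. cos x ^ (2 * a + 1) * sin x ^ (2 * b + 3)) has_integral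
      1 / (2 * real a + 2) * ((2 * real b + 2) * I)) {0..pi/2}"
    by (simp del: power_Suc add: add_nonneg_eq_0_iff)
  also have "1 / (2 * real a + 2) * ((2 * real b + 2) * I) = fact a * fact (Suc b) / (2 * fact (a + Suc b + 1))"
    by (simp add: I_def divide_simps add_nonneg_eq_0_iff) (simp add: algebra_simps)
  finally show ?case by (simp add: numeral_3_eq_3)
qed

text \<open>The integrals over the angles \<open>x\<close> and \<open>y\<close> force \<open>a = c\<close> and \<open>b = d\<close>, and a beta integral over
  \<open>p\<close> remains. The angle \<open>t\<close> runs only over $[0, \pi]$, where an odd phase does not
  integrate to zero; the assumption says that the other angles settle that case.\<close>

lemma haar_mean_monomial:
  assumes "even n \<or> a + b \<noteq> c + d"
  shows "haar_mean (\<lambda>(t, p, x, y). cis (of_int n * t)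
      * ((of_real (cos p) * cis (- x)) ^ a * (of_real (sin p) * cis y) ^ b * (of_real (cos p) * cis x) ^ c * (of_real (sin p) * cis (- y)) ^ d))
    = (if n = 0 \<and> a = c \<and> b = d then fact a * fact b / fact (a + b + 1) else 0)"
proof -
  define P where "P = (\<lambda>p. complex_of_real (cos p ^ (a + c + 1) * sin p ^ (b + d + 1)))"
  define A where "A = (\<lambda>x. cis (of_int (int c - int a) * x))"
  define B where "B = (\<lambda>y. cis (of_int (int b - int d) * y))"
  define T where "T = (\<lambda>t. cis (of_int n * t))"
  define AB where "AB = (\<lambda>w. A (fst w) * (B (snd w) / (2 * pi ^ 3)))"
  define PAB where "PAB = (\<lambda>v. P (fst v) * AB (snd v))"
  have cont: "continuous_on UNIV T" "continuous_on UNIV P" "continuous_on UNIV A"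
    "continuous_on UNIV (\<lambda>y. B y / (2 * pi ^ 3))" "continuous_on UNIV AB" "continuous_on UNIV PAB"
    unfolding PAB_def AB_def T_def P_def A_def B_def by (intro continuous_intros; simp)+
  have "haar_mean (\<lambda>(t, p, x, y). cis (of_int n * t)
      * ((of_real (cos p) * cis (- x)) ^ a * (of_real (sin p) * cis y) ^ b * (of_real (cos p) * cis x) ^ c * (of_real (sin p) * cis (- y)) ^ d))
    = integral u2_box (\<lambda>u. T (fst u) * PAB (snd u))"
    unfolding haar_mean_def
  proof (rule integral_cong)
    fix u :: angles
    obtain t p x y where u: "u = (t, p, x, y)" by (metis prod_cases4)
    have "cis (- x) ^ a * cis x ^ c = A x" "cis y ^ b * cis (- y) ^ d = B y"
      by (simp_all add: A_def B_def Complex.DeMoivre cis_mult algebra_simps)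
    then have e: "cis (- x) ^ a * (cis y ^ b * (cis x ^ c * cis (- y) ^ d)) = A x * B y"
      by (metis (no_types) mult.assoc mult.left_commute)
    show "haar_weight u * (case u of (t, p, x, y) \<Rightarrow> cis (of_int n * t)
      * ((of_real (cos p) * cis (- x)) ^ a * (of_real (sin p) * cis y) ^ b * (of_real (cos p) * cis x) ^ c * (of_real (sin p) * cis (- y)) ^ d))
     = T (fst u) * PAB (snd u)"
      by (simp add: u haar_weight_def power_mult_distrib power_add e PAB_def AB_def P_def T_def)
  qed
  also have "\<dots> = integral (cbox 0 pi) T * (integral (cbox 0 (pi/2)) P
      * (integral (cbox 0 (2 * pi)) A * integral (cbox 0 (2 * pi)) (\<lambda>y. B y / (2 * pi ^ 3))))"
    unfolding u2_box_def integral_box_mult[OF cont(1) cont(6)]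
    unfolding PAB_def integral_box_mult[OF cont(2) cont(5)]
    unfolding AB_def integral_box_mult[OF cont(3) cont(4)] by (rule refl)
  finally have eq: "haar_mean (\<lambda>(t, p, x, y). cis (of_int n * t)
      * ((of_real (cos p) * cis (- x)) ^ a * (of_real (sin p) * cis y) ^ b * (of_real (cos p) * cis x) ^ c * (of_real (sin p) * cis (- y)) ^ d))
    = integral (cbox 0 pi) T * (integral (cbox 0 (pi/2)) P
      * (integral (cbox 0 (2 * pi)) A * (integral (cbox 0 (2 * pi)) B / (2 * pi ^ 3))))"
    by simp
  show ?thesis
  proof (cases "a = c \<and> b = d")
    case True
    have "integral (cbox 0 (pi/2)) P = complex_of_real (fact a * fact b / (2 * fact (a + b + 1)))"
    proof -
      have "P = (\<lambda>x. complex_of_real (cos x ^ (2 * a + 1) * sin x ^ (2 * b + 1)))"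
        using True by (simp add: P_def mult_2)
      then show ?thesis
        unfolding cbox_interval by (simp only:) (intro integral_unique has_integral_of_real integral_cos_sin_powers)
    qed
    moreover have "even n" using assms True by simp
    ultimately show ?thesis unfolding eq T_def A_def B_def integral_cis_2pi integral_cis_pi[OF \<open>even n\<close>] using True 
      by (simp add: power3_eq_cube)
  next
    case False
    then show ?thesis unfolding eq A_def B_def integral_cis_2pi by auto
  qed
qed

section \<open>Pairings of linear forms on the three-sphere\<close>

text \<open>Linear forms in the first column $z = (\cos p\,e^{-ix}, -i \sin p\,e^{iy})$ of the $SU(2)$ part of
  the chart, a point of the three-sphere, and in its conjugate.\<close>

definition lin :: "complex \<Rightarrow> complex \<Rightarrow> angles \<Rightarrow> complex" where
  "lin a b = (\<lambda>(t, p, x, y). a * (of_real (cos p) * cis (- x)) + b * (- \<i> * (of_real (sin p) * cis y)))"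

definition conj_lin :: "complex \<Rightarrow> complex \<Rightarrow> angles \<Rightarrow> complex" where
  "conj_lin a b = (\<lambda>(t, p, x, y). a * (of_real (cos p) * cis x) + b * (\<i> * (of_real (sin p) * cis (- y))))"

definition phase :: "int \<Rightarrow> angles \<Rightarrow> complex" where
  "phase n u = cis (of_int n * fst u)"

lemma continuous_lin [continuous_intros]:
  "continuous_on S (lin a b)" "continuous_on S (conj_lin a b)" "continuous_on S (phase n)"
  unfolding lin_def conj_lin_def phase_def case_prod_unfold
  by (intro continuous_intros)+

text \<open>Expand both powers binomially. The factorials of \<open>haar_mean_monomial\<close> cancel one of the two
  binomial coefficients, and the sum closes up to a power of $ac + bd$.\<close>

lemma haar_mean_lin_powers:
  assumes "even n \<or> K \<noteq> L"
  shows "haar_mean (\<lambda>u. phase n u * (lin a b u ^ K * conj_lin c d u ^ L))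
    = (if n = 0 \<and> K = L then (a * c + b * d) ^ K / of_nat (K + 1) else 0)"
proof -
  define mono where "mono = (\<lambda>i j. \<lambda>(t, p, x, y). cis (of_int n * t)
      * ((of_real (cos p) * cis (- x)) ^ i * (of_real (sin p) * cis y) ^ (K - i) * (of_real (cos p) * cis x) ^ j * (of_real (sin p) * cis (- y)) ^ (L - j)))"
  \<comment> \<open>The second coordinates of $z$ and $\overline z$ carry the factors $\mp i$; they are moved into the
    coefficients and cancel in the end.\<close>
  define b' d' where "b' = - \<i> * b" and "d' = \<i> * d"
  define w where "w i j = of_nat (K choose i) * a ^ i * b' ^ (K - i)
      * (of_nat (L choose j) * c ^ j * d' ^ (L - j))" for i j
  have cont: "continuous_on UNIV (mono i j)" for i j
    unfolding mono_def case_prod_unfold by (intro continuous_intros)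
  have "phase n u * (lin a b u ^ K * conj_lin c d u ^ L) = (\<Sum>i\<le>K. \<Sum>j\<le>L. w i j * mono i j u)" for u
  proof -
    obtain t p x y where u: "u = (t, p, x, y)" by (metis prod_cases4)
    define P Q P' Q' where "P = of_real (cos p) * cis (- x)" and "Q = of_real (sin p) * cis y"
      and "P' = of_real (cos p) * cis x" and "Q' = of_real (sin p) * cis (- y)"
    have "lin a b u = a * P + b' * Q" "conj_lin c d u = c * P' + d' * Q'"
      by (simp_all add: lin_def conj_lin_def u P_def Q_def P'_def Q'_def b'_def d'_def)
    then have "lin a b u ^ K = (\<Sum>i\<le>K. of_nat (K choose i) * (a * P) ^ i * (b' * Q) ^ (K - i))"
      "conj_lin c d u ^ L = (\<Sum>j\<le>L. of_nat (L choose j) * (c * P') ^ j * (d' * Q') ^ (L - j))"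
      by (simp_all only: binomial_ring)
    then show ?thesis
      by (simp only: sum_product, simp only: sum_distrib_left)
        (intro sum.cong refl, simp add: w_def mono_def u phase_def P_def Q_def P'_def Q'_def power_mult_distrib mult_ac)
  qed
  then have "haar_mean (\<lambda>u. phase n u * (lin a b u ^ K * conj_lin c d u ^ L))
      = (\<Sum>i\<le>K. \<Sum>j\<le>L. w i j * haar_mean (mono i j))"
    by (simp add: haar_mean_sum haar_mean_cmult cont continuous_on_sum continuous_on_mult_left)
  also have "haar_mean (mono i j) = (if n = 0 \<and> i = j \<and> K = L then 1 / (of_nat (K choose i) * of_nat (K + 1)) else 0)"
    if "i \<le> K" "j \<le> L" for i j
  proof -
    have "haar_mean (mono i j) = (if n = 0 \<and> i = j \<and> K - i = L - j then fact i * fact (K - i) / fact (i + (K - i) + 1) else 0)"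
      unfolding mono_def using assms that by (intro haar_mean_monomial) auto
    also have "fact i * fact (K - i) / fact (i + (K - i) + 1) = 1 / (complex_of_nat (K choose i) * of_nat (K + 1))"
    proof -
      have "fact i * fact (K - i) = fact K / complex_of_nat (K choose i)"
        using that by (simp add: binomial_fact)
      moreover have "i + (K - i) + 1 = Suc K" using that by simp
      ultimately show ?thesis by (simp only: fact_Suc) simp
    qed
    finally show ?thesis using that by auto
  qed
  then have "(\<Sum>i\<le>K. \<Sum>j\<le>L. w i j * haar_mean (mono i j))
      = (\<Sum>i\<le>K. \<Sum>j\<le>L. if j = i then (if n = 0 \<and> K = L then w i i * (1 / (of_nat (K choose i) * of_nat (K + 1))) else 0) else 0)"
    by (intro sum.cong refl) auto
  also have "\<dots> = (if n = 0 \<and> K = L then (\<Sum>i\<le>K. w i i * (1 / (of_nat (K choose i) * of_nat (K + 1)))) else 0)"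
  proof (cases "n = 0 \<and> K = L")
    case False
    then show ?thesis by (simp only: if_False if_cancel sum.neutral_const)
  qed (simp add: sum.delta)
  also have "\<dots> = (if n = 0 \<and> K = L then (a * c + b * d) ^ K / of_nat (K + 1) else 0)"
  proof -
    have "w i i * (1 / (of_nat (K choose i) * of_nat (K + 1)))
       = of_nat (K choose i) * (a * c) ^ i * (b * d) ^ (K - i) / of_nat (K + 1)" if "K = L" "i \<le> K" for i
    proof -
      have "b' ^ (K - i) * d' ^ (K - i) = (b * d) ^ (K - i)"
      proof -
        have "b' * d' = b * d" by (simp add: b'_def d'_def algebra_simps)
        then show ?thesis by (metis power_mult_distrib)
      qed
      moreover have "complex_of_nat (K choose i) \<noteq> 0" using that by simp
      moreover have "w i i = of_nat (K choose i) * (of_nat (K choose i) * (a * c) ^ i * (b' ^ (K - i) * d' ^ (K - i)))"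
        using that(1) by (simp add: w_def power_mult_distrib mult_ac)
      ultimately show ?thesis by simp
    qed
    then show ?thesis by (simp add: binomial_ring[of "a * c"] sum_divide_distrib)
  qed
  finally show ?thesis .
qed

lemma poly2_coeffs_eq:
  fixes c d :: "nat \<Rightarrow> nat \<Rightarrow> complex"
  assumes "\<And>x y. (\<Sum>i\<le>K. \<Sum>j\<le>L. c i j * x ^ i * y ^ j) = (\<Sum>i\<le>K. \<Sum>j\<le>L. d i j * x ^ i * y ^ j)"
    and "i \<le> K" "j \<le> L"
  shows "c i j = d i j"
proof -
  have "(\<Sum>j\<le>L. c i j * y ^ j) = (\<Sum>j\<le>L. d i j * y ^ j)" for y
  proof -
    have "(\<Sum>i\<le>K. (\<Sum>j\<le>L. c i j * y ^ j) * x ^ i) = (\<Sum>i\<le>K. (\<Sum>j\<le>L. d i j * y ^ j) * x ^ i)" for x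
      using assms(1)[of x y] by (simp add: sum_distrib_left sum_distrib_right mult_ac)
    then show ?thesis using polyfun_eq_coeffs[where c = "\<lambda>i. \<Sum>j\<le>L. c i j * y ^ j" and d = "\<lambda>i. \<Sum>j\<le>L. d i j * y ^ j" and n = K] assms(2) by simp
  qed
  then show ?thesis using polyfun_eq_coeffs[where c = "c i" and d = "d i" and n = L] assms(3) by simp
qed

text \<open>Polarization: apply \<open>haar_mean_lin_powers\<close> to the forms with coefficient vectors
  $(s, 1) + x(1, -t)$ and $(t, 1) + y(1, -s)$. Since $(s, 1)$ is orthogonal to $(1, -s)$ and
  $(t, 1)$ to $(1, -t)$, their pairing is $(1 + st)(1 + xy)$; compare the coefficients of
  $x^{i'} y^{j'}$.\<close>

lemma haar_mean_lin_products:
  assumes "even n \<or> i + i' \<noteq> j + j'"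
  shows "haar_mean (\<lambda>u. phase n u * (lin s 1 u ^ i * lin 1 (- t) u ^ i' * (conj_lin t 1 u ^ j * conj_lin 1 (- s) u ^ j')))
    = (if n = 0 \<and> i = j \<and> i' = j' then (1 + s * t) ^ (i + i') / (of_nat ((i + i') choose i') * of_nat (i + i' + 1)) else 0)"
proof -
  define K L where "K = i + i'" and "L = j + j'"
  define f where "f k l u = phase n u * (lin s 1 u ^ (K - k) * lin 1 (- t) u ^ k * (conj_lin t 1 u ^ (L - l) * conj_lin 1 (- s) u ^ l))" for k l u
  define c where "c k l = of_nat (K choose k) * of_nat (L choose l) * haar_mean (f k l)" for k l
  define d where "d k l = (if l = k then if n = 0 \<and> K = L then of_nat (K choose k) * ((1 + s * t) ^ K / of_nat (K + 1)) else 0 else 0)" for k l :: nat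
  have cont: "continuous_on UNIV (f k l)" for k l
    unfolding f_def by (intro continuous_intros)
  have "(\<Sum>k\<le>K. \<Sum>l\<le>L. c k l * x ^ k * y ^ l) = (\<Sum>k\<le>K. \<Sum>l\<le>L. d k l * x ^ k * y ^ l)" for x y
  proof -
    have "phase n u * (lin (s + x) (1 - x * t) u ^ K * conj_lin (t + y) (1 - y * s) u ^ L)
       = (\<Sum>k\<le>K. \<Sum>l\<le>L. (of_nat (K choose k) * of_nat (L choose l) * x ^ k * y ^ l) * f k l u)" for u
    proof -
      have "lin (s + x) (1 - x * t) u = x * lin 1 (- t) u + lin s 1 u"
        "conj_lin (t + y) (1 - y * s) u = y * conj_lin 1 (- s) u + conj_lin t 1 u"
        by (simp_all add: lin_def conj_lin_def case_prod_unfold algebra_simps)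
      then have "lin (s + x) (1 - x * t) u ^ K = (\<Sum>k\<le>K. of_nat (K choose k) * (x * lin 1 (- t) u) ^ k * lin s 1 u ^ (K - k))"
        "conj_lin (t + y) (1 - y * s) u ^ L = (\<Sum>l\<le>L. of_nat (L choose l) * (y * conj_lin 1 (- s) u) ^ l * conj_lin t 1 u ^ (L - l))"
        by (simp_all only: binomial_ring)
      then show ?thesis
        by (simp only: sum_product, simp only: sum_distrib_left)
          (intro sum.cong refl, simp add: f_def power_mult_distrib mult_ac)
    qed
    then have "haar_mean (\<lambda>u. phase n u * (lin (s + x) (1 - x * t) u ^ K * conj_lin (t + y) (1 - y * s) u ^ L))
       = (\<Sum>k\<le>K. \<Sum>l\<le>L. (of_nat (K choose k) * of_nat (L choose l) * x ^ k * y ^ l) * haar_mean (f k l))"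
      by (simp add: haar_mean_sum haar_mean_cmult cont continuous_on_sum continuous_on_mult_left)
    also have "\<dots> = (\<Sum>k\<le>K. \<Sum>l\<le>L. c k l * x ^ k * y ^ l)"
      by (simp add: c_def mult_ac)
    finally have "(\<Sum>k\<le>K. \<Sum>l\<le>L. c k l * x ^ k * y ^ l)
       = (if n = 0 \<and> K = L then ((s + x) * (t + y) + (1 - x * t) * (1 - y * s)) ^ K / of_nat (K + 1) else 0)"
      using haar_mean_lin_powers[of n K L "s + x" "1 - x * t" "t + y" "1 - y * s"] assms by (simp add: K_def L_def)
    also have "(s + x) * (t + y) + (1 - x * t) * (1 - y * s) = (1 + s * t) * (x * y + 1)"
      by (simp add: algebra_simps)
    also have "(if n = 0 \<and> K = L then ((1 + s * t) * (x * y + 1)) ^ K / of_nat (K + 1) else 0)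
       = (\<Sum>k\<le>K. if n = 0 \<and> K = L then of_nat (K choose k) * ((1 + s * t) ^ K / of_nat (K + 1)) * x ^ k * y ^ k else 0)"
      by (simp add: power_mult_distrib binomial_ring[of "x * y"] sum_distrib_left sum_divide_distrib mult_ac
          split: if_splits) auto
    also have "\<dots> = (\<Sum>k\<le>K. \<Sum>l\<le>L. d k l * x ^ k * y ^ l)"
    proof (rule sum.cong[OF refl])
      fix k assume "k \<in> {..K}"
      have "(\<Sum>l\<le>L. d k l * x ^ k * y ^ l) = (\<Sum>l\<le>L. if l = k then d k k * x ^ k * y ^ k else 0)"
        by (intro sum.cong refl) (simp add: d_def)
      also have "\<dots> = (if k \<le> L then d k k * x ^ k * y ^ k else 0)" by (simp add: sum.delta)
      finally show "(if n = 0 \<and> K = L then of_nat (K choose k) * ((1 + s * t) ^ K / of_nat (K + 1)) * x ^ k * y ^ k else 0)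
          = (\<Sum>l\<le>L. d k l * x ^ k * y ^ l)"
        using \<open>k \<in> {..K}\<close> by (auto simp: d_def)
    qed
    finally show ?thesis .
  qed
  \<comment> \<open>The coefficient of $x^{i'} y^{j'}$ carries the binomial factors \<open>K choose i'\<close> and
    \<open>L choose j'\<close>, which are divided out in the rest of the proof.\<close>
  then have "c i' j' = d i' j'" by (rule poly2_coeffs_eq) (simp_all add: K_def L_def)
  moreover define H where "H = haar_mean (f i' j')"
  ultimately have eq: "of_nat (K choose i') * of_nat (L choose j') * H = d i' j'" by (simp add: c_def)
  have nz: "complex_of_nat (K choose i') \<noteq> 0" "complex_of_nat (L choose j') \<noteq> 0"
    by (simp_all add: K_def L_def)
  have "H = (if n = 0 \<and> i = j \<and> i' = j' then (1 + s * t) ^ K / (of_nat (K choose i') * of_nat (K + 1)) else 0)"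
  proof (cases "n = 0 \<and> i = j \<and> i' = j'")
    case True
    then have "of_nat (K choose i') * (of_nat (K choose i') * H) = of_nat (K choose i') * ((1 + s * t) ^ K / of_nat (K + 1))"
      using eq by (simp add: d_def K_def L_def mult.assoc)
    then have "of_nat (K choose i') * H = (1 + s * t) ^ K / of_nat (K + 1)"
      using nz(1) by (simp only: mult_cancel_left) simp
    then show ?thesis using nz(1) True by (simp add: divide_simps mult_ac del: of_nat_Suc)
  next
    case False
    then have "d i' j' = 0" by (auto simp: d_def K_def L_def)
    with False eq nz show ?thesis by auto
  qed
  moreover have "f i' j' = (\<lambda>u. phase n u * (lin s 1 u ^ i * lin 1 (- t) u ^ i' * (conj_lin t 1 u ^ j * conj_lin 1 (- s) u ^ j')))"
    by (simp add: f_def K_def L_def fun_eq_iff)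
  ultimately show ?thesis by (simp only: H_def K_def)
qed

section \<open>Schur orthogonality\<close>

text \<open>The unitary matrix $V$ with $W^+ = R V^*$ at the point $W$ of the chart
  (\<open>adjugate_u2_param\<close>).\<close>

definition haar_unitary :: "angles \<Rightarrow> HC" where
  "haar_unitary u = (case u of (t, p, x, y) \<Rightarrow> cis (- t) \<cdot>\<^sub>c
     mat2 (of_real (cos p) * cis (- x)) (- \<i> * of_real (sin p) * cis (- y))
          (- \<i> * of_real (sin p) * cis y) (of_real (cos p) * cis x))"

text \<open>The irreducible representations of $U(2)$ are $\det^a \otimes \mathrm{Sym}^k$, and
  $\mathrm{Sym}^k(V^*)$ is the inverse of $\mathrm{Sym}^k(V)$ for unitary $V$. A predicate on the family $V$
  covers $V$ and its transpose at the same time.\<close>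

definition schur_orthogonal :: "(angles \<Rightarrow> HC) \<Rightarrow> bool" where
  "schur_orthogonal V \<longleftrightarrow> (\<forall>i j. continuous_on UNIV (\<lambda>u. V u $ i $ j)) \<and>
     (\<forall>a b J K i j k l. i \<le> J \<longrightarrow> j \<le> J \<longrightarrow> k \<le> K \<longrightarrow> l \<le> K \<longrightarrow>
       haar_mean (\<lambda>u. det (V u) ^ a * symcoef J (V u) i j * (det (cadj (V u)) ^ b * symcoef K (cadj (V u)) k l))
       = (if a = b \<and> J = K \<and> i = l \<and> j = k then 1 / of_nat (J + 1) else 0))"

lemma sum_symcoef_powers:
  assumes "j \<le> k"
  shows "(\<Sum>i\<le>k. symcoef k Z i j * x ^ i) = (x * Z$1$1 + Z$2$1) ^ j * (x * Z$1$2 + Z$2$2) ^ (k - j)"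
proof -
  have "poly ([:Z$2$1, Z$1$1:] ^ j * [:Z$2$2, Z$1$2:] ^ (k - j)) x = (\<Sum>i\<le>k. symcoef k Z i j * x ^ i)"
    unfolding symcoef_def poly_altdef using degree_linear_powers[of "Z$2$1" "Z$1$1" j "Z$2$2" "Z$1$2" "k - j"] assms
    by (intro sum.mono_neutral_left) (auto intro: coeff_eq_0)
  then show ?thesis by (simp add: poly_power add.commute)
qed

text \<open>Both sides are the coefficients of the bilinear form $((x, 1) Z (y, 1)^T)^k$.\<close>

lemma symcoef_transpose:
  assumes "i \<le> k" "j \<le> k"
  shows "of_nat (k choose j) * symcoef k Z i j = of_nat (k choose i) * symcoef k (transpose Z) j i"
proof -
  have gen: "(\<Sum>j\<le>k. \<Sum>i\<le>k. of_nat (k choose j) * symcoef k Z i j * y ^ j * x ^ i)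
      = (y * (x * Z$1$1 + Z$2$1) + (x * Z$1$2 + Z$2$2)) ^ k" for Z x y
  proof -
    have "(\<Sum>i\<le>k. of_nat (k choose j) * symcoef k Z i j * y ^ j * x ^ i)
        = of_nat (k choose j) * (y * (x * Z$1$1 + Z$2$1)) ^ j * (x * Z$1$2 + Z$2$2) ^ (k - j)" if "j \<le> k" for j
    proof -
      have "(\<Sum>i\<le>k. of_nat (k choose j) * symcoef k Z i j * y ^ j * x ^ i)
          = of_nat (k choose j) * y ^ j * (\<Sum>i\<le>k. symcoef k Z i j * x ^ i)"
        by (simp only: sum_distrib_left mult_ac)
      then show ?thesis by (simp add: sum_symcoef_powers that power_mult_distrib mult.assoc)
    qed
    then show ?thesis by (simp add: binomial_ring)
  qed
  have "of_nat (k choose j) * symcoef k Z i j = of_nat (k choose i) * symcoef k (transpose Z) j i"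
    if "i \<le> k" "j \<le> k" for i j
  proof (rule poly2_coeffs_eq[OF _ that(2,1)])
    fix y x
    have "(\<Sum>j\<le>k. \<Sum>i\<le>k. of_nat (k choose j) * symcoef k Z i j * y ^ j * x ^ i)
       = (x * (y * transpose Z$1$1 + transpose Z$2$1) + (y * transpose Z$1$2 + transpose Z$2$2)) ^ k"
      unfolding gen by (simp add: transpose_def algebra_simps)
    also have "\<dots> = (\<Sum>j\<le>k. \<Sum>i\<le>k. of_nat (k choose i) * symcoef k (transpose Z) j i * y ^ j * x ^ i)"
      unfolding gen[symmetric] by (subst sum.swap) (simp add: mult_ac)
    finally show "(\<Sum>j\<le>k. \<Sum>i\<le>k. of_nat (k choose j) * symcoef k Z i j * y ^ j * x ^ i)
      = (\<Sum>j\<le>k. \<Sum>i\<le>k. of_nat (k choose i) * symcoef k (transpose Z) j i * y ^ j * x ^ i)" .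
  qed
  then show ?thesis using assms by blast
qed

text \<open>The next lemmas provide the continuity that the linearity of the mean presupposes.\<close>

lemma continuous_on_coeff_mult:
  fixes f g :: "'a::topological_space \<Rightarrow> complex poly"
  assumes "\<And>i. continuous_on S (\<lambda>u. coeff (f u) i)" "\<And>i. continuous_on S (\<lambda>u. coeff (g u) i)"
  shows "continuous_on S (\<lambda>u. coeff (f u * g u) i)"
  unfolding coeff_mult by (intro continuous_intros assms)

lemma continuous_on_coeff_power:
  fixes f :: "'a::topological_space \<Rightarrow> complex poly"
  assumes "\<And>i. continuous_on S (\<lambda>u. coeff (f u) i)"
  shows "continuous_on S (\<lambda>u. coeff (f u ^ n) i)"
  using assms by (induction n arbitrary: i) (auto intro: continuous_on_coeff_mult)

lemma continuous_on_symcoef: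
  assumes "\<And>i j. continuous_on S (\<lambda>u. V u $ i $ j)"
  shows "continuous_on S (\<lambda>u. symcoef k (V u) i j)"
proof -
  have "continuous_on S (\<lambda>u. coeff [:V u $ a $ b, V u $ c $ d:] i)" for a b c d i
  proof (cases i)
    case (Suc n)
    then show ?thesis using assms by (cases n) auto
  qed (use assms in simp)
  then show ?thesis
    unfolding symcoef_def by (intro continuous_on_coeff_mult continuous_on_coeff_power)
qed

lemma continuous_on_det_HC:
  fixes V :: "'a::topological_space \<Rightarrow> HC"
  assumes "\<And>i j. continuous_on S (\<lambda>u. V u $ i $ j)"
  shows "continuous_on S (\<lambda>u. det (V u))"
  unfolding det_2 by (intro continuous_intros assms)

lemma continuous_on_cadj:
  assumes "\<And>i j. continuous_on S (\<lambda>u. V u $ i $ j)"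
  shows "continuous_on S (\<lambda>u. cadj (V u) $ i $ j)"
  using assms by (simp add: cadj_def continuous_on_cnj)

lemma continuous_haar_unitary: "continuous_on S (\<lambda>u. haar_unitary u $ i $ j)"
proof -
  have "continuous_on S (\<lambda>u. haar_unitary u $ 1 $ 1)" "continuous_on S (\<lambda>u. haar_unitary u $ 1 $ 2)"
    "continuous_on S (\<lambda>u. haar_unitary u $ 2 $ 1)" "continuous_on S (\<lambda>u. haar_unitary u $ 2 $ 2)"
    unfolding haar_unitary_def case_prod_unfold by (simp, intro continuous_intros)+
  then show ?thesis using exhaust_2[of i] exhaust_2[of j] by auto
qed

lemma phase_mult: "phase m u * phase n u = phase (m + n) u"
  by (simp add: phase_def cis_mult algebra_simps)

lemma phase_power: "phase m u ^ k = phase (int k * m) u"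
  by (simp add: phase_def Complex.DeMoivre algebra_simps)

text \<open>The columns of $V$ are, up to phase, $z$ and the vector orthogonal to it, so that the generating polynomials of $\mathrm{Sym}^k$ become products of \<open>lin\<close> and \<open>conj_lin\<close>.\<close>

lemma haar_unitary_phase:
  "det (haar_unitary u) = phase (- 2) u" "det (cadj (haar_unitary u)) = phase 2 u"
  "s * haar_unitary u $ 1 $ 1 + haar_unitary u $ 2 $ 1 = phase (- 1) u * lin s 1 u"
  "s * haar_unitary u $ 1 $ 2 + haar_unitary u $ 2 $ 2 = phase (- 1) u * conj_lin 1 (- s) u"
  "s * transpose (cadj (haar_unitary u)) $ 1 $ 1 + transpose (cadj (haar_unitary u)) $ 2 $ 1 = phase 1 u * conj_lin s 1 u"
  "s * transpose (cadj (haar_unitary u)) $ 1 $ 2 + transpose (cadj (haar_unitary u)) $ 2 $ 2 = phase 1 u * lin 1 (- s) u"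
proof -
  obtain t p x y where u: "u = (t, p, x, y)" by (metis prod_cases4)
  have det: "det (haar_unitary u) = phase (- 2) u"
  proof -
    have "det (haar_unitary u) = (cis (- t) * cis (- t)) * (of_real (cos p) * of_real (cos p) * (cis (- x) * cis x)
        + of_real (sin p) * of_real (sin p) * (cis (- y) * cis y))"
      by (simp add: haar_unitary_def u det_2 algebra_simps)
    also have "\<dots> = cis (- t) * cis (- t) * (of_real (cos p) * of_real (cos p) + of_real (sin p) * of_real (sin p))"
      by (simp add: cis_mult)
    also have "complex_of_real (cos p) * of_real (cos p) + of_real (sin p) * of_real (sin p) = 1"
      using sin_cos_squared_add3[of p] by (metis of_real_1 of_real_add of_real_mult)
    finally show ?thesis by (simp add: u phase_def cis_mult)
  qed
  then show "det (haar_unitary u) = phase (- 2) u" .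
  have "det (cadj (haar_unitary u)) = cnj (det (haar_unitary u))"
    by (simp add: det_2 cadj_def mult.commute)
  then show "det (cadj (haar_unitary u)) = phase 2 u"
    by (simp add: det phase_def cis_cnj)
qed (simp_all add: haar_unitary_def phase_def lin_def conj_lin_def transpose_def cadj_def cis_cnj case_prod_unfold algebra_simps)

text \<open>With $\overline V$ in place of $V^*$, the generating function in $s, t$ of the means is the one of
  \<open>haar_mean_lin_products\<close>, and $(1 + st)^J$ contributes only equal powers of $s$ and $t$. The
  passage from $\overline V$ to its transpose $V^*$ is \<open>symcoef_transpose\<close>.\<close>

lemma schur_orthogonal_haar_unitary: "schur_orthogonal haar_unitary"
  unfolding schur_orthogonal_def
proof (intro conjI allI impI continuous_haar_unitary)
  fix a b J K i j k l :: nat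
  assume le: "i \<le> J" "j \<le> J" "k \<le> K" "l \<le> K"
  define F where "F i l u = det (haar_unitary u) ^ a * symcoef J (haar_unitary u) i j
      * (det (cadj (haar_unitary u)) ^ b * symcoef K (transpose (cadj (haar_unitary u))) l k)" for i l u
  define d where "d i l = (if l = i then if a = b \<and> J = K \<and> j = k
      then of_nat (J choose i) / (of_nat (J choose j) * of_nat (J + 1)) else 0 else (0::complex))" for i l
  have cont: "continuous_on UNIV (F i l)" for i l
  proof -
    have "continuous_on UNIV (\<lambda>u. transpose (cadj (haar_unitary u)) $ i $ j)" for i j
      by (simp add: transpose_def continuous_on_cadj continuous_haar_unitary)
    then show ?thesis
      unfolding F_def
      by (intro continuous_on_mult continuous_on_power continuous_on_symcoef continuous_on_det_HC continuous_on_cadj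
          continuous_haar_unitary)
  qed
  have "haar_mean (F i l) = d i l"
  proof (rule poly2_coeffs_eq[OF _ le(1) le(4)])
    fix s t
    \<comment> \<open>The total power of the central phase in the integrand.\<close>
    define n where "n = 2 * int b + int K - 2 * int a - int J"
    have F: "phase n u * (lin s 1 u ^ j * lin 1 (- t) u ^ (K - k) * (conj_lin t 1 u ^ k * conj_lin 1 (- s) u ^ (J - j)))
       = (\<Sum>i\<le>J. \<Sum>l\<le>K. (s ^ i * t ^ l) * F i l u)" for u
    proof -
      have "(\<Sum>i\<le>J. \<Sum>l\<le>K. (s ^ i * t ^ l) * F i l u)
         = det (haar_unitary u) ^ a * det (cadj (haar_unitary u)) ^ b *
           ((\<Sum>i\<le>J. symcoef J (haar_unitary u) i j * s ^ i) * (\<Sum>l\<le>K. symcoef K (transpose (cadj (haar_unitary u))) l k * t ^ l))"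
        by (simp only: sum_product, simp only: sum_distrib_left)
          (intro sum.cong refl, simp add: F_def mult_ac)
      also have "\<dots> = (phase (- 2) u ^ a * phase 2 u ^ b * (phase (- 1) u ^ j * phase (- 1) u ^ (J - j) * (phase 1 u ^ k * phase 1 u ^ (K - k))))
          * (lin s 1 u ^ j * lin 1 (- t) u ^ (K - k) * (conj_lin t 1 u ^ k * conj_lin 1 (- s) u ^ (J - j)))"
        using le by (simp only: sum_symcoef_powers haar_unitary_phase power_mult_distrib) (simp only: mult_ac)
      also have "phase (- 2) u ^ a * phase 2 u ^ b * (phase (- 1) u ^ j * phase (- 1) u ^ (J - j) * (phase 1 u ^ k * phase 1 u ^ (K - k)))
          = phase n u"
        using le by (simp add: phase_power phase_mult n_def of_nat_diff algebra_simps)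
      finally show ?thesis ..
    qed
    have "(\<Sum>i\<le>J. \<Sum>l\<le>K. haar_mean (F i l) * s ^ i * t ^ l) = (\<Sum>i\<le>J. \<Sum>l\<le>K. (s ^ i * t ^ l) * haar_mean (F i l))"
      by (simp add: mult_ac)
    also have "\<dots> = haar_mean (\<lambda>u. \<Sum>i\<le>J. \<Sum>l\<le>K. (s ^ i * t ^ l) * F i l u)"
      by (simp add: haar_mean_sum haar_mean_cmult cont continuous_on_sum continuous_on_mult_left)
    also have "\<dots> = (if n = 0 \<and> j = k \<and> K - k = J - j
         then (1 + s * t) ^ (j + (K - k)) / (of_nat ((j + (K - k)) choose (K - k)) * of_nat (j + (K - k) + 1)) else 0)"
      unfolding F[symmetric]
    proof (rule haar_mean_lin_products)
      \<comment> \<open>If the degrees in $z$ and $\overline z$ agree, then $K - J$ is even.\<close>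
      show "even n \<or> j + (K - k) \<noteq> k + (J - j)"
      proof (rule disjCI)
        assume "\<not> j + (K - k) \<noteq> k + (J - j)"
        then have "int (j + (K - k)) = int (k + (J - j))" by simp
        then have "int K - int J = 2 * (int k - int j)" using le by (simp add: of_nat_diff)
        then have "n = 2 * (int b - int a + int k - int j)" by (simp add: n_def)
        then show "even n" by simp
      qed
    qed
    also have "\<dots> = (if a = b \<and> J = K \<and> j = k then (1 + s * t) ^ J / (of_nat (J choose j) * of_nat (J + 1)) else 0)"
    proof -
      have "n = 0 \<and> j = k \<and> K - k = J - j \<longleftrightarrow> a = b \<and> J = K \<and> j = k"
        using le by (auto simp: n_def)
      moreover have "J choose (J - j) = J choose j" using le by (simp flip: binomial_symmetric)
      ultimately show ?thesis using le by (auto simp del: of_nat_Suc)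
    qed
    also have "\<dots> = (\<Sum>i\<le>J. \<Sum>l\<le>K. d i l * s ^ i * t ^ l)"
    proof (cases "a = b \<and> J = K \<and> j = k")
      case True
      have "(\<Sum>i\<le>J. \<Sum>l\<le>K. d i l * s ^ i * t ^ l)
         = (\<Sum>i\<le>J. \<Sum>l\<le>J. if l = i then d i i * s ^ i * t ^ i else 0)"
        using True by (intro sum.cong refl) (auto simp: d_def)
      also have "\<dots> = (\<Sum>i\<le>J. d i i * s ^ i * t ^ i)" by (simp add: sum.delta)
      also have "\<dots> = (s * t + 1) ^ J / (of_nat (J choose j) * of_nat (J + 1))"
        unfolding binomial_ring sum_divide_distrib
        using True by (intro sum.cong refl) (simp add: d_def power_mult_distrib)
      finally show ?thesis using True by (simp add: add.commute)
    next
      case False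
      then have "d i l = 0" for i l by (auto simp: d_def)
      then show ?thesis using False by auto
    qed
    finally show "(\<Sum>i\<le>J. \<Sum>l\<le>K. haar_mean (F i l) * s ^ i * t ^ l) = (\<Sum>i\<le>J. \<Sum>l\<le>K. d i l * s ^ i * t ^ l)" .
  qed
  moreover have "det (haar_unitary u) ^ a * symcoef J (haar_unitary u) i j
      * (det (cadj (haar_unitary u)) ^ b * symcoef K (cadj (haar_unitary u)) k l)
     = of_nat (K choose k) / of_nat (K choose l) * F i l u" for u
    using symcoef_transpose[of k K l "cadj (haar_unitary u)"] le by (simp add: F_def field_simps)
  ultimately show "haar_mean (\<lambda>u. det (haar_unitary u) ^ a * symcoef J (haar_unitary u) i j
      * (det (cadj (haar_unitary u)) ^ b * symcoef K (cadj (haar_unitary u)) k l))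
     = (if a = b \<and> J = K \<and> i = l \<and> j = k then 1 / of_nat (J + 1) else 0)"
    using le by (simp only: haar_mean_cmult) (simp add: d_def del: of_nat_Suc)
qed

lemma schur_orthogonal_transpose:
  assumes "schur_orthogonal V"
  shows "schur_orthogonal (\<lambda>u. transpose (V u))"
  unfolding schur_orthogonal_def
proof (intro conjI allI impI)
  show "continuous_on UNIV (\<lambda>u. transpose (V u) $ i $ j)" for i j
    using assms by (simp add: schur_orthogonal_def transpose_def)
  fix a b J K i j k l :: nat
  assume le: "i \<le> J" "j \<le> J" "k \<le> K" "l \<le> K"
  have cadj: "cadj (transpose Z) = transpose (cadj Z)" for Z :: HC
    by (simp add: cadj_def transpose_def)
  have "det (transpose (V u)) ^ a * symcoef J (transpose (V u)) i j
      * (det (cadj (transpose (V u))) ^ b * symcoef K (cadj (transpose (V u))) k l)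
     = (of_nat (J choose i) / of_nat (J choose j) * (of_nat (K choose k) / of_nat (K choose l)))
      * (det (V u) ^ a * symcoef J (V u) j i * (det (cadj (V u)) ^ b * symcoef K (cadj (V u)) l k))" for u
    using symcoef_transpose[of j J i "V u"] symcoef_transpose[of l K k "cadj (V u)"] le
    by (simp add: cadj det_transpose field_simps)
  moreover have "haar_mean (\<lambda>u. det (V u) ^ a * symcoef J (V u) j i * (det (cadj (V u)) ^ b * symcoef K (cadj (V u)) l k))
      = (if a = b \<and> J = K \<and> j = k \<and> i = l then 1 / of_nat (J + 1) else 0)"
    using assms le unfolding schur_orthogonal_def by blast
  ultimately show "haar_mean (\<lambda>u. det (transpose (V u)) ^ a * symcoef J (transpose (V u)) i j
      * (det (cadj (transpose (V u))) ^ b * symcoef K (cadj (transpose (V u))) k l))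
     = (if a = b \<and> J = K \<and> i = l \<and> j = k then 1 / of_nat (J + 1) else 0)"
    using le by (simp only: haar_mean_cmult) (simp del: of_nat_Suc)
qed

section \<open>Matrix powers and their isotypic parts\<close>

text \<open>The power operation on matrices as vectors of vectors is entrywise, so the matrix power has its
  own name.\<close>

primrec mpow :: "HC \<Rightarrow> nat \<Rightarrow> HC" where
  "mpow M 0 = mat 1"
| "mpow M (Suc k) = M ** mpow M k"

lemma cayley_hamilton: "M ** M = trace M \<cdot>\<^sub>c M - det M \<cdot>\<^sub>c mat 1"
  by (simp add: HC_eq_iff matrix_matrix_mult_def sum_2 trace_def det_2 mat_def algebra_simps)

lemma cscale_simps:
  "M ** (c \<cdot>\<^sub>c A) = c \<cdot>\<^sub>c (M ** A)" "(c \<cdot>\<^sub>c A) ** M = c \<cdot>\<^sub>c (A ** M)"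
  "trace (c \<cdot>\<^sub>c A) = c * trace A" "a \<cdot>\<^sub>c b \<cdot>\<^sub>c A = (a * b) \<cdot>\<^sub>c A"
  by (simp_all add: HC_eq_iff matrix_matrix_mult_def sum_2 trace_def algebra_simps)

lemma matrix_sub_distrib:
  "M ** (A - B) = M ** A - M ** B" "(A - B) ** M = A ** M - B ** M" for A B M :: HC
  by (simp_all add: HC_eq_iff matrix_matrix_mult_def sum_2 algebra_simps)

lemma mpow_Suc_lucas:
  "mpow M (Suc k) = lucas (trace M) (det M) (Suc k) \<cdot>\<^sub>c M - (det M * lucas (trace M) (det M) k) \<cdot>\<^sub>c mat 1"
proof (induction k)
  case (Suc k)
  have "mpow M (Suc (Suc k)) = lucas (trace M) (det M) (Suc k) \<cdot>\<^sub>c (M ** M) - (det M * lucas (trace M) (det M) k) \<cdot>\<^sub>c M"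
    unfolding mpow.simps(2)[of M "Suc k"] Suc by (simp add: matrix_sub_distrib cscale_simps)
  then show ?case
    by (simp add: cayley_hamilton HC_eq_iff algebra_simps)
qed (simp add: HC_eq_iff)

text \<open>In the notation of the introduction, $\mathrm{tr}(\Phi_k(M)E) = a_{k-1}\mathrm{tr}(ME) - a_{k-2} d\,
  \mathrm{tr}(E)$ with $a_n$ the coefficients of $1/D^2$, and $M^k = h_{k-1}M - d\,h_{k-2}$ by
  Cayley--Hamilton; compare the coefficients using \<open>lucas_eq_lucas2\<close>.\<close>

lemma trace_mpow_Suc:
  fixes M E :: HC
  defines "p \<equiv> trace M" and "d \<equiv> det M"
  shows "of_nat (Suc k) * trace (mpow M (Suc k) ** E)
    = (lucas2 p d (k + 2) * trace (M ** E) - lucas2 p d (k + 1) * (d * trace E))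
    - d * (lucas p d k * trace E + (lucas2 p d k * trace (M ** E) - lucas2 p d (k - 1) * (d * trace E)))"
proof -
  have "trace (mpow M (Suc k) ** E) = lucas p d (k + 1) * trace (M ** E) - d * lucas p d k * trace E"
    unfolding mpow_Suc_lucas p_def d_def
    by (simp add: matrix_sub_distrib cscale_simps trace_sub del: lucas.simps)
  moreover have "of_nat (Suc k) * lucas p d (k + 1) = lucas2 p d (k + 2) - d * lucas2 p d k"
    using lucas_eq_lucas2[of k p d] by simp
  moreover have "of_nat k * lucas p d k = lucas2 p d (k + 1) - d * lucas2 p d (k - 1)"
    using lucas_eq_lucas2[of "k - 1" p d] by (cases k) simp_all
  ultimately show ?thesis
    by (simp only: of_nat_Suc) algebra
qed

definition sym_pair :: "nat \<Rightarrow> (nat \<Rightarrow> nat \<Rightarrow> complex) \<Rightarrow> HC \<Rightarrow> complex" where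
  "sym_pair k C V = (\<Sum>i\<le>k. \<Sum>j\<le>k. symcoef k V i j * C j i)"

text \<open>The coefficients of $\mathrm{tr}((VA)^k E)$ in its components of type $\mathrm{Sym}^k$ and
  $\det \otimes \mathrm{Sym}^{k-2}$. The derivative $\mathrm{tr}(\Phi_k(VA)E)$ is obtained by moving $A$ in the
  direction $AE$, which keeps it linear in the entries of $\mathrm{Sym}^k(V)$.\<close>

definition top_coef :: "nat \<Rightarrow> HC \<Rightarrow> HC \<Rightarrow> nat \<Rightarrow> nat \<Rightarrow> complex" where
  "top_coef k A E i j = (if k = 0 then trace E else dsymcoef k A (A ** E) i j / of_nat k)"

definition low_coef :: "nat \<Rightarrow> HC \<Rightarrow> HC \<Rightarrow> nat \<Rightarrow> nat \<Rightarrow> complex" where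
  "low_coef k A E i j = (if k < 2 then 0 else
     - det A * (symcoef (k - 2) A i j * trace E + dsymcoef (k - 2) A (A ** E) i j) / of_nat k)"

lemma adjugate_mult_cancel: "adjugate A ** (A ** E) = det A \<cdot>\<^sub>c E"
  by (simp add: matrix_mul_assoc adjugate_det) (simp add: HC_eq_iff matrix_matrix_mult_def sum_2 mat_def)

lemma sum_dsymcoef_symcoef':
  "(\<Sum>i\<le>k. \<Sum>j\<le>k. dsymcoef k A (A ** E) i j * symcoef k B j i)
   = lucas2 (trace (A ** B)) (det A * det B) (Suc k) * trace (A ** E ** B)
   - lucas2 (trace (A ** B)) (det A * det B) k * (det A * det B * trace E)"
  unfolding sum_dsymcoef_symcoef by (simp add: adjugate_mult_cancel cscale_simps del: lucas2.simps)

lemma sym_pair_linear: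
  "sym_pair k (\<lambda>i j. c * (C i j * t + D i j)) V = c * (sym_pair k C V * t + sym_pair k D V)"
  unfolding sym_pair_def sum_distrib_left sum_distrib_right sum.distrib[symmetric]
  by (intro sum.cong refl) (simp add: algebra_simps)

lemma trace_mpow_sym_pair:
  "trace (mpow (V ** A) k ** E) = sym_pair k (top_coef k A E) V + det V * sym_pair (k - 2) (low_coef k A E) V"
proof (cases k)
  case 0
  then show ?thesis by (simp add: sym_pair_def top_coef_def low_coef_def symcoef_def)
next
  case (Suc n)
  define p d where "p = trace (V ** A)" and "d = det V * det A"
  have pd: "trace (A ** V) = p" "det A * det V = d" "det (V ** A) = d"
    unfolding p_def d_def det_mul by (rule trace_mul_sym, rule mult.commute, rule refl)
  have tr: "trace (A ** E ** V) = trace (V ** A ** E)" by (metis matrix_mul_assoc trace_mul_sym)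
  have d1: "sym_pair m (dsymcoef m A (A ** E)) V
      = lucas2 p d (Suc m) * trace (V ** A ** E) - lucas2 p d m * (d * trace E)" for m
    unfolding sym_pair_def using sum_dsymcoef_symcoef'[of m A E V]
    by (subst sum.swap) (simp add: mult.commute pd tr del: lucas2.simps)
  have s1: "sym_pair m (symcoef m A) V = lucas p d (Suc m)" for m
    unfolding sym_pair_def using trace_symcoef_mult[of m V A] by (simp add: p_def d_def del: lucas.simps)
  have top: "sym_pair k (top_coef k A E) V = sym_pair k (dsymcoef k A (A ** E)) V / of_nat k"
  proof -
    have "k \<noteq> 0" using Suc by simp
    then show ?thesis by (simp add: sym_pair_def top_coef_def sum_divide_distrib)
  qed
  have low: "sym_pair (k - 2) (low_coef k A E) V = - det A * (lucas p d n * trace E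
      + (lucas2 p d n * trace (V ** A ** E) - lucas2 p d (n - 1) * (d * trace E))) / of_nat k"
  proof (cases n)
    case (Suc m)
    have "sym_pair (k - 2) (low_coef k A E) V = - det A * (sym_pair m (symcoef m A) V * trace E + sym_pair m (dsymcoef m A (A ** E)) V) / of_nat k"
    proof -
      have "k - 2 = m" using Suc \<open>k = Suc n\<close> by simp
      moreover have "low_coef k A E = (\<lambda>i j. - det A / of_nat k * (symcoef m A i j * trace E + dsymcoef m A (A ** E) i j))"
        using Suc \<open>k = Suc n\<close> by (simp add: low_coef_def fun_eq_iff)
      ultimately show ?thesis by (simp only: sym_pair_linear) simp
    qed
    then show ?thesis unfolding d1 s1 using Suc by (simp del: lucas.simps lucas2.simps of_nat_Suc)
  qed (simp add: sym_pair_def low_coef_def Suc)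
  show ?thesis
  proof -
    have solve: "T = X / K + v * (- a * Y / K)" if "K * T = X - (v * a) * Y" "K \<noteq> 0" for K T X Y v a :: complex
      using that by (simp add: field_simps)
    show ?thesis
      unfolding top low d1 unfolding Suc
    proof (rule solve)
      show "of_nat (Suc n) * trace (mpow (V ** A) (Suc n) ** E)
         = lucas2 p d (Suc (Suc n)) * trace (V ** A ** E) - lucas2 p d (Suc n) * (d * trace E)
          - det V * det A * (lucas p d n * trace E + (lucas2 p d n * trace (V ** A ** E) - lucas2 p d (n - 1) * (d * trace E)))"
        using trace_mpow_Suc[of n "V ** A" E] unfolding pd(3) p_def[symmetric] d_def[symmetric]
        by (simp only: add_2_eq_Suc' Suc_eq_plus1[symmetric])
    qed (simp del: of_nat_Suc)
  qed
qed

section \<open>Means of products of matrix powers\<close>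

lemma haar_mean_sym_pair:
  assumes "schur_orthogonal V"
  shows "haar_mean (\<lambda>u. det (V u) ^ a * sym_pair J C (V u) * (det (cadj (V u)) ^ b * sym_pair K D (cadj (V u))))
    = (if a = b \<and> J = K then (\<Sum>i\<le>J. \<Sum>j\<le>J. C j i * D i j) / of_nat (J + 1) else 0)"
proof -
  define F where "F i j k l u = det (V u) ^ a * symcoef J (V u) i j * (det (cadj (V u)) ^ b * symcoef K (cadj (V u)) k l)" for i j k l u
  have V: "\<And>i j. continuous_on UNIV (\<lambda>u. V u $ i $ j)" using assms by (simp add: schur_orthogonal_def)
  have cont: "continuous_on UNIV (F i j k l)" for i j k l
    unfolding F_def
    by (intro continuous_on_mult continuous_on_power continuous_on_symcoef continuous_on_det_HC continuous_on_cadj V)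
  have mean: "haar_mean (F i j k l) = (if a = b \<and> J = K \<and> i = l \<and> j = k then 1 / of_nat (J + 1) else 0)"
    if "i \<le> J" "j \<le> J" "k \<le> K" "l \<le> K" for i j k l
    using assms that unfolding schur_orthogonal_def F_def by blast
  have "det (V u) ^ a * sym_pair J C (V u) * (det (cadj (V u)) ^ b * sym_pair K D (cadj (V u)))
     = (\<Sum>i\<le>J. \<Sum>j\<le>J. \<Sum>k\<le>K. \<Sum>l\<le>K. (C j i * D l k) * F i j k l u)" for u
  proof -
    have "sym_pair J C (V u) * sym_pair K D (cadj (V u))
       = (\<Sum>i\<le>J. \<Sum>j\<le>J. \<Sum>k\<le>K. \<Sum>l\<le>K. (symcoef J (V u) i j * C j i) * (symcoef K (cadj (V u)) k l * D l k))"
      unfolding sym_pair_def by (simp only: sum_distrib_right, simp only: sum_distrib_left)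
    then have "det (V u) ^ a * det (cadj (V u)) ^ b * (sym_pair J C (V u) * sym_pair K D (cadj (V u)))
       = (\<Sum>i\<le>J. \<Sum>j\<le>J. \<Sum>k\<le>K. \<Sum>l\<le>K. (C j i * D l k) * F i j k l u)"
      by (simp only: sum_distrib_left) (intro sum.cong refl, simp add: F_def mult_ac)
    then show ?thesis by (simp only: mult_ac)
  qed
  then have "haar_mean (\<lambda>u. det (V u) ^ a * sym_pair J C (V u) * (det (cadj (V u)) ^ b * sym_pair K D (cadj (V u))))
     = (\<Sum>i\<le>J. \<Sum>j\<le>J. \<Sum>k\<le>K. \<Sum>l\<le>K. (C j i * D l k) * haar_mean (F i j k l))"
    by (simp add: haar_mean_sum haar_mean_cmult cont continuous_on_sum continuous_on_mult_left)
  also have "\<dots> = (\<Sum>i\<le>J. \<Sum>j\<le>J. if a = b \<and> J = K then C j i * D i j / of_nat (J + 1) else 0)"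
  proof (intro sum.cong refl)
    fix i j assume ij: "i \<in> {..J}" "j \<in> {..J}"
    have "(\<Sum>k\<le>K. \<Sum>l\<le>K. (C j i * D l k) * haar_mean (F i j k l))
       = (\<Sum>k\<le>K. \<Sum>l\<le>K. if l = i then if k = j then if a = b \<and> J = K then C j i * D i j / of_nat (J + 1) else 0 else 0 else 0)"
      using ij by (intro sum.cong refl) (auto simp: mean)
    also have "\<dots> = (if a = b \<and> J = K then C j i * D i j / of_nat (J + 1) else 0)"
    proof (cases "a = b \<and> J = K")
      case False
      then show ?thesis by (simp only: if_False if_cancel sum.neutral_const)
    qed (use ij in \<open>simp add: sum.delta\<close>)
    finally show "(\<Sum>k\<le>K. \<Sum>l\<le>K. (C j i * D l k) * haar_mean (F i j k l))
      = (if a = b \<and> J = K then C j i * D i j / of_nat (J + 1) else 0)" .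
  qed
  also have "\<dots> = (if a = b \<and> J = K then (\<Sum>i\<le>J. \<Sum>j\<le>J. C j i * D i j) / of_nat (J + 1) else 0)"
  proof (cases "a = b \<and> J = K")
    case False
    then show ?thesis by (simp only: if_False if_cancel sum.neutral_const)
  qed (simp add: sum_divide_distrib)
  finally show ?thesis .
qed

lemma continuous_on_sym_pair:
  "(\<And>i j. continuous_on S (\<lambda>u. V u $ i $ j)) \<Longrightarrow> continuous_on S (\<lambda>u. sym_pair k C (V u))"
  unfolding sym_pair_def
  by (intro continuous_on_sum continuous_on_mult continuous_on_const continuous_on_symcoef)

definition coef_pairing :: "nat \<Rightarrow> (nat \<Rightarrow> nat \<Rightarrow> complex) \<Rightarrow> (nat \<Rightarrow> nat \<Rightarrow> complex) \<Rightarrow> complex" where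
  "coef_pairing k C D = (\<Sum>i\<le>k. \<Sum>j\<le>k. C i j * D j i) / of_nat (k + 1)"

text \<open>The mixed terms of type $\mathrm{Sym}^j$ against $\det \otimes \mathrm{Sym}^{k-2}$ vanish because the powers
  of $\det$ differ.\<close>

lemma haar_mean_trace_powers:
  assumes "schur_orthogonal V"
  shows "haar_mean (\<lambda>u. trace (mpow (V u ** A) j ** E) * trace (mpow (cadj (V u) ** B) k ** F))
    = (if j = k then coef_pairing k (top_coef k A E) (top_coef k B F)
        + coef_pairing (k - 2) (low_coef k A E) (low_coef k B F) else 0)"
proof -
  define G where "G a J C b K D u = det (V u) ^ a * sym_pair J C (V u) * (det (cadj (V u)) ^ b * sym_pair K D (cadj (V u)))" for a J C b K D u
  have V: "\<And>i j. continuous_on UNIV (\<lambda>u. V u $ i $ j)" using assms by (simp add: schur_orthogonal_def)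
  have cont: "continuous_on UNIV (G a J C b K D)" for a J C b K D
    unfolding G_def
    by (intro continuous_on_mult continuous_on_power continuous_on_sym_pair continuous_on_det_HC continuous_on_cadj V)
  have mean: "haar_mean (G a J C b K D) = (if a = b \<and> J = K then coef_pairing J C D else 0)" for a J C b K D
    unfolding G_def haar_mean_sym_pair[OF assms] coef_pairing_def by (subst sum.swap) simp
  have add: "haar_mean (\<lambda>u. f u + g u) = haar_mean f + haar_mean g"
    if "continuous_on UNIV f" "continuous_on UNIV g" for f g
    unfolding haar_mean_def distrib_left by (intro integral_add haar_integrable that)
  have zero: "coef_pairing n (low_coef m A' E') D = 0" "coef_pairing n C (low_coef m A' E') = 0" if "m < 2" for n m A' E' C D
    using that by (simp_all add: coef_pairing_def low_coef_def)
  have "trace (mpow (V u ** A) j ** E) * trace (mpow (cadj (V u) ** B) k ** F)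
    = (G 0 j (top_coef j A E) 0 k (top_coef k B F) u + G 0 j (top_coef j A E) 1 (k - 2) (low_coef k B F) u)
    + (G 1 (j - 2) (low_coef j A E) 0 k (top_coef k B F) u + G 1 (j - 2) (low_coef j A E) 1 (k - 2) (low_coef k B F) u)" for u
    unfolding trace_mpow_sym_pair G_def by (simp add: algebra_simps)
  then have "haar_mean (\<lambda>u. trace (mpow (V u ** A) j ** E) * trace (mpow (cadj (V u) ** B) k ** F))
    = (if j = k then coef_pairing j (top_coef j A E) (top_coef k B F) else 0)
    + (if j - 2 = k - 2 then coef_pairing (j - 2) (low_coef j A E) (low_coef k B F) else 0)"
    by (simp add: add cont continuous_on_add mean)
  \<comment> \<open>Truncated subtraction confuses the types for $j, k < 2$, but there \<open>low_coef\<close> vanishes.\<close>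
  also have "(if j - 2 = k - 2 then coef_pairing (j - 2) (low_coef j A E) (low_coef k B F) else 0)
    = (if j = k then coef_pairing (k - 2) (low_coef k A E) (low_coef k B F) else 0)"
  proof (cases "j < 2 \<or> k < 2")
    case True
    then show ?thesis using zero by auto
  next
    case False
    then show ?thesis by (auto simp: eq_diff_iff)
  qed
  finally show ?thesis by simp
qed

text \<open>The general shape of the second derivatives: a quadratic expression in the directions
  \<open>E\<close>, \<open>F\<close> with four scalar coefficients.\<close>

definition pair_form :: "complex \<Rightarrow> complex \<Rightarrow> complex \<Rightarrow> complex \<Rightarrow> HC \<Rightarrow> HC \<Rightarrow> HC \<Rightarrow> HC \<Rightarrow> complex" where
  "pair_form c1 c2 c3 c4 A B E F = c1 * trace (A ** E ** B ** F) + c2 * (trace E * trace F)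
     + c3 * (trace (B ** A ** E) * trace (A ** B ** F))
     + c4 * (trace (B ** A ** E) * trace F + trace E * trace (A ** B ** F))"

lemma sum_dsymcoef_dsymcoef_mult:
  fixes A B :: HC and k :: nat
  defines "p \<equiv> trace (A ** B)" and "d \<equiv> det A * det B"
  shows "(\<Sum>i\<le>k. \<Sum>j\<le>k. dsymcoef k A (A ** E) i j * dsymcoef k B (B ** F) j i)
   = pair_form (lucas2 p d (k + 1)) (2 * d\<^sup>2 * lucas3 p d (k - 1) - d * lucas2 p d k)
       (2 * lucas3 p d (k + 1)) (- 2 * d * lucas3 p d k) A B E F"
proof -
  have tr: "trace (A ** E ** B) = trace (B ** A ** E)" by (metis matrix_mul_assoc trace_mul_sym)
  show ?thesis
    unfolding sum_dsymcoef_dsymcoef pair_form_def adjugate_mult_cancel cscale_simps p_def[symmetric] d_def[symmetric]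
    unfolding matrix_mul_assoc tr
    by (simp add: d_def power2_eq_square algebra_simps del: lucas2.simps lucas3.simps)
qed

lemma coef_pairing_top:
  fixes A B :: HC and n :: nat
  defines "p \<equiv> trace (A ** B)" and "d \<equiv> det A * det B" and "k \<equiv> Suc n"
  shows "coef_pairing k (top_coef k A E) (top_coef k B F)
   = pair_form (lucas2 p d (k + 1)) (2 * d\<^sup>2 * lucas3 p d (k - 1) - d * lucas2 p d k)
       (2 * lucas3 p d (k + 1)) (- 2 * d * lucas3 p d k) A B E F / ((of_nat k)\<^sup>2 * of_nat (k + 1))"
proof -
  have "k \<noteq> 0" by (simp add: k_def)
  then have "coef_pairing k (top_coef k A E) (top_coef k B F)
     = (\<Sum>i\<le>k. \<Sum>j\<le>k. dsymcoef k A (A ** E) i j * dsymcoef k B (B ** F) j i) / ((of_nat k)\<^sup>2 * of_nat (k + 1))"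
    by (simp add: coef_pairing_def top_coef_def sum_divide_distrib power2_eq_square)
  then show ?thesis unfolding sum_dsymcoef_dsymcoef_mult p_def d_def .
qed

lemma coef_pairing_low:
  fixes A B :: HC and m :: nat
  defines "p \<equiv> trace (A ** B)" and "d \<equiv> det A * det B"
  shows "coef_pairing m (low_coef (m + 2) A E) (low_coef (m + 2) B F)
   = d * pair_form (lucas2 p d (m + 1)) (lucas p d (m + 1) - 3 * d * lucas2 p d m + 2 * d\<^sup>2 * lucas3 p d (m - 1))
       (2 * lucas3 p d (m + 1)) (lucas2 p d (m + 1) - 2 * d * lucas3 p d m) A B E F
     / ((of_nat (m + 2))\<^sup>2 * of_nat (m + 1))"
proof -
  define K where "K = complex_of_nat (m + 2)"
  define a a' b b' where "a = symcoef m A" and "a' = dsymcoef m A (A ** E)"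
    and "b = symcoef m B" and "b' = dsymcoef m B (B ** F)"
  have tr: "trace (A ** E ** B) = trace (B ** A ** E)" "trace (B ** F ** A) = trace (A ** B ** F)"
    "trace (B ** A) = p" "det B * det A = d"
    unfolding p_def d_def by (metis matrix_mul_assoc trace_mul_sym, metis matrix_mul_assoc trace_mul_sym,
      rule trace_mul_sym, rule mult.commute)
  have ab: "(\<Sum>i\<le>m. \<Sum>j\<le>m. a i j * b j i) = lucas p d (m + 1)"
    using trace_symcoef_mult[of m A B] by (simp add: a_def b_def p_def d_def del: lucas.simps)
  have a'b: "(\<Sum>i\<le>m. \<Sum>j\<le>m. a' i j * b j i) = lucas2 p d (m + 1) * trace (B ** A ** E) - lucas2 p d m * (d * trace E)"
    using sum_dsymcoef_symcoef'[of m A E B] by (simp add: a'_def b_def p_def d_def tr del: lucas2.simps)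
  have ab': "(\<Sum>i\<le>m. \<Sum>j\<le>m. a i j * b' j i) = lucas2 p d (m + 1) * trace (A ** B ** F) - lucas2 p d m * (d * trace F)"
  proof -
    have "(\<Sum>i\<le>m. \<Sum>j\<le>m. a i j * b' j i) = (\<Sum>i\<le>m. \<Sum>j\<le>m. dsymcoef m B (B ** F) i j * symcoef m A j i)"
      by (subst sum.swap) (simp add: a_def b'_def mult.commute)
    then show ?thesis unfolding sum_dsymcoef_symcoef' tr by simp
  qed
  have a'b': "(\<Sum>i\<le>m. \<Sum>j\<le>m. a' i j * b' j i) = pair_form (lucas2 p d (m + 1)) (2 * d\<^sup>2 * lucas3 p d (m - 1) - d * lucas2 p d m)
       (2 * lucas3 p d (m + 1)) (- 2 * d * lucas3 p d m) A B E F"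
    unfolding a'_def b'_def p_def d_def by (rule sum_dsymcoef_dsymcoef_mult)
  have "coef_pairing m (low_coef (m + 2) A E) (low_coef (m + 2) B F)
     = (\<Sum>i\<le>m. \<Sum>j\<le>m. (d / K\<^sup>2) * ((a i j * trace E + a' i j) * (b j i * trace F + b' j i))) / of_nat (m + 1)"
    unfolding coef_pairing_def
    by (rule arg_cong[where f = "\<lambda>x. x / _"]) (intro sum.cong refl,
      simp add: low_coef_def a_def a'_def b_def b'_def K_def d_def power2_eq_square)
  also have "\<dots> = d / K\<^sup>2 * (trace E * trace F * (\<Sum>i\<le>m. \<Sum>j\<le>m. a i j * b j i)
      + trace F * (\<Sum>i\<le>m. \<Sum>j\<le>m. a' i j * b j i) + trace E * (\<Sum>i\<le>m. \<Sum>j\<le>m. a i j * b' j i)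
      + (\<Sum>i\<le>m. \<Sum>j\<le>m. a' i j * b' j i)) / of_nat (m + 1)"
    unfolding sum_distrib_left sum.distrib[symmetric]
    by (rule arg_cong[where f = "\<lambda>x. x / _"]) (intro sum.cong refl, simp add: algebra_simps)
  also have "trace E * trace F * (\<Sum>i\<le>m. \<Sum>j\<le>m. a i j * b j i)
      + trace F * (\<Sum>i\<le>m. \<Sum>j\<le>m. a' i j * b j i) + trace E * (\<Sum>i\<le>m. \<Sum>j\<le>m. a i j * b' j i)
      + (\<Sum>i\<le>m. \<Sum>j\<le>m. a' i j * b' j i)
    = pair_form (lucas2 p d (m + 1)) (lucas p d (m + 1) - 3 * d * lucas2 p d m + 2 * d\<^sup>2 * lucas3 p d (m - 1))
       (2 * lucas3 p d (m + 1)) (lucas2 p d (m + 1) - 2 * d * lucas3 p d m) A B E F"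
    unfolding ab a'b ab' a'b' pair_form_def by (simp only: algebra_simps) (simp add: algebra_simps)
  finally show ?thesis by (simp add: K_def del: of_nat_Suc)
qed

definition unit_matrix :: "2 \<Rightarrow> 2 \<Rightarrow> HC" where
  "unit_matrix p i = (\<chi> a b. if a = p \<and> b = i then 1 else 0)"

lemma trace_unit_matrix: "trace (Z ** unit_matrix p i) = Z $ i $ p"
  "trace (unit_matrix p i) = (if p = i then 1 else 0)"
  "(Z ** unit_matrix p i ** Y) $ q $ l = Z $ q $ p * Y $ i $ l"
  using exhaust_2[of p] exhaust_2[of i]
  by (auto simp: unit_matrix_def trace_def matrix_matrix_mult_def sum_2)

text \<open>Traces against matrix units recover the entries, so the means of products of two traces
  suffice.\<close>

lemma triple_product_entry:
  "(M ** B ** L) $ i $ l = (\<Sum>p\<in>UNIV. \<Sum>q\<in>UNIV. B $ p $ q * (trace (M ** unit_matrix p i) * trace (L ** unit_matrix l q)))"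
  unfolding trace_unit_matrix by (simp add: matrix_matrix_mult_def sum_2 algebra_simps)

text \<open>Contracting the two directions with the matrix in the middle turns the four parts of
  \<open>pair_form\<close> into multiples of $B$, $BN$ and $BN^2$.\<close>

lemma pair_form_contract:
  fixes A B :: HC
  defines "N \<equiv> A ** B"
  shows "(\<Sum>p\<in>UNIV. \<Sum>q\<in>UNIV. B $ p $ q * pair_form c1 c2 c3 c4 A B (unit_matrix p i) (unit_matrix l q))
    = (c1 * trace N + c2) * B $ i $ l + c3 * (B ** N ** N) $ i $ l + 2 * c4 * (B ** N) $ i $ l"
proof -
  have BN: "(B ** N) $ i $ l = (\<Sum>p\<in>UNIV. (B ** A) $ i $ p * B $ p $ l)"
    "(B ** N) $ i $ l = (\<Sum>q\<in>UNIV. B $ i $ q * N $ q $ l)"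
    "(B ** N ** N) $ i $ l = (\<Sum>p\<in>UNIV. \<Sum>q\<in>UNIV. (B ** A) $ i $ p * B $ p $ q * N $ q $ l)"
    unfolding N_def by (simp_all add: matrix_matrix_mult_def sum_2 algebra_simps)
  have "(\<Sum>p\<in>UNIV. \<Sum>q\<in>UNIV. B $ p $ q * pair_form c1 c2 c3 c4 A B (unit_matrix p i) (unit_matrix l q))
    = (\<Sum>p\<in>UNIV. \<Sum>q\<in>UNIV. B $ p $ q * (c1 * (A $ q $ p * B $ i $ l)
        + c2 * ((if p = i then 1 else 0) * (if l = q then 1 else 0)) + c3 * ((B ** A) $ i $ p * N $ q $ l)
        + c4 * ((B ** A) $ i $ p * (if l = q then 1 else 0) + (if p = i then 1 else 0) * N $ q $ l)))"
    unfolding pair_form_def trace_unit_matrix N_def by simp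
  also have "\<dots> = (c1 * trace N + c2) * B $ i $ l + c3 * (\<Sum>p\<in>UNIV. \<Sum>q\<in>UNIV. (B ** A) $ i $ p * B $ p $ q * N $ q $ l)
     + c4 * ((\<Sum>p\<in>UNIV. (B ** A) $ i $ p * B $ p $ l) + (\<Sum>q\<in>UNIV. B $ i $ q * N $ q $ l))"
  proof -
    have "trace N = A$1$1 * B$1$1 + A$1$2 * B$2$1 + (A$2$1 * B$1$2 + A$2$2 * B$2$2)"
      by (simp add: N_def trace_def matrix_matrix_mult_def sum_2)
    then show ?thesis using exhaust_2[of i] exhaust_2[of l] by (auto simp: sum_2 algebra_simps)
  qed
  finally show ?thesis unfolding BN(3) using BN(1,2) by simp
qed

text \<open>After reduction of $BN^2$ by Cayley--Hamilton, the coefficients of $1/D^3$ occur only in the two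
  combinations of \<open>lucas2_eq_lucas3\<close> and \<open>lucas2_eq_lucas3'\<close>, which are multiples of
  coefficients of $1/D^2$.\<close>

lemma lucas_contract_top:
  fixes p d b x bn bnn :: complex
  defines "a \<equiv> lucas2 p d" and "t \<equiv> lucas3 p d"
  assumes bnn: "bnn = p * bn - d * b"
  shows "(a (m + 1) * p + (2 * d\<^sup>2 * t (m - 1) - d * a m)) * b + 2 * t (m + 1) * bnn + 2 * (- 2 * d * t m) * bn
    = (p * a (m + 1) - of_nat (m + 1) * d * a m) * b + (of_nat m - 1) * a (m + 1) * bn"
proof (cases m)
  case 0
  then show ?thesis by (simp add: a_def t_def)
next
  case (Suc n)
  have 1: "of_nat (n + 1) * a (n + 1) = 2 * (t (n + 2) - d * t n)"
    unfolding a_def t_def by (rule lucas2_eq_lucas3)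
  have 2: "of_nat n * a (n + 2) = 2 * p * t (n + 2) - 4 * d * t (n + 1)"
    unfolding a_def t_def by (rule lucas2_eq_lucas3')
  have "(a (m + 1) * p + (2 * d\<^sup>2 * t (m - 1) - d * a m)) * b + 2 * t (m + 1) * bnn + 2 * (- 2 * d * t m) * bn
     = (p * a (n + 2) - d * (a (n + 1) + 2 * (t (n + 2) - d * t n))) * b + (2 * p * t (n + 2) - 4 * d * t (n + 1)) * bn"
    unfolding bnn by (simp add: Suc power2_eq_square algebra_simps)
  also have "\<dots> = (p * a (n + 2) - d * (a (n + 1) + of_nat (n + 1) * a (n + 1))) * b + of_nat n * a (n + 2) * bn"
    unfolding 1 2 ..
  finally show ?thesis by (simp add: Suc algebra_simps)
qed

text \<open>The contribution of type $\mathrm{Sym}^k$, with $k = n + 1$, is a combination of the first two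
  families; \<open>b\<close> and \<open>x\<close> stand for entries of $Y^+$ and $N(Y)X$.\<close>

lemma lucas_contract_top':
  fixes p d b x bn bnn :: complex
  defines "a \<equiv> lucas2 p d"
  assumes bn: "bn = p * b - x"
  shows "of_nat (n + 2) * ((p * a (n + 2) - of_nat (n + 2) * d * a (n + 1)) * b + of_nat n * a (n + 2) * bn)
    = (of_nat (n + 1))\<^sup>2 * (a (n + 3) * b - a (n + 2) * x) + (a (n + 2) * x - a (n + 1) * d * b)"
proof -
  have 1: "of_nat (n + 1) * lucas p d (n + 2) = p * a (n + 2) - 2 * d * a (n + 1)"
    unfolding a_def by (rule lucas_eq_lucas2')
  have 2: "a (n + 3) = p * a (n + 2) - d * a (n + 1) + lucas p d (n + 2)"
    by (simp add: a_def numeral_3_eq_3)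
  have "(of_nat (n + 1))\<^sup>2 * a (n + 3) = (of_nat (n + 1))\<^sup>2 * (p * a (n + 2) - d * a (n + 1)) + of_nat (n + 1) * (p * a (n + 2) - 2 * d * a (n + 1))"
    unfolding 2 1[symmetric] by (simp add: power2_eq_square algebra_simps)
  then show ?thesis
    unfolding bn by (simp add: right_diff_distrib mult.assoc[symmetric] del: of_nat_Suc of_nat_add) (simp add: power2_eq_square algebra_simps)
qed

text \<open>The contribution of type $\det \otimes \mathrm{Sym}^m$ is a multiple of the third family.\<close>

lemma lucas_contract_low:
  fixes p d b x bn bnn :: complex
  defines "h \<equiv> lucas p d" and "a \<equiv> lucas2 p d" and "t \<equiv> lucas3 p d"
  assumes bnn: "bnn = p * bn - d * b" and bn: "bn = p * b - x"
  shows "(a (m + 1) * p + (h (m + 1) - 3 * d * a m + 2 * d\<^sup>2 * t (m - 1))) * b + 2 * t (m + 1) * bnn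
      + 2 * (a (m + 1) - 2 * d * t m) * bn
    = of_nat (m + 1) * (a (m + 2) * b - a (m + 1) * x)"
proof -
  have 1: "of_nat m * h (m + 1) = p * a (m + 1) - 2 * d * a m"
    using lucas_eq_lucas2'[of "m - 1" p d] by (cases m) (simp_all add: h_def a_def)
  have 2: "a (m + 2) = p * a (m + 1) - d * a m + h (m + 1)"
    by (simp add: h_def a_def)
  have "(a (m + 1) * p + (h (m + 1) - 3 * d * a m + 2 * d\<^sup>2 * t (m - 1))) * b + 2 * t (m + 1) * bnn
      + 2 * (a (m + 1) - 2 * d * t m) * bn
    = ((a (m + 1) * p + (2 * d\<^sup>2 * t (m - 1) - d * a m)) * b + 2 * t (m + 1) * bnn + 2 * (- 2 * d * t m) * bn)
      + (h (m + 1) - 2 * d * a m) * b + 2 * a (m + 1) * bn"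
    by (simp add: algebra_simps)
  also have "\<dots> = (p * a (m + 1) - of_nat (m + 1) * d * a m) * b + (of_nat m - 1) * a (m + 1) * bn
      + (h (m + 1) - 2 * d * a m) * b + 2 * a (m + 1) * bn"
    unfolding h_def a_def t_def lucas_contract_top[OF bnn] by (rule refl)
  also have "\<dots> = (p * a (m + 1) - 2 * d * a m + h (m + 1)) * b + of_nat (m + 1) * ((p * a (m + 1) - d * a m) * b - a (m + 1) * x)"
    unfolding bn by (simp add: algebra_simps)
  also have "\<dots> = of_nat (m + 1) * (a (m + 2) * b - a (m + 1) * x)"
    unfolding 1[symmetric] 2 by (simp add: algebra_simps)
  finally show ?thesis .
qed

section \<open>The mean value as a sum of gradients of characters\<close>

text \<open>The sum of the terms with $l = k/2$ of the three series. For \<open>k = 0\<close> the second coefficient is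
  zero by the convention on division; the third series starts at $l = 1$.\<close>

definition mean_term :: "nat \<Rightarrow> HC \<Rightarrow> HC \<Rightarrow> HC" where
  "mean_term k X Y = (1 / (of_nat k + 1)\<^sup>2) \<cdot>\<^sub>c char_grad_left k X Y
     + (1 / ((of_nat k)\<^sup>2 * (of_nat k + 1)\<^sup>2)) \<cdot>\<^sub>c char_grad_right k X Y
     + (if k < 2 then 0 else (det X * det Y / (of_nat k)\<^sup>2) \<cdot>\<^sub>c char_grad_left (k - 2) X Y)"

lemma haar_mean_power_product:
  assumes V: "schur_orthogonal V"
  shows "haar_mean (\<lambda>u. (mpow (V u ** adjugate X) j ** adjugate Y ** mpow (cadj (V u) ** adjugate Y) k) $ i $ l)
    = (if j = k then mean_term k X Y $ i $ l else 0)"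
proof -
  define A B where "A = adjugate X" and "B = adjugate Y"
  define p d where "p = trace (A ** B)" and "d = det A * det B"
  define G where "G = (\<lambda>q r. coef_pairing k (top_coef k A (unit_matrix q i)) (top_coef k B (unit_matrix l r))
        + coef_pairing (k - 2) (low_coef k A (unit_matrix q i)) (low_coef k B (unit_matrix l r)))"
  have cont: "continuous_on UNIV (\<lambda>u. trace (mpow (V u ** A) j ** E) * trace (mpow (cadj (V u) ** B) k ** F))" for E F
    using V unfolding trace_mpow_sym_pair schur_orthogonal_def
    by (intro continuous_on_mult continuous_on_add continuous_on_sym_pair continuous_on_det_HC continuous_on_cadj) auto
  have "haar_mean (\<lambda>u. (mpow (V u ** A) j ** B ** mpow (cadj (V u) ** B) k) $ i $ l)
     = (\<Sum>q\<in>UNIV. \<Sum>r\<in>UNIV. B $ q $ r * haar_mean (\<lambda>u. trace (mpow (V u ** A) j ** unit_matrix q i)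
          * trace (mpow (cadj (V u) ** B) k ** unit_matrix l r)))"
    unfolding triple_product_entry
    by (simp add: haar_mean_sum haar_mean_cmult cont continuous_on_sum continuous_on_mult_left)
  also have "\<dots> = (if j = k then (\<Sum>q\<in>UNIV. \<Sum>r\<in>UNIV. B $ q $ r * G q r) else 0)"
    unfolding haar_mean_trace_powers[OF V] G_def by simp
  also have "(\<Sum>q\<in>UNIV. \<Sum>r\<in>UNIV. B $ q $ r * G q r) = mean_term k X Y $ i $ l"
  proof (cases k)
    case 0
    have "G q r = (if q = i then 1 else 0) * (if l = r then 1 else 0)" for q r
      by (simp add: G_def 0 coef_pairing_def top_coef_def low_coef_def trace_unit_matrix)
    then have "(\<Sum>q\<in>UNIV. \<Sum>r\<in>UNIV. B $ q $ r * G q r) = B $ i $ l"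
      using exhaust_2[of i] exhaust_2[of l] by (auto simp: sum_2)
    then show ?thesis by (simp add: 0 mean_term_def char_grad_left_def B_def numeral_2_eq_2)
  next
    case (Suc n)
    define b x bn bnn where "b = B $ i $ l" and "x = det Y * X $ i $ l"
      and "bn = (B ** (A ** B)) $ i $ l" and "bnn = (B ** (A ** B) ** (A ** B)) $ i $ l"
    \<comment> \<open>Indeed $BAB = pB - (BA)^+B$, and $(BA)^+B = A^+B^+B = N(Y)X$.\<close>
    have bn: "bn = p * b - x"
    proof -
      have "B ** (A ** B) = p \<cdot>\<^sub>c B - det Y \<cdot>\<^sub>c X"
        by (simp add: A_def B_def p_def HC_eq_iff adjugate_def matrix_matrix_mult_def sum_2 trace_def det_2 algebra_simps)
      then show ?thesis by (simp add: bn_def b_def x_def)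
    qed
    have bnn: "bnn = p * bn - d * b"
    proof -
      have "B ** (A ** B) ** (A ** B) = B ** (p \<cdot>\<^sub>c (A ** B) - d \<cdot>\<^sub>c mat 1)"
        unfolding matrix_mul_assoc[symmetric] cayley_hamilton[of "A ** B", unfolded matrix_mul_assoc[symmetric]] p_def d_def det_mul ..
      also have "\<dots> = p \<cdot>\<^sub>c (B ** (A ** B)) - d \<cdot>\<^sub>c B"
        by (simp add: matrix_sub_distrib cscale_simps)
      finally show ?thesis by (simp add: bn_def bnn_def b_def)
    qed
    have pd: "trace (X ** Y) = p" "det X * det Y = d"
      by (simp_all add: p_def d_def A_def B_def adjugate_def trace_def matrix_matrix_mult_def sum_2 det_2 algebra_simps)
    have lin: "(\<Sum>q\<in>UNIV. \<Sum>r\<in>UNIV. B $ q $ r * pair_form c1 c2 c3 c4 A B (unit_matrix q i) (unit_matrix l r))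
       = (c1 * p + c2) * b + c3 * bnn + 2 * c4 * bn" for c1 c2 c3 c4
      unfolding pair_form_contract p_def b_def bn_def bnn_def ..
    define t1 t2 t3 where "t1 = lucas2 p d (n + 3) * b - lucas2 p d (n + 2) * x"
      and "t2 = lucas2 p d (n + 2) * x - lucas2 p d (n + 1) * d * b"
      and "t3 = lucas2 p d (n + 1) * b - lucas2 p d n * x"
    have top: "(\<Sum>q\<in>UNIV. \<Sum>r\<in>UNIV. B $ q $ r * coef_pairing k (top_coef k A (unit_matrix q i)) (top_coef k B (unit_matrix l r)))
       = ((of_nat k)\<^sup>2 * t1 + t2) / ((of_nat k)\<^sup>2 * (of_nat k + 1)\<^sup>2)"
    proof -
      have "(\<Sum>q\<in>UNIV. \<Sum>r\<in>UNIV. B $ q $ r * coef_pairing k (top_coef k A (unit_matrix q i)) (top_coef k B (unit_matrix l r)))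
        = ((p * lucas2 p d (n + 2) - of_nat (n + 2) * d * lucas2 p d (n + 1)) * b + of_nat n * lucas2 p d (n + 2) * bn)
           / ((of_nat k)\<^sup>2 * of_nat (k + 1))"
        unfolding Suc coef_pairing_top times_divide_eq_right sum_divide_distrib[symmetric] p_def[symmetric] d_def[symmetric] lin
          lucas_contract_top[OF bnn]
        by simp
      also have "\<dots> = (of_nat (n + 2) * ((p * lucas2 p d (n + 2) - of_nat (n + 2) * d * lucas2 p d (n + 1)) * b + of_nat n * lucas2 p d (n + 2) * bn))
           / ((of_nat k)\<^sup>2 * (of_nat k + 1)\<^sup>2)"
      proof -
        have "of_nat (n + 2) = complex_of_nat k + 1" "of_nat (k + 1) = complex_of_nat k + 1" "complex_of_nat k + 1 \<noteq> 0"
          using of_nat_neq_0[of k, where 'a = complex] by (simp_all add: Suc add.commute)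
        then show ?thesis by (simp only: power2_eq_square) simp
      qed
      finally show ?thesis unfolding lucas_contract_top'[OF bn] t1_def t2_def by (simp add: Suc)
    qed
    have low: "(\<Sum>q\<in>UNIV. \<Sum>r\<in>UNIV. B $ q $ r * coef_pairing (k - 2) (low_coef k A (unit_matrix q i)) (low_coef k B (unit_matrix l r)))
       = d * t3 / (of_nat k)\<^sup>2"
    proof (cases n)
      case 0
      then show ?thesis using Suc by (simp add: coef_pairing_def low_coef_def t3_def)
    next
      case (Suc m)
      have k: "k = m + 2" "k - 2 = m" using Suc \<open>k = Suc n\<close> by simp_all
      have "B $ q $ r * (d * F / c) = d * (B $ q $ r * F) / c" for q r F c by simp
      then have "(\<Sum>q\<in>UNIV. \<Sum>r\<in>UNIV. B $ q $ r * coef_pairing (k - 2) (low_coef k A (unit_matrix q i)) (low_coef k B (unit_matrix l r)))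
         = d * (of_nat (m + 1) * (lucas2 p d (m + 2) * b - lucas2 p d (m + 1) * x)) / ((of_nat (m + 2))\<^sup>2 * of_nat (m + 1))"
        unfolding k(2) unfolding k(1) coef_pairing_low p_def[symmetric] d_def[symmetric]
        by (simp only: sum_divide_distrib[symmetric] sum_distrib_left[symmetric] lin lucas_contract_low[OF bnn bn])
      also have "\<dots> = d * t3 / (of_nat k)\<^sup>2"
        unfolding t3_def Suc k(1) by (simp add: numeral_2_eq_2 del: of_nat_Suc lucas2.simps)
      finally show ?thesis .
    qed
    have "(\<Sum>q\<in>UNIV. \<Sum>r\<in>UNIV. B $ q $ r * G q r)
       = ((of_nat k)\<^sup>2 * t1 + t2) / ((of_nat k)\<^sup>2 * (of_nat k + 1)\<^sup>2) + d * t3 / (of_nat k)\<^sup>2"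
      unfolding G_def distrib_left sum.distrib top low ..
    also have "\<dots> = t1 / (of_nat k + 1)\<^sup>2 + t2 / ((of_nat k)\<^sup>2 * (of_nat k + 1)\<^sup>2) + d * t3 / (of_nat k)\<^sup>2"
      using Suc by (simp add: add_divide_distrib del: of_nat_Suc)
    also have "\<dots> = mean_term k X Y $ i $ l"
    proof -
      have "char_grad_left k X Y $ i $ l = t1"
        unfolding char_grad_left_def pd Suc t1_def b_def x_def B_def
        by (simp add: numeral_3_eq_3 numeral_2_eq_2 del: lucas2.simps)
      moreover have "char_grad_right k X Y $ i $ l = t2"
        unfolding char_grad_right_def pd Suc t2_def b_def x_def B_def
        by (simp add: numeral_2_eq_2 pd mult.assoc del: lucas2.simps)
      moreover have "char_grad_left (k - 2) X Y $ i $ l = t3" if "\<not> k < 2"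
        using that unfolding char_grad_left_def pd Suc t3_def b_def x_def B_def
        by (cases n) (simp_all add: numeral_2_eq_2 del: lucas2.simps)
      moreover have "t3 = 0" if "k < 2" using that Suc by (simp add: t3_def)
      ultimately show ?thesis by (auto simp: mean_term_def pd)
    qed
    finally show ?thesis .
  qed
  finally show ?thesis by (simp only: A_def B_def)
qed

section \<open>Contractions from the two domains\<close>

definition contraction_factor :: "real \<Rightarrow> HC \<Rightarrow> bool" where
  "contraction_factor q A \<longleftrightarrow> 0 \<le> q \<and> (\<forall>v. norm (A *v v) \<le> q * norm v)"

lemma norm_vec2_sq: "(norm v)\<^sup>2 = (cmod (v$1))\<^sup>2 + (cmod (v$2))\<^sup>2" for v :: "complex^2"
  by (simp add: norm_vec_def L2_set_def sum_2)

lemma norm_vec2_sq_inner: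
  "complex_of_real ((norm w)\<^sup>2) = (\<Sum>i\<in>UNIV. cnj (w$i) * w$i)" for w :: "complex^2"
  by (simp add: norm_vec2_sq sum_2 complex_norm_square mult.commute del: of_real_power)

lemma norm_vec2_eq:
  "(cmod (v$1))\<^sup>2 + (cmod (v$2))\<^sup>2 = (cmod (w$1))\<^sup>2 + (cmod (w$2))\<^sup>2 \<Longrightarrow> norm v = norm w" for v w :: "complex^2"
  by (metis norm_vec2_sq norm_ge_zero power2_eq_imp_eq)

lemma norm_axis2: "norm (axis j 1 :: complex^2) = 1"
proof (rule power2_eq_imp_eq)
  show "(norm (axis j 1 :: complex^2))\<^sup>2 = 1\<^sup>2"
    using exhaust_2[of j] by (auto simp: norm_vec2_sq axis_def)
qed auto

lemma contraction_factor_mpow: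
  assumes "contraction_factor q M"
  shows "norm (mpow M n *v v) \<le> q ^ n * norm v"
proof (induction n)
  case (Suc n)
  have "norm (mpow M (Suc n) *v v) \<le> q * norm (mpow M n *v v)"
    using assms by (simp add: contraction_factor_def flip: matrix_vector_mul_assoc)
  also have "\<dots> \<le> q * (q ^ n * norm v)"
    using assms Suc by (intro mult_left_mono) (auto simp: contraction_factor_def)
  finally show ?case by (simp add: mult.assoc)
qed simp

lemma contraction_factor_entry:
  assumes "contraction_factor q M"
  shows "cmod (mpow M n $ i $ j) \<le> q ^ n"
proof -
  have "(mpow M n *v axis j 1) $ i = mpow M n $ i $ j"
    using exhaust_2[of j] by (auto simp: matrix_vector_mult_def sum_2 axis_def)
  then show ?thesis
    using contraction_factor_mpow[OF assms, of n "axis j 1"]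
      Finite_Cartesian_Product.norm_nth_le[of "mpow M n *v axis j 1" i] by (simp add: norm_axis2)
qed

lemma contraction_factor_mult:
  assumes "contraction_factor q A" "contraction_factor r B"
  shows "contraction_factor (q * r) (A ** B)"
  unfolding contraction_factor_def
proof (intro conjI allI)
  fix v
  have "norm ((A ** B) *v v) \<le> q * norm (B *v v)"
    using assms(1) by (simp add: contraction_factor_def flip: matrix_vector_mul_assoc)
  also have "\<dots> \<le> q * (r * norm v)"
    using assms by (intro mult_left_mono) (auto simp: contraction_factor_def)
  finally show "norm ((A ** B) *v v) \<le> q * r * norm v" by (simp add: mult.assoc)
qed (use assms in \<open>auto simp: contraction_factor_def\<close>)

lemma contraction_factor_unitary:
  assumes "cadj V ** V = mat 1"
  shows "contraction_factor 1 V"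
proof -
  have "norm (V *v v) = norm v" for v
  proof -
    have "(\<Sum>i\<in>UNIV. cnj ((V *v v)$i) * (V *v v)$i) = (\<Sum>i\<in>UNIV. cnj (v$i) * ((cadj V ** V) *v v)$i)"
      by (simp add: matrix_vector_mult_def matrix_matrix_mult_def cadj_def sum_2 algebra_simps)
    then have "complex_of_real ((norm (V *v v))\<^sup>2) = complex_of_real ((norm v)\<^sup>2)"
      unfolding norm_vec2_sq_inner assms by simp
    then have "(norm (V *v v))\<^sup>2 = (norm v)\<^sup>2" by (rule of_real_eq_iff[THEN iffD1])
    then show ?thesis by (metis norm_ge_zero power2_eq_imp_eq)
  qed
  then show ?thesis by (simp add: contraction_factor_def)
qed

text \<open>For $w = A^Tv$ one has $|w|^2 = (A\overline w) \cdot v$, to which Cauchy--Schwarz applies.\<close>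

lemma contraction_factor_transpose:
  assumes "contraction_factor q A"
  shows "contraction_factor q (transpose A)"
  unfolding contraction_factor_def
proof (intro conjI allI)
  show "0 \<le> q" using assms by (simp add: contraction_factor_def)
  fix v
  define w where "w = transpose A *v v"
  define c :: "complex^2" where "c = (\<chi> i. cnj (w$i))"
  have "norm c = norm w" by (rule norm_vec2_eq) (simp add: c_def)
  have "complex_of_real ((norm w)\<^sup>2) = (\<Sum>i\<in>UNIV. c$i * w$i)"
    by (simp add: norm_vec2_sq sum_2 complex_norm_square mult.commute c_def del: of_real_power)
  also have "\<dots> = (\<Sum>k\<in>UNIV. (A *v c)$k * v$k)"
    by (simp add: w_def matrix_vector_mult_def transpose_def sum_2 algebra_simps)
  finally have "(norm w)\<^sup>2 = cmod (\<Sum>k\<in>UNIV. (A *v c)$k * v$k)"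
    by (metis norm_of_real abs_power2 abs_norm_cancel power2_abs)
  also have "\<dots> \<le> (\<Sum>k\<in>UNIV. cmod ((A *v c)$k) * cmod (v$k))"
    by (rule order_trans[OF norm_sum]) (simp add: norm_mult)
  also have "\<dots> \<le> norm (A *v c) * norm v"
    unfolding norm_vec_def using L2_set_mult_ineq[of "\<lambda>k. cmod ((A *v c)$k)" "\<lambda>k. cmod (v$k)" UNIV] by simp
  also have "\<dots> \<le> (q * norm w) * norm v"
    using assms \<open>norm c = norm w\<close> unfolding contraction_factor_def by (metis mult_right_mono norm_ge_zero)
  finally have "norm w * norm w \<le> norm w * (q * norm v)" by (simp add: power2_eq_square mult_ac)
  then have "norm w \<le> q * norm v"
    using \<open>0 \<le> q\<close> by (cases "norm w = 0") (simp_all add: mult_le_cancel_left)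
  then show "norm (transpose A *v v) \<le> q * norm v" unfolding w_def .
qed

text \<open>The unit sphere is compact, so the norm of the image attains a maximum there, which is less than
  one.\<close>

lemma contraction_factor_exists:
  assumes "\<And>v. v \<noteq> 0 \<Longrightarrow> norm (A *v v) < norm v"
  obtains q where "q < 1" "contraction_factor q A"
proof -
  have "compact (sphere (0::complex^2) 1)" by simp
  moreover have "axis 1 1 \<in> sphere (0::complex^2) 1"
    by (simp add: norm_axis2)
  moreover have "continuous_on (sphere 0 1) (\<lambda>v. norm (A *v v))"
    unfolding matrix_vector_mult_def by (intro continuous_intros)
  ultimately obtain v0 where v0: "v0 \<in> sphere 0 1" "\<And>v. v \<in> sphere 0 1 \<Longrightarrow> norm (A *v v) \<le> norm (A *v v0)"
    using continuous_attains_sup[of "sphere 0 1" "\<lambda>v. norm (A *v v)"] by blast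
  define q where "q = norm (A *v v0)"
  have "v0 \<noteq> 0" using v0(1) by auto
  then have "q < 1" using assms[of v0] v0(1) by (simp add: q_def)
  moreover have "norm (A *v v) \<le> q * norm v" for v
  proof (cases "v = 0")
    case False
    then have "inverse (norm v) *\<^sub>R v \<in> sphere 0 1" by simp
    then have "norm (A *v (inverse (norm v) *\<^sub>R v)) \<le> q" unfolding q_def by (rule v0(2))
    moreover have "A *v (inverse (norm v) *\<^sub>R v) = inverse (norm v) *\<^sub>R (A *v v)"
      by (simp add: vec_eq_iff matrix_vector_mult_def scaleR_sum_right)
    ultimately show ?thesis using False by (simp add: field_simps)
  qed simp
  ultimately show thesis using that[of q] by (simp add: contraction_factor_def q_def)
qed

text \<open>For two-by-two matrices, $Z^+$ is conjugate to $Z^T$ by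
  $\bigl(\begin{smallmatrix}0&1\cr-1&0\end{smallmatrix}\bigr)$, and $Z^T$ to $Z^*$ by complex
  conjugation of vectors.\<close>

lemma norm_adjugate_mult:
  obtains w where "norm w = norm v" "norm (adjugate Z *v v) = norm (cadj Z *v w)"
proof
  define w :: "complex^2" where "w = vector [cnj (v$2), - cnj (v$1)]"
  show "norm w = norm v" by (rule norm_vec2_eq) (simp add: w_def)
  have "(cadj Z *v w)$1 = cnj ((adjugate Z *v v)$2)" "(cadj Z *v w)$2 = - cnj ((adjugate Z *v v)$1)"
    by (simp_all add: w_def matrix_vector_mult_def sum_2 cadj_def adjugate_def)
  then show "norm (adjugate Z *v v) = norm (cadj Z *v w)"
    by (intro norm_vec2_eq) simp
qed

lemma quadratic_form_eq:
  "Re (\<Sum>i\<in>UNIV. cnj (v$i) * ((Z ** cadj Z) *v v)$i) = (norm (cadj Z *v v))\<^sup>2"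
  "Re (\<Sum>i\<in>UNIV. cnj (v$i) * (mat (of_real c) *v v)$i) = c * (norm v)\<^sup>2"
proof -
  have "(\<Sum>i\<in>UNIV. cnj (v$i) * ((Z ** cadj Z) *v v)$i) = complex_of_real ((norm (cadj Z *v v))\<^sup>2)"
    unfolding norm_vec2_sq_inner by (simp add: matrix_vector_mult_def matrix_matrix_mult_def cadj_def sum_2 algebra_simps)
  then show "Re (\<Sum>i\<in>UNIV. cnj (v$i) * ((Z ** cadj Z) *v v)$i) = (norm (cadj Z *v v))\<^sup>2" by simp
  have "(\<Sum>i\<in>UNIV. cnj (v$i) * (mat (of_real c) *v v)$i) = complex_of_real c * complex_of_real ((norm v)\<^sup>2)"
    unfolding norm_vec2_sq_inner by (simp add: matrix_vector_mult_def mat_def sum_2 algebra_simps)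
  then show "Re (\<Sum>i\<in>UNIV. cnj (v$i) * (mat (of_real c) *v v)$i) = c * (norm v)\<^sup>2" 
    by (simp flip: of_real_mult)
qed

lemma quadratic_form_diff:
  "Re (\<Sum>i\<in>UNIV. cnj (v$i) * ((A - B) *v v)$i)
    = Re (\<Sum>i\<in>UNIV. cnj (v$i) * (A *v v)$i) - Re (\<Sum>i\<in>UNIV. cnj (v$i) * (B *v v)$i)" for A B :: HC
  by (simp add: matrix_vector_mult_def sum_2 algebra_simps)

lemma norm_adjugate_Dplus:
  assumes "Z \<in> Dplus R" "R > 0" "v \<noteq> 0"
  shows "norm (adjugate Z *v v) < R * norm v"
proof -
  obtain w where w: "norm w = norm v" "norm (adjugate Z *v v) = norm (cadj Z *v w)"
    by (rule norm_adjugate_mult)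
  with assms(3) have "w \<noteq> 0" by auto
  then have "(norm (cadj Z *v w))\<^sup>2 < R\<^sup>2 * (norm w)\<^sup>2"
    using assms(1) unfolding Dplus_def pos_def_def mem_Collect_eq quadratic_form_diff quadratic_form_eq by auto
  then have "(norm (cadj Z *v w))\<^sup>2 < (R * norm w)\<^sup>2" by (simp only: power_mult_distrib)
  then have "norm (cadj Z *v w) < R * norm w"
    by (rule power2_less_imp_less) (use assms(2) in simp)
  then show ?thesis by (simp add: w)
qed

lemma norm_adjugate_Dminus:
  assumes "Z \<in> Dminus R" "R > 0" "v \<noteq> 0"
  shows "R * norm v < norm (adjugate Z *v v)"
proof -
  obtain w where w: "norm w = norm v" "norm (adjugate Z *v v) = norm (cadj Z *v w)"
    by (rule norm_adjugate_mult)
  with assms(3) have "w \<noteq> 0" by auto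
  then have "R\<^sup>2 * (norm w)\<^sup>2 < (norm (cadj Z *v w))\<^sup>2"
    using assms(1) unfolding Dminus_def pos_def_def mem_Collect_eq quadratic_form_diff quadratic_form_eq by auto
  then have "(R * norm w)\<^sup>2 < (norm (cadj Z *v w))\<^sup>2" by (simp only: power_mult_distrib)
  then have "R * norm w < norm (cadj Z *v w)"
    by (rule power2_less_imp_less) simp
  then show ?thesis by (simp add: w)
qed

lemma adjugate_simps:
  "adjugate (A ** B) = adjugate B ** adjugate A" "adjugate (mat 1) = mat 1" "adjugate (c \<cdot>\<^sub>c A) = c \<cdot>\<^sub>c adjugate A"
  "adjugate (transpose A) = transpose (adjugate A)" "det (adjugate A) = det A" "adjugate (A - B) = adjugate A - adjugate B"
  by (simp_all add: HC_eq_iff adjugate_def matrix_matrix_mult_def sum_2 mat_def transpose_def det_2 algebra_simps)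

lemma cscale_mult_vec: "(c \<cdot>\<^sub>c A) *v v = c *s (A *v v)"
  by (simp add: vec_eq_iff matrix_vector_mult_def sum_2 algebra_simps)

lemma norm_scale_vec: "norm (c *s v) = cmod c * norm v" for v :: "complex^2"
proof -
  have "(norm (c *s v))\<^sup>2 = (cmod c * norm v)\<^sup>2"
    by (simp add: norm_vec2_sq power_mult_distrib norm_mult distrib_left)
  then show ?thesis by (rule power2_eq_imp_eq) auto
qed

lemma Dplus_contraction:
  assumes "Z \<in> Dplus R" "R > 0"
  obtains q where "q < 1" "contraction_factor q (adjugate (of_real (1 / R) \<cdot>\<^sub>c Z))"
proof (rule contraction_factor_exists)
  fix v :: "complex^2" assume "v \<noteq> 0"
  from norm_adjugate_Dplus[OF assms this] assms(2)
  show "norm (adjugate (of_real (1 / R) \<cdot>\<^sub>c Z) *v v) < norm v"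
    by (simp add: adjugate_simps cscale_mult_vec norm_scale_vec norm_divide field_simps)
qed (use that in blast)

lemma Dminus_contraction:
  assumes "Z \<in> Dminus R" "R > 0"
  shows "det Z \<noteq> 0"
    and "\<exists>q<1. contraction_factor q (adjugate (of_real R \<cdot>\<^sub>c matrix_inv Z))"
proof -
  have "v = 0" if "adjugate Z *v v = 0" for v
  proof (rule ccontr)
    assume "v \<noteq> 0"
    then have "R * norm v < 0" using norm_adjugate_Dminus[OF assms] that by fastforce
    then show False using assms(2) by (simp add: mult_less_0_iff)
  qed
  then have "\<exists>B. B ** adjugate Z = mat 1" by (simp add: matrix_left_invertible_ker)
  then show det: "det Z \<noteq> 0"
    by (metis adjugate_simps(5) det_I det_mul mult_zero_right zero_neq_one)
  have inv: "adjugate Z ** adjugate (matrix_inv Z) = mat 1"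
    by (metis adjugate_simps(1,2) matrix_inv_mult(2) det)
  have "norm (adjugate (of_real R \<cdot>\<^sub>c matrix_inv Z) *v v) < norm v" if "v \<noteq> 0" for v
  proof -
    define w where "w = adjugate (matrix_inv Z) *v v"
    have v: "adjugate Z *v w = v" by (simp add: w_def matrix_vector_mul_assoc inv)
    with that have "w \<noteq> 0" by auto
    from norm_adjugate_Dminus[OF assms this] show ?thesis
      using assms(2) unfolding v by (simp add: adjugate_simps cscale_mult_vec norm_scale_vec w_def[symmetric])
  qed
  then show "\<exists>q<1. contraction_factor q (adjugate (of_real R \<cdot>\<^sub>c matrix_inv Z))"
    using contraction_factor_exists by metis
qed

section \<open>Absolute convergence of the coefficients\<close>

text \<open>With $s$ a partial sum of the norms of $f$, the recurrence gives $s \le |f(0)| + |c| s + \sum |g|$,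
  a bound on $s$.\<close>

lemma summable_first_order_recurrence:
  fixes f g :: "nat \<Rightarrow> complex"
  assumes rec: "\<And>n. f (Suc n) = c * f n + g n" and c: "cmod c < 1" and g: "summable (\<lambda>n. cmod (g n))"
  shows "summable (\<lambda>n. cmod (f n))"
proof (rule summableI_nonneg_bounded)
  fix N
  define s where "s = (\<Sum>n<N. cmod (f n))"
  have "s \<le> (\<Sum>n<Suc N. cmod (f n))" by (simp add: s_def)
  also have "\<dots> = cmod (f 0) + (\<Sum>n<N. cmod (f (Suc n)))" by (rule sum.lessThan_Suc_shift)
  also have "\<dots> \<le> cmod (f 0) + (\<Sum>n<N. cmod c * cmod (f n) + cmod (g n))"
    unfolding rec by (intro add_left_mono sum_mono order_trans[OF norm_triangle_ineq]) (simp add: norm_mult)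
  also have "\<dots> = cmod (f 0) + cmod c * s + (\<Sum>n<N. cmod (g n))"
    by (simp add: s_def sum.distrib sum_distrib_left)
  also have "(\<Sum>n<N. cmod (g n)) \<le> (\<Sum>n. cmod (g n))"
    by (rule sum_le_suminf[OF g]) auto
  finally have "(1 - cmod c) * s \<le> cmod (f 0) + (\<Sum>n. cmod (g n))" by (simp add: algebra_simps)
  then show "(\<Sum>n<N. cmod (f n)) \<le> (cmod (f 0) + (\<Sum>n. cmod (g n))) / (1 - cmod c)"
    using c by (simp add: s_def pos_le_divide_eq mult.commute)
qed auto

text \<open>Since $D = (1 - \alpha\tau)(1 - \beta\tau)$, division by $D^2$ is a succession of four first-order
  recurrences.\<close>

lemma summable_lucas2:
  assumes "cmod \<alpha> < 1" "cmod \<beta> < 1"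
  shows "summable (\<lambda>n. cmod (lucas2 (\<alpha> + \<beta>) (\<alpha> * \<beta>) n))"
proof -
  let ?h = "lucas (\<alpha> + \<beta>) (\<alpha> * \<beta>)" and ?a = "lucas2 (\<alpha> + \<beta>) (\<alpha> * \<beta>)"
  have 1: "summable (\<lambda>n. cmod (?h (Suc n) - \<alpha> * ?h n))"
    by (rule summable_first_order_recurrence[where c = \<beta> and g = "\<lambda>_. 0"]) (use assms in \<open>simp_all add: algebra_simps\<close>)
  have 2: "summable (\<lambda>n. cmod (?h n))"
    by (rule summable_first_order_recurrence[OF _ assms(1) 1]) simp
  then have "summable (\<lambda>n. cmod (?h (Suc n)))" by (subst summable_Suc_iff)
  from summable_first_order_recurrence[OF _ assms(2) this]
  have 3: "summable (\<lambda>n. cmod (?a (Suc n) - \<alpha> * ?a n))"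
    by (simp add: algebra_simps)
  show ?thesis
    by (rule summable_first_order_recurrence[OF _ assms(1) 3]) simp
qed

lemma eigenvalue_bound:
  assumes "contraction_factor q N" "q < 1" "z * z = trace N * z - det N"
  shows "cmod z < 1"
proof -
  have "det (N - mat z) = z * z - trace N * z + det N"
    by (simp add: det_2 trace_def sum_2 mat_def algebra_simps)
  with assms(3) have "\<not> invertible (N - mat z)" by (simp add: invertible_det_nz)
  then have "\<not> (\<exists>B. B ** (N - mat z) = mat 1)"
    using matrix_left_right_inverse unfolding invertible_def by blast
  then obtain v where v: "v \<noteq> 0" "(N - mat z) *v v = 0" by (auto simp: matrix_left_invertible_ker)
  then have "N *v v = z *s v"
    by (simp add: vec_eq_iff forall_2 matrix_vector_mult_def sum_2 mat_def algebra_simps)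
  then have "cmod z * norm v \<le> q * norm v"
    using assms(1) by (metis contraction_factor_def norm_scale_vec)
  then show ?thesis using v(1) assms(2) by simp
qed

lemma quadratic_roots:
  fixes p d :: complex
  obtains \<alpha> \<beta> where "p = \<alpha> + \<beta>" "d = \<alpha> * \<beta>"
proof
  define s where "s = csqrt (p\<^sup>2 - 4 * d)"
  have s: "s * s = p\<^sup>2 - 4 * d" by (metis s_def power2_csqrt power2_eq_square)
  show "p = (p + s) / 2 + (p - s) / 2" by (simp add: field_simps)
  have "(p + s) / 2 * ((p - s) / 2) = (p\<^sup>2 - s * s) / 4" by (simp add: power2_eq_square algebra_simps)
  then show "d = (p + s) / 2 * ((p - s) / 2)" by (simp add: s)
qed

lemma summable_lucas2_contraction:
  assumes "contraction_factor q N" "q < 1"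
  shows "summable (\<lambda>n. cmod (lucas2 (trace N) (det N) n))"
proof -
  obtain \<alpha> \<beta> where ab: "trace N = \<alpha> + \<beta>" "det N = \<alpha> * \<beta>" by (rule quadratic_roots)
  have "cmod \<alpha> < 1" "cmod \<beta> < 1"
    by (rule eigenvalue_bound[OF assms], simp add: ab algebra_simps)+
  then show ?thesis unfolding ab by (rule summable_lucas2)
qed

section \<open>Neumann series\<close>

definition neumann :: "HC \<Rightarrow> HC" where
  "neumann M = (\<chi> i j. \<Sum>n. mpow M n $ i $ j)"

lemma neumann_inverse:
  assumes "contraction_factor q M" "q < 1"
  shows "(mat 1 - M) ** neumann M = mat 1" "neumann M ** (mat 1 - M) = mat 1"
proof -
  have "summable (\<lambda>n. mpow M n $ i $ j)" for i j
  proof (rule summable_comparison_test')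
    show "summable (\<lambda>n. q ^ n)" using assms by (simp add: contraction_factor_def summable_geometric)
  qed (rule contraction_factor_entry[OF assms(1)])
  then have s: "(\<lambda>n. mpow M n $ i $ j) sums neumann M $ i $ j" for i j
    by (simp add: neumann_def summable_sums)
  have "neumann M $ i $ j = (mat 1 + M ** neumann M) $ i $ j" for i j
  proof (rule sums_unique2[OF s])
    have "(\<lambda>n. (M ** mpow M n) $ i $ j) sums (M ** neumann M) $ i $ j"
      unfolding matrix_matrix_mult_def by simp (intro sums_sum sums_mult s)
    then have "(\<lambda>n. mpow M (Suc n) $ i $ j) sums (M ** neumann M) $ i $ j" by simp
    then have "(\<lambda>n. mpow M n $ i $ j) sums ((M ** neumann M) $ i $ j + mpow M 0 $ i $ j)"
      using sums_Suc_iff[of "\<lambda>n. mpow M n $ i $ j"] by blast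
    then show "(\<lambda>n. mpow M n $ i $ j) sums (mat 1 + M ** neumann M) $ i $ j"
      by (simp add: add.commute)
  qed
  then have "neumann M = mat 1 + M ** neumann M" by (simp add: vec_eq_iff)
  then show 1: "(mat 1 - M) ** neumann M = mat 1"
    unfolding matrix_sub_distrib by (simp add: algebra_simps)
  then show "neumann M ** (mat 1 - M) = mat 1" by (simp only: matrix_left_right_inverse)
qed

definition partial_neumann :: "nat \<Rightarrow> HC \<Rightarrow> HC" where
  "partial_neumann n M = (\<Sum>j<n. mpow M j)"

lemma neumann_uniform_limit:
  fixes M :: "angles \<Rightarrow> HC"
  assumes "\<And>u n i j. cmod (mpow (M u) n $ i $ j) \<le> q ^ n" "0 \<le> q" "q < 1"
  shows "uniform_limit UNIV (\<lambda>n u. partial_neumann n (M u) $ i $ j) (\<lambda>u. neumann (M u) $ i $ j) sequentially"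
    and "bounded (range (\<lambda>u. neumann (M u) $ i $ j))"
proof -
  have q: "summable (\<lambda>n. q ^ n)" using assms(2,3) by (simp add: summable_geometric)
  have "uniform_limit UNIV (\<lambda>n u. \<Sum>k<n. mpow (M u) k $ i $ j) (\<lambda>u. \<Sum>k. mpow (M u) k $ i $ j) sequentially"
    by (rule Weierstrass_m_test[OF _ q]) (rule assms(1))
  then show "uniform_limit UNIV (\<lambda>n u. partial_neumann n (M u) $ i $ j) (\<lambda>u. neumann (M u) $ i $ j) sequentially"
    by (simp add: partial_neumann_def neumann_def)
  have "cmod (neumann (M u) $ i $ j) \<le> (\<Sum>n. q ^ n)" for u
  proof -
    have n: "summable (\<lambda>n. cmod (mpow (M u) n $ i $ j))"
      by (rule summable_comparison_test'[OF q]) (simp add: assms(1))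
    have "cmod (neumann (M u) $ i $ j) \<le> (\<Sum>n. cmod (mpow (M u) n $ i $ j))"
      by (simp add: neumann_def summable_norm n)
    also have "\<dots> \<le> (\<Sum>n. q ^ n)" by (intro suminf_le assms n q)
    finally show ?thesis .
  qed
  then show "bounded (range (\<lambda>u. neumann (M u) $ i $ j))" unfolding bounded_iff by blast
qed

lemma continuous_on_mpow:
  assumes "\<And>i j. continuous_on S (\<lambda>u. M u $ i $ j)"
  shows "continuous_on S (\<lambda>u. mpow (M u) n $ i $ j)"
proof (induction n arbitrary: i j)
  case (Suc n)
  have "(\<lambda>u. mpow (M u) (Suc n) $ i $ j) = (\<lambda>u. \<Sum>k\<in>UNIV. M u $ i $ k * mpow (M u) n $ k $ j)"
    by (simp add: matrix_matrix_mult_def)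
  then show ?case by (simp only:) (intro continuous_on_sum continuous_on_mult assms Suc)
qed simp

text \<open>The products of the partial sums converge uniformly, and their means are the partial sums of the
  series because only the terms $j = k$ contribute.\<close>

lemma haar_mean_neumann:
  assumes V: "schur_orthogonal V" and q: "0 \<le> q" "q < 1"
    and M: "\<And>u n i j. cmod (mpow (V u ** adjugate X) n $ i $ j) \<le> q ^ n"
    and L: "\<And>u n i j. cmod (mpow (cadj (V u) ** adjugate Y) n $ i $ j) \<le> q ^ n"
  defines "F \<equiv> \<lambda>u. neumann (V u ** adjugate X) ** adjugate Y ** neumann (cadj (V u) ** adjugate Y)"
  shows "continuous_on UNIV (\<lambda>u. F u $ i $ l)"
    and "(\<lambda>k. mean_term k X Y $ i $ l) sums haar_mean (\<lambda>u. F u $ i $ l)"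
proof -
  define M L where "M = (\<lambda>u. V u ** adjugate X)" and "L = (\<lambda>u. cadj (V u) ** adjugate Y)"
  have M_L: "V u ** adjugate X = M u" "cadj (V u) ** adjugate Y = L u" for u
    by (simp_all add: M_def L_def)
  define G where "G n u = (partial_neumann n (M u) ** adjugate Y ** partial_neumann n (L u)) $ i $ l" for n u
  have "cmod (mpow (M u) n $ a $ b) \<le> q ^ n" "cmod (mpow (L u) n $ a $ b) \<le> q ^ n" for u n a b
    unfolding M_def L_def by (rule M, rule L)
  note Mlim = neumann_uniform_limit[OF this(1) q] and Llim = neumann_uniform_limit[OF this(2) q]
  have entry: "(P ** Z ** Q) $ i $ l = Z$1$1 * (P$i$1 * Q$1$l) + Z$1$2 * (P$i$1 * Q$2$l)
      + (Z$2$1 * (P$i$2 * Q$1$l) + Z$2$2 * (P$i$2 * Q$2$l))" for P Z Q :: HC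
    by (simp add: matrix_matrix_mult_def sum_2 algebra_simps)
  have lim: "uniform_limit UNIV G (\<lambda>u. F u $ i $ l) sequentially"
    unfolding G_def F_def M_L entry
    by (intro uniform_limit_add bounded_linear.uniform_limit[OF bounded_linear_mult_right] uniform_lim_mult Mlim Llim)
  have cont_V: "\<And>i j. continuous_on UNIV (\<lambda>u. V u $ i $ j)" using V by (simp add: schur_orthogonal_def)
  have "continuous_on UNIV (\<lambda>u. M u $ a $ b)" "continuous_on UNIV (\<lambda>u. L u $ a $ b)" for a b
    unfolding M_def L_def matrix_matrix_mult_def vec_lambda_beta
    by (intro continuous_on_sum continuous_on_mult continuous_on_const continuous_on_cadj cont_V)+
  then have cont_pow: "continuous_on UNIV (\<lambda>u. mpow (M u) n $ a $ b)" "continuous_on UNIV (\<lambda>u. mpow (L u) n $ a $ b)" for n a b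
    by (intro continuous_on_mpow; blast)+
  have cont_prod: "continuous_on UNIV (\<lambda>u. (mpow (M u) j ** adjugate Y ** mpow (L u) k) $ i $ l)" for j k
    unfolding entry by (intro continuous_on_add continuous_on_mult continuous_on_const cont_pow)
  have G: "G n u = (\<Sum>j<n. \<Sum>k<n. (mpow (M u) j ** adjugate Y ** mpow (L u) k) $ i $ l)" for n u
    unfolding G_def partial_neumann_def entry
    by (simp only: sum_component sum_product sum.distrib, simp only: sum_distrib_left)
  have cont_G: "continuous_on UNIV (G n)" for n
    unfolding G by (intro continuous_on_sum cont_prod)
  show cont_F: "continuous_on UNIV (\<lambda>u. F u $ i $ l)"
    by (rule uniform_limit_theorem[OF _ lim]) (auto simp: cont_G)
  have mean_G: "haar_mean (G n) = (\<Sum>k<n. mean_term k X Y $ i $ l)" for n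
  proof -
    have "haar_mean (G n) = (\<Sum>j<n. \<Sum>k<n. haar_mean (\<lambda>u. (mpow (M u) j ** adjugate Y ** mpow (L u) k) $ i $ l))"
      unfolding G by (simp add: haar_mean_sum cont_prod continuous_on_sum)
    also have "\<dots> = (\<Sum>j<n. \<Sum>k<n. if j = k then mean_term k X Y $ i $ l else 0)"
      unfolding M_def L_def haar_mean_power_product[OF V] ..
    finally show ?thesis by (simp add: sum.delta)
  qed
  have "uniform_limit u2_box (\<lambda>n u. haar_weight u * G n u) (\<lambda>u. haar_weight u * F u $ i $ l) sequentially"
  proof (rule uniform_lim_mult)
    show "uniform_limit u2_box (\<lambda>n. haar_weight) haar_weight sequentially" by (rule uniform_limit_const)
    show "uniform_limit u2_box G (\<lambda>u. F u $ i $ l) sequentially"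
      by (rule uniform_limit_on_subset[OF lim]) simp
    have "compact u2_box" by (simp add: u2_box_def)
    then show "bounded (haar_weight ` u2_box)" "bounded ((\<lambda>u. F u $ i $ l) ` u2_box)"
      using continuous_haar_weight continuous_on_subset[OF cont_F]
      by (auto intro!: compact_imp_bounded compact_continuous_image)
  qed
  then obtain I J where IJ: "\<And>n. ((\<lambda>u. haar_weight u * G n u) has_integral I n) u2_box"
    "((\<lambda>u. haar_weight u * F u $ i $ l) has_integral J) u2_box" "I \<longlonglongrightarrow> J"
    unfolding u2_box_def
    by (rule uniform_limit_integral_cbox)
      (auto intro!: continuous_on_mult continuous_haar_weight continuous_on_subset[OF cont_G])
  have "I n = (\<Sum>k<n. mean_term k X Y $ i $ l)" for n
    using mean_G[of n] integral_unique[OF IJ(1)[of n]] by (simp add: haar_mean_def)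
  moreover have "J = haar_mean (\<lambda>u. F u $ i $ l)"
    using integral_unique[OF IJ(2)] by (simp add: haar_mean_def)
  ultimately have "(\<lambda>n. \<Sum>k<n. mean_term k X Y $ i $ l) \<longlonglongrightarrow> haar_mean (\<lambda>u. F u $ i $ l)"
    using IJ(3) by (metis (no_types, lifting) ext)
  then show "(\<lambda>k. mean_term k X Y $ i $ l) sums haar_mean (\<lambda>u. F u $ i $ l)"
    by (simp add: sums_def)
qed

section \<open>The kernel as a resolvent\<close>

lemma haar_unitary_unitary:
  "cadj (haar_unitary u) ** haar_unitary u = mat 1" "haar_unitary u ** cadj (haar_unitary u) = mat 1"
proof -
  obtain t p x y where u: "u = (t, p, x, y)" by (metis prod_cases4)
  have "complex_of_real (cos p) * of_real (cos p) + of_real (sin p) * of_real (sin p) = 1"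
    using sin_cos_squared_add3[of p] by (metis of_real_1 of_real_add of_real_mult)
  then show 1: "cadj (haar_unitary u) ** haar_unitary u = mat 1"
    by (simp add: u haar_unitary_def HC_eq_iff matrix_matrix_mult_def sum_2 mat_def cadj_def cis_cnj cis_mult
        cis_mult_cancel mult_ac add.commute)
  then show "haar_unitary u ** cadj (haar_unitary u) = mat 1"
    by (simp only: matrix_left_right_inverse)
qed

lemma adjugate_u2_param: "adjugate (u2_param R u) = of_real R \<cdot>\<^sub>c cadj (haar_unitary u)"
proof -
  obtain t p x y where u: "u = (t, p, x, y)" by (metis prod_cases4)
  show ?thesis
    unfolding u u2_param_eq by (simp add: haar_unitary_def HC_eq_iff adjugate_def cadj_def cis_cnj mult_ac)
qed

text \<open>By $X X^+ = N(X)$, this is the inverse of $(W - Z)^+$.\<close>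

definition cauchy_kernel :: "HC \<Rightarrow> HC \<Rightarrow> HC" where
  "cauchy_kernel W Z = (1 / det (W - Z)) \<cdot>\<^sub>c (W - Z)"

lemma cauchy_kernel_inverse:
  assumes "det (W - Z) \<noteq> 0"
  shows "cauchy_kernel W Z ** adjugate (W - Z) = mat 1" "adjugate (W - Z) ** cauchy_kernel W Z = mat 1"
  using assms by (simp_all add: cauchy_kernel_def cscale_simps adjugate_det HC_eq_iff mat_def)

text \<open>With $A = Z_1^+/R$ and $B = R Y^+$, where $Y = Z_2^{-1}$, one has $(W - Z_1)^+ = W^+(1 - VA)$ and
  $(W - Z_2)^+ = -(1 - V^*B) Z_2^+$.\<close>

lemma cauchy_kernel_neumann:
  assumes R: "R > 0" and W: "adjugate W = of_real R \<cdot>\<^sub>c cadj V" and V: "cadj V ** V = mat 1"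
    and q: "contraction_factor q (V ** adjugate (of_real (1 / R) \<cdot>\<^sub>c Z1))" "q < 1"
    and r: "contraction_factor r (cadj V ** adjugate (of_real R \<cdot>\<^sub>c Y))" "r < 1" and Y: "Z2 ** Y = mat 1"
  shows "cauchy_kernel W Z1 ** adjugate W ** cauchy_kernel W Z2
    = (- 1 / of_real R) \<cdot>\<^sub>c (neumann (V ** adjugate (of_real (1 / R) \<cdot>\<^sub>c Z1)) ** adjugate (of_real R \<cdot>\<^sub>c Y)
        ** neumann (cadj V ** adjugate (of_real R \<cdot>\<^sub>c Y)))"
proof -
  define A B where "A = adjugate (of_real (1 / R) \<cdot>\<^sub>c Z1)" and "B = adjugate (of_real R \<cdot>\<^sub>c Y)"
  define S T where "S = neumann (V ** A)" and "T = neumann (cadj V ** B)"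
  have S: "(mat 1 - V ** A) ** S = mat 1" and T: "T ** (mat 1 - cadj V ** B) = mat 1"
    unfolding S_def T_def A_def B_def by (rule neumann_inverse[OF q], rule neumann_inverse[OF r])
  have nz: "det (mat 1 - V ** A) \<noteq> 0" "det (mat 1 - cadj V ** B) \<noteq> 0"
    using S T by (metis det_I det_mul mult_zero_left mult_zero_right zero_neq_one)+
  \<comment> \<open>The factorization $(W - Z_1)^+ = W^+(1 - VA)$ shows that $W - Z_1$ is invertible and identifies the
    first kernel.\<close>
  have "cadj V ** (V ** A) = A" by (simp add: matrix_mul_assoc V)
  then have 1: "adjugate (W - Z1) = adjugate W ** (mat 1 - V ** A)"
    using R by (simp add: adjugate_simps W matrix_sub_distrib cscale_simps A_def) (simp add: HC_eq_iff)
  have "det (cadj V) \<noteq> 0" using V by (metis det_I det_mul mult_zero_left zero_neq_one)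
  then have "det (adjugate W) \<noteq> 0" unfolding W using R by (simp add: det_2)
  then have "det (W - Z1) \<noteq> 0" using nz(1) 1 by (metis adjugate_simps(5) det_mul mult_eq_0_iff)
  from cauchy_kernel_inverse(1)[OF this] have "cauchy_kernel W Z1 ** adjugate W ** (mat 1 - V ** A) = mat 1"
    by (simp only: 1 matrix_mul_assoc)
  then have K1: "cauchy_kernel W Z1 ** adjugate W = S"
    using S by (metis matrix_mul_assoc matrix_mul_lid matrix_mul_rid)
  \<comment> \<open>The factorization $(W - Z_2)^+ = -(1 - V^*B) Z_2^+$ does the same for the second kernel.\<close>
  have "adjugate Y ** adjugate Z2 = mat 1" by (metis Y adjugate_simps(1,2))
  then have B: "B ** adjugate Z2 = of_real R \<cdot>\<^sub>c mat 1" by (simp add: B_def adjugate_simps cscale_simps)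
  have 2: "(mat 1 - cadj V ** B) ** adjugate Z2 = - 1 \<cdot>\<^sub>c adjugate (W - Z2)"
    unfolding matrix_sub_distrib matrix_mul_assoc[symmetric] B by (simp add: adjugate_simps W cscale_simps) (simp add: HC_eq_iff)
  have "det (adjugate Z2) \<noteq> 0" using Y by (metis adjugate_simps(5) det_I det_mul mult_zero_left zero_neq_one)
  then have "det (- 1 \<cdot>\<^sub>c adjugate (W - Z2)) \<noteq> 0" using nz(2) by (simp add: det_mul flip: 2)
  moreover have "det (- 1 \<cdot>\<^sub>c M) = det M" for M by (simp add: det_2)
  ultimately have "det (W - Z2) \<noteq> 0" by (simp only: adjugate_simps(5)) simp
  then have "(mat 1 - cadj V ** B) ** adjugate Z2 ** cauchy_kernel W Z2 = - 1 \<cdot>\<^sub>c mat 1"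
    unfolding 2 by (simp add: cscale_simps cauchy_kernel_inverse(2))
  then have "T ** (mat 1 - cadj V ** B) ** (adjugate Z2 ** cauchy_kernel W Z2) = - 1 \<cdot>\<^sub>c T"
    by (simp add: cscale_simps flip: matrix_mul_assoc)
  then have "adjugate Z2 ** cauchy_kernel W Z2 = - 1 \<cdot>\<^sub>c T" by (simp add: T)
  then have "B ** adjugate Z2 ** cauchy_kernel W Z2 = - 1 \<cdot>\<^sub>c (B ** T)"
    by (simp add: cscale_simps flip: matrix_mul_assoc)
  then have "of_real R \<cdot>\<^sub>c cauchy_kernel W Z2 = - 1 \<cdot>\<^sub>c (B ** T)" by (simp add: B cscale_simps)
  then have K2: "cauchy_kernel W Z2 = (- 1 / of_real R) \<cdot>\<^sub>c (B ** T)"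
    using R by (simp add: HC_eq_iff field_simps)
  show ?thesis
    unfolding K1 K2 cscale_simps matrix_mul_assoc S_def T_def A_def B_def ..
qed

text \<open>The density of the chart and $N(W)^{-2}$ combine to \<open>haar_weight\<close>; the integral of a
  matrix-valued function is taken entrywise.\<close>

lemma J'_entry:
  assumes R: "R > 0"
    and F: "\<And>u. cauchy_kernel (u2_param R u) Z1 ** adjugate (u2_param R u) ** cauchy_kernel (u2_param R u) Z2 = c \<cdot>\<^sub>c F u"
    and cont: "\<And>i l. continuous_on UNIV (\<lambda>u. F u $ i $ l)"
  shows "J' R (\<lambda>W. inverse ((det W)\<^sup>2) \<cdot>\<^sub>c adjugate W) Z1 Z2 $ i $ l = c * haar_mean (\<lambda>u. F u $ i $ l)"
proof -
  define g where "g u = (\<chi> i l. (of_real (2 * pi ^ 3) * (- \<i>) * c) * (haar_weight u * F u $ i $ l))" for u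
  have "u2_jac R u \<cdot>\<^sub>c ((1 / det (u2_param R u - Z1)) \<cdot>\<^sub>c (u2_param R u - Z1) **
      (inverse ((det (u2_param R u))\<^sup>2) \<cdot>\<^sub>c adjugate (u2_param R u)) **
      ((1 / det (u2_param R u - Z2)) \<cdot>\<^sub>c (u2_param R u - Z2))) = g u" for u
  proof -
    obtain t p a b where u: "u = (t, p, a, b)" by (metis prod_cases4)
    have "(cis (2 * t))\<^sup>2 = cis (4 * t)" by (simp add: Complex.DeMoivre)
    define e where "e = of_real R ^ 4 * cis (4 * t)"
    have "(of_real R ^ 2 * cis (2 * t))\<^sup>2 = e"
      unfolding e_def \<open>(cis (2 * t))\<^sup>2 = cis (4 * t)\<close>[symmetric] by (simp add: power_mult_distrib flip: power_mult)
    moreover have "u2_jac R u = - \<i> * e * of_real (cos p * sin p)"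
      unfolding u u2_jac_eq e_def by (simp only: mult.assoc)
    moreover have "e \<noteq> 0" using R by (simp add: e_def)
    ultimately have "u2_jac R u * inverse ((det (u2_param R u))\<^sup>2) = of_real (2 * pi ^ 3) * (- \<i>) * haar_weight u"
      unfolding u det_u2_param haar_weight_def by simp
    then have "(u2_jac R u * inverse ((det (u2_param R u))\<^sup>2)) \<cdot>\<^sub>c (cauchy_kernel (u2_param R u) Z1 **
       adjugate (u2_param R u) ** cauchy_kernel (u2_param R u) Z2) = g u"
      unfolding F by (simp add: g_def HC_eq_iff)
    then show ?thesis by (simp add: cauchy_kernel_def cscale_simps mult_ac del: u2_jac.simps u2_param.simps)
  qed
  then have J: "J' R (\<lambda>W. inverse ((det W)\<^sup>2) \<cdot>\<^sub>c adjugate W) Z1 Z2 = (\<i> / of_real (2 * pi ^ 3)) \<cdot>\<^sub>c integral u2_box g"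
    unfolding J'_def u2_integral_def by simp
  have "g integrable_on u2_box"
    unfolding g_def u2_box_def
    by (intro integrable_continuous continuous_on_vec_lambda continuous_on_mult continuous_on_const
        continuous_haar_weight continuous_on_subset[OF cont]) auto
  from integral_linear[OF this bounded_linear_compose[OF bounded_linear_vec_nth[of l] bounded_linear_vec_nth[of i]]]
  have "integral u2_box g $ i $ l = integral u2_box (\<lambda>u. g u $ i $ l)" by (simp add: o_def)
  also have "\<dots> = of_real (2 * pi ^ 3) * (- \<i>) * c * haar_mean (\<lambda>u. F u $ i $ l)"
    by (simp add: g_def haar_mean_def)
  finally show ?thesis by (simp add: J)
qed

text \<open>The terms have degree $k$ in $X$ and $k + 1$ in $Y$, so the rescaling by $R$ leaves one factor.\<close>

lemma mean_term_scale:
  assumes "s * t = 1"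
  shows "mean_term k (s \<cdot>\<^sub>c X) (t \<cdot>\<^sub>c Y) = t \<cdot>\<^sub>c mean_term k X Y"
proof -
  have pd: "trace ((s \<cdot>\<^sub>c X) ** (t \<cdot>\<^sub>c Y)) = trace (X ** Y)" "det (s \<cdot>\<^sub>c X) * det (t \<cdot>\<^sub>c Y) = det X * det Y"
    "det (t \<cdot>\<^sub>c Y) = t * t * det Y" "det (s \<cdot>\<^sub>c X) = s * s * det X"
  proof -
    have "trace ((s \<cdot>\<^sub>c X) ** (t \<cdot>\<^sub>c Y)) = (s * t) * trace (X ** Y)" by (simp add: cscale_simps mult_ac)
    then show "trace ((s \<cdot>\<^sub>c X) ** (t \<cdot>\<^sub>c Y)) = trace (X ** Y)" by (simp add: assms)
    show 1: "det (t \<cdot>\<^sub>c Y) = t * t * det Y" "det (s \<cdot>\<^sub>c X) = s * s * det X" by (simp_all add: det_2 algebra_simps)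
    have "det (s \<cdot>\<^sub>c X) * det (t \<cdot>\<^sub>c Y) = (s * t) * (s * t) * (det X * det Y)" unfolding 1 by (simp only: mult_ac)
    then show "det (s \<cdot>\<^sub>c X) * det (t \<cdot>\<^sub>c Y) = det X * det Y" by (simp add: assms)
  qed
  have x: "(b * (t * t * det Y)) \<cdot>\<^sub>c s \<cdot>\<^sub>c X = t \<cdot>\<^sub>c (b * det Y) \<cdot>\<^sub>c X"
    and d: "(b * (s * s * det X) * (t * t * det Y)) \<cdot>\<^sub>c t \<cdot>\<^sub>c adjugate Y = t \<cdot>\<^sub>c (b * det X * det Y) \<cdot>\<^sub>c adjugate Y"
    and y: "b \<cdot>\<^sub>c t \<cdot>\<^sub>c adjugate Y = t \<cdot>\<^sub>c b \<cdot>\<^sub>c adjugate Y" for b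
  proof -
    have "b * (t * t * det Y) * s = (s * t) * (t * (b * det Y))"
      "b * (s * s * det X) * (t * t * det Y) * t = (s * t) * (s * t) * (t * (b * det X * det Y))"
      by (simp_all only: mult_ac)
    then show "(b * (t * t * det Y)) \<cdot>\<^sub>c s \<cdot>\<^sub>c X = t \<cdot>\<^sub>c (b * det Y) \<cdot>\<^sub>c X"
      "(b * (s * s * det X) * (t * t * det Y)) \<cdot>\<^sub>c t \<cdot>\<^sub>c adjugate Y = t \<cdot>\<^sub>c (b * det X * det Y) \<cdot>\<^sub>c adjugate Y"
      "b \<cdot>\<^sub>c t \<cdot>\<^sub>c adjugate Y = t \<cdot>\<^sub>c b \<cdot>\<^sub>c adjugate Y"
      unfolding cscale_simps(4) by (simp_all only: assms mult_1 mult.commute)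
  qed
  have diff: "t \<cdot>\<^sub>c (A - B) = t \<cdot>\<^sub>c A - t \<cdot>\<^sub>c B" for A B
    by (simp add: HC_eq_iff algebra_simps)
  have "char_grad_left k (s \<cdot>\<^sub>c X) (t \<cdot>\<^sub>c Y) = t \<cdot>\<^sub>c char_grad_left k X Y" for k
    unfolding char_grad_left_def pd(1,2) unfolding pd(3) adjugate_simps(3) x y diff ..
  moreover have "char_grad_right k (s \<cdot>\<^sub>c X) (t \<cdot>\<^sub>c Y) = t \<cdot>\<^sub>c char_grad_right k X Y"
    unfolding char_grad_right_def pd(1,2) unfolding pd(3,4) adjugate_simps(3) x d diff ..
  ultimately show ?thesis
    by (simp add: mean_term_def pd(2) HC_eq_iff distrib_left mult.left_commute)
qed

lemma mean_term_transpose: "mean_term k (transpose X) (transpose Y) = transpose (mean_term k X Y)"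
proof -
  have pd: "trace (transpose X ** transpose Y) = trace (X ** Y)"
    by (simp add: trace_def matrix_matrix_mult_def sum_2 transpose_def algebra_simps)
  have "char_grad_left k (transpose X) (transpose Y) = transpose (char_grad_left k X Y)"
    "char_grad_right k (transpose X) (transpose Y) = transpose (char_grad_right k X Y)" for k
    unfolding char_grad_left_def char_grad_right_def pd det_transpose adjugate_simps
    by (simp_all add: HC_eq_iff transpose_def)
  then show ?thesis
    by (simp only: mean_term_def det_transpose) (simp add: HC_eq_iff transpose_def)
qed

lemma cadj_cadj: "cadj (cadj V) = V"
  by (simp add: cadj_def vec_eq_iff)

text \<open>The common part of both halves of the theorem: \<open>V\<close> will be \<open>haar_unitary\<close> and its transpose.\<close>

lemma kernel_mean_sums:
  assumes R: "R > 0" and V: "schur_orthogonal V" "\<And>u. cadj (V u) ** V u = mat 1"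
    and q: "contraction_factor q (adjugate (of_real (1 / R) \<cdot>\<^sub>c Z1))" "q < 1"
    and r: "contraction_factor r (adjugate (of_real R \<cdot>\<^sub>c Y))" "r < 1" and Y: "Z2 ** Y = mat 1"
  obtains F where "\<And>i l. continuous_on UNIV (\<lambda>u. F u $ i $ l)"
    and "\<And>u W. adjugate W = of_real R \<cdot>\<^sub>c cadj (V u) \<Longrightarrow>
      cauchy_kernel W Z1 ** adjugate W ** cauchy_kernel W Z2 = (- 1 / of_real R) \<cdot>\<^sub>c F u"
    and "\<And>i l. (\<lambda>k. mean_term k Z1 Y $ i $ l) sums (1 / of_real R * haar_mean (\<lambda>u. F u $ i $ l))"
proof -
  define X' Y' where "X' = of_real (1 / R) \<cdot>\<^sub>c Z1" and "Y' = of_real R \<cdot>\<^sub>c Y"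
  define s where "s = max q r"
  have s: "0 \<le> s" "s < 1" using q r by (auto simp: s_def contraction_factor_def)
  have mono: "contraction_factor s A" if "contraction_factor c A" "c \<le> s" for c A
    using that s(1) unfolding contraction_factor_def
    by (metis mult_right_mono norm_ge_zero order_trans)
  have VV: "V u ** cadj (V u) = mat 1" for u using V(2)[of u] by (simp only: matrix_left_right_inverse)
  have M: "contraction_factor s (V u ** adjugate X')" for u
    using contraction_factor_mult[OF contraction_factor_unitary[OF V(2)] mono[OF q(1)]]
    by (simp add: s_def X'_def)
  have L: "contraction_factor s (cadj (V u) ** adjugate Y')" for u
    using contraction_factor_mult[OF contraction_factor_unitary mono[OF r(1)], of "cadj (V u)"] VV[of u]
    by (simp add: s_def Y'_def cadj_cadj)
  define F where "F = (\<lambda>u. neumann (V u ** adjugate X') ** adjugate Y' ** neumann (cadj (V u) ** adjugate Y'))"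
  then have F: "neumann (V u ** adjugate X') ** adjugate Y' ** neumann (cadj (V u) ** adjugate Y') = F u" for u
    by simp
  note mean = haar_mean_neumann[OF V(1) s contraction_factor_entry[OF M] contraction_factor_entry[OF L], unfolded F]
  show thesis
  proof
    show "continuous_on UNIV (\<lambda>u. F u $ i $ l)" for i l by (rule mean(1))
    show "cauchy_kernel W Z1 ** adjugate W ** cauchy_kernel W Z2 = (- 1 / of_real R) \<cdot>\<^sub>c F u"
      if "adjugate W = of_real R \<cdot>\<^sub>c cadj (V u)" for u W
      unfolding F_def X'_def Y'_def
      by (rule cauchy_kernel_neumann[OF R that V(2) _ s(2) _ s(2) Y]) (use M L in \<open>simp_all add: X'_def Y'_def\<close>)
    have "mean_term k Z1 Y $ i $ l = 1 / of_real R * (mean_term k X' Y' $ i $ l)" for k i l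
      using mean_term_scale[of "of_real (1 / R)" "of_real R" k Z1 Y] R by (simp add: X'_def Y'_def)
    then show "(\<lambda>k. mean_term k Z1 Y $ i $ l) sums (1 / of_real R * haar_mean (\<lambda>u. F u $ i $ l))" for i l
      by (simp only:) (intro sums_mult mean(2))
  qed
qed

lemma J'_plus_minus_sums:
  assumes R: "R > 0" and Z: "Z1 \<in> Dplus R" "Z2 \<in> Dminus R"
  shows "(\<lambda>k. mean_term k Z1 (matrix_inv Z2) $ i $ l) sums
    (- J' R (\<lambda>W. inverse ((det W)\<^sup>2) \<cdot>\<^sub>c adjugate W) Z1 Z2 $ i $ l)"
proof -
  obtain q where q: "q < 1" "contraction_factor q (adjugate (of_real (1 / R) \<cdot>\<^sub>c Z1))"
    using Dplus_contraction[OF Z(1) R] by blast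
  obtain r where r: "r < 1" "contraction_factor r (adjugate (of_real R \<cdot>\<^sub>c matrix_inv Z2))"
    using Dminus_contraction[OF Z(2) R] by blast
  obtain F where F: "\<And>i l. continuous_on UNIV (\<lambda>u. F u $ i $ l)"
    "\<And>u W. adjugate W = of_real R \<cdot>\<^sub>c cadj (haar_unitary u) \<Longrightarrow>
      cauchy_kernel W Z1 ** adjugate W ** cauchy_kernel W Z2 = (- 1 / of_real R) \<cdot>\<^sub>c F u"
    "\<And>i l. (\<lambda>k. mean_term k Z1 (matrix_inv Z2) $ i $ l) sums (1 / of_real R * haar_mean (\<lambda>u. F u $ i $ l))"
    using kernel_mean_sums[OF R schur_orthogonal_haar_unitary haar_unitary_unitary(1) q(2,1) r(2,1)
        matrix_inv_mult(1)[OF Dminus_contraction(1)[OF Z(2) R]]] by blast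
  show ?thesis
    using F(3)[of i l] J'_entry[OF R F(2)[OF adjugate_u2_param] F(1), of i l] by simp
qed

text \<open>Transposition exchanges the two kernels and brings the integrand to the form treated before, with
  the transpose of $V$. The terms are compatible with transposition, so the same series results.\<close>

lemma J'_minus_plus_sums:
  assumes R: "R > 0" and Z: "Z1 \<in> Dminus R" "Z2 \<in> Dplus R"
  shows "(\<lambda>k. mean_term k Z2 (matrix_inv Z1) $ i $ l) sums
    (- J' R (\<lambda>W. inverse ((det W)\<^sup>2) \<cdot>\<^sub>c adjugate W) Z1 Z2 $ i $ l)"
proof -
  have tr: "transpose (A ** B) = transpose B ** transpose A" "transpose (c \<cdot>\<^sub>c A) = c \<cdot>\<^sub>c transpose A"
    "transpose (cadj A) = cadj (transpose A)" "transpose (mat 1) = (mat 1 :: HC)" for A B c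
    by (rule matrix_transpose_mul, simp_all add: HC_eq_iff transpose_def cadj_def mat_def)
  have tr_kernel: "transpose (cauchy_kernel W Z) = cauchy_kernel (transpose W) (transpose Z)" for W Z
    by (simp add: cauchy_kernel_def HC_eq_iff transpose_def det_2 mult.commute)
  obtain q where q: "q < 1" "contraction_factor q (adjugate (of_real (1 / R) \<cdot>\<^sub>c transpose Z2))"
    using Dplus_contraction[OF Z(2) R] contraction_factor_transpose by (metis adjugate_simps(4) tr(2))
  obtain r where r: "r < 1" "contraction_factor r (adjugate (of_real R \<cdot>\<^sub>c transpose (matrix_inv Z1)))"
    using Dminus_contraction[OF Z(1) R] contraction_factor_transpose by (metis adjugate_simps(4) tr(2))
  have unitary: "cadj (transpose (haar_unitary u)) ** transpose (haar_unitary u) = mat 1" for u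
    by (metis haar_unitary_unitary(2) tr(1,3,4))
  have inv: "transpose Z1 ** transpose (matrix_inv Z1) = mat 1"
    by (metis matrix_inv_mult(2)[OF Dminus_contraction(1)[OF Z(1) R]] tr(1,4))
  obtain F where F: "\<And>i l. continuous_on UNIV (\<lambda>u. F u $ i $ l)"
    "\<And>u W. adjugate W = of_real R \<cdot>\<^sub>c cadj (transpose (haar_unitary u)) \<Longrightarrow>
      cauchy_kernel W (transpose Z2) ** adjugate W ** cauchy_kernel W (transpose Z1) = (- 1 / of_real R) \<cdot>\<^sub>c F u"
    "\<And>i l. (\<lambda>k. mean_term k (transpose Z2) (transpose (matrix_inv Z1)) $ i $ l) sums (1 / of_real R * haar_mean (\<lambda>u. F u $ i $ l))"
    using kernel_mean_sums[OF R schur_orthogonal_transpose[OF schur_orthogonal_haar_unitary] unitary q(2,1) r(2,1) inv] by blast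
  have "cauchy_kernel (u2_param R u) Z1 ** adjugate (u2_param R u) ** cauchy_kernel (u2_param R u) Z2
      = (- 1 / of_real R) \<cdot>\<^sub>c transpose (F u)" for u
  proof -
    have "adjugate (transpose (u2_param R u)) = of_real R \<cdot>\<^sub>c cadj (transpose (haar_unitary u))"
      by (simp only: adjugate_simps adjugate_u2_param tr)
    from F(2)[OF this] have "transpose (cauchy_kernel (u2_param R u) Z1 ** adjugate (u2_param R u) ** cauchy_kernel (u2_param R u) Z2)
      = (- 1 / of_real R) \<cdot>\<^sub>c F u"
      by (simp only: tr tr_kernel adjugate_simps matrix_mul_assoc)
    then show ?thesis by (metis tr(2) transpose_transpose)
  qed
  from J'_entry[OF R this, of i l] have "J' R (\<lambda>W. inverse ((det W)\<^sup>2) \<cdot>\<^sub>c adjugate W) Z1 Z2 $ i $ l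
     = - 1 / of_real R * haar_mean (\<lambda>u. F u $ l $ i)"
    using F(1) by (simp add: transpose_def)
  moreover have "mean_term k (transpose Z2) (transpose (matrix_inv Z1)) $ l $ i = mean_term k Z2 (matrix_inv Z1) $ i $ l" for k
    by (simp add: mean_term_transpose) (simp add: transpose_def)
  ultimately show ?thesis using F(3)[of l i] by simp
qed

section \<open>The three series\<close>

lemma sums_HC: "(\<And>i j. (\<lambda>k. f k $ i $ j) sums (S $ i $ j)) \<Longrightarrow> f sums S" for f :: "nat \<Rightarrow> HC"
  unfolding sums_def by (intro vec_tendstoI) (simp add: sum_component)

lemma summable_lucas2_Dplus_Dminus:
  assumes "R > 0" "Z1 \<in> Dplus R" "Z2 \<in> Dminus R"
  shows "summable (\<lambda>n. cmod (lucas2 (trace (Z1 ** matrix_inv Z2)) (det Z1 * det (matrix_inv Z2)) n))"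
proof -
  let ?A = "adjugate (of_real (1 / R) \<cdot>\<^sub>c Z1)" and ?B = "adjugate (of_real R \<cdot>\<^sub>c matrix_inv Z2)"
  obtain q where q: "q < 1" "contraction_factor q ?A" using Dplus_contraction[OF assms(2,1)] by blast
  obtain r where r: "r < 1" "contraction_factor r ?B" using Dminus_contraction[OF assms(3,1)] by blast
  have "q * r < 1" using q r unfolding contraction_factor_def
    by (metis less_eq_real_def mult_le_one mult_less_cancel_right2 mult_strict_mono' mult_1 less_le_trans not_less)
  with summable_lucas2_contraction[OF contraction_factor_mult[OF q(2) r(2)]]
  have "summable (\<lambda>n. cmod (lucas2 (trace (?A ** ?B)) (det (?A ** ?B)) n))" .
  moreover have AB: "?A ** ?B = adjugate (matrix_inv Z2 ** Z1)"
    using assms(1) by (simp add: adjugate_simps cscale_simps) (simp add: HC_eq_iff)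
  have "trace (adjugate Z) = trace Z" for Z by (simp add: trace_def adjugate_def sum_2 add.commute)
  then have "trace (?A ** ?B) = trace (Z1 ** matrix_inv Z2)" unfolding AB by (metis trace_mul_sym)
  moreover have "det (?A ** ?B) = det Z1 * det (matrix_inv Z2)"
    unfolding AB adjugate_simps(5) det_mul by (rule mult.commute)
  ultimately show ?thesis by simp
qed

lemma char_grad_summable:
  assumes "summable (\<lambda>n. cmod (lucas2 (trace (X ** Y)) (det X * det Y) n))"
  shows "summable (\<lambda>k. cmod (char_grad_left k X Y $ i $ j))" "summable (\<lambda>k. cmod (char_grad_right k X Y $ i $ j))"
proof -
  let ?a = "lucas2 (trace (X ** Y)) (det X * det Y)"
  have diff: "summable (\<lambda>k. cmod (?a (k + m) * c - ?a (k + n) * c'))" for m n c c'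
  proof (rule summable_comparison_test')
    show "summable (\<lambda>k. cmod (?a (k + m)) * cmod c + cmod (?a (k + n)) * cmod c')"
      using assms by (intro summable_add summable_mult2 summable_ignore_initial_segment)
    show "norm (cmod (?a (k + m) * c - ?a (k + n) * c')) \<le> cmod (?a (k + m)) * cmod c + cmod (?a (k + n)) * cmod c'" for k
      using norm_triangle_ineq4[of "?a (k + m) * c" "?a (k + n) * c'"] by (simp add: norm_mult)
  qed
  show "summable (\<lambda>k. cmod (char_grad_left k X Y $ i $ j))"
    using diff[of 2 "adjugate Y $ i $ j" 1 "det Y * X $ i $ j"]
    by (simp add: char_grad_left_def mult.assoc del: lucas2.simps add_2_eq_Suc')
  show "summable (\<lambda>k. cmod (char_grad_right k X Y $ i $ j))"
    using diff[of 1 "det Y * X $ i $ j" 0 "det X * (det Y * adjugate Y $ i $ j)"]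
    by (simp add: char_grad_right_def mult.assoc del: lucas2.simps)
qed

lemma scaleR_cscale: "c *\<^sub>R A = of_real c \<cdot>\<^sub>c A"
  unfolding HC_eq_iff vector_scaleR_component cscale_nth by (simp add: scaleR_conv_of_real)

text \<open>The coefficients in front of the gradients are at most one, so each of the three series converges
  absolutely and the convergent series of their sums may be split.\<close>

lemma three_series_of_mean_terms:
  assumes "summable (\<lambda>n. cmod (lucas2 (trace (X ** Y)) (det X * det Y) n))"
    and "\<And>i l. (\<lambda>k. mean_term k X Y $ i $ l) sums (- J $ i $ l)"
  obtains S1 S2 S3 where "(\<lambda>k. (1 / (real k + 1)\<^sup>2) *\<^sub>R char_grad_left k X Y) sums S1"
    "(\<lambda>k. (1 / ((real k + 1)\<^sup>2 * (real k + 2)\<^sup>2)) *\<^sub>R char_grad_right (Suc k) X Y) sums S2"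
    "(\<lambda>k. (1 / (real k + 2)\<^sup>2) *\<^sub>R ((det X * det Y) \<cdot>\<^sub>c char_grad_left k X Y)) sums S3"
    "J = - S1 - S2 - S3"
proof -
  define t1 where "t1 k = (1 / (real k + 1)\<^sup>2) *\<^sub>R char_grad_left k X Y" for k
  define t2 where "t2 k = (1 / ((real k)\<^sup>2 * (real k + 1)\<^sup>2)) *\<^sub>R char_grad_right k X Y" for k
  define t3 where "t3 k = (if k < 2 then 0 else (1 / (real k)\<^sup>2) *\<^sub>R ((det X * det Y) \<cdot>\<^sub>c char_grad_left (k - 2) X Y))" for k
  have scaled: "\<exists>S. (\<lambda>k. c k *\<^sub>R f k) sums S" if "\<And>i j. summable (\<lambda>k. cmod (f k $ i $ j))" "\<And>k. \<bar>c k\<bar> \<le> 1"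
    for c :: "nat \<Rightarrow> real" and f :: "nat \<Rightarrow> HC"
  proof -
    have "summable (\<lambda>k. (c k *\<^sub>R f k) $ i $ j)" for i j
      by (rule summable_comparison_test'[OF that(1)[of i j]]) (simp add: mult_left_le_one_le that(2))
    then have "(\<lambda>k. c k *\<^sub>R f k) sums (\<chi> i j. \<Sum>k. (c k *\<^sub>R f k) $ i $ j)"
      by (intro sums_HC) (simp add: summable_sums del: vector_scaleR_component)
    then show ?thesis by blast
  qed
  have le1: "\<bar>1 / (a::real)\<bar> \<le> 1" if "a = 0 \<or> a \<ge> 1" for a using that by auto
  obtain S1 where S1: "t1 sums S1"
    using scaled[OF char_grad_summable(1)[OF assms(1)], of "\<lambda>k. 1 / (real k + 1)\<^sup>2"] le1
    by (auto simp: t1_def[abs_def])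
  obtain S2 where S2: "t2 sums S2"
  proof -
    have c: "\<bar>1 / ((real k)\<^sup>2 * (real k + 1)\<^sup>2)\<bar> \<le> 1" for k
      by (rule le1, cases "k = 0") (auto simp: one_le_mult_iff simp flip: power_mult_distrib intro!: one_le_power mult_ge1_I)
    from scaled[where c = "\<lambda>k. 1 / ((real k)\<^sup>2 * (real k + 1)\<^sup>2)", OF char_grad_summable(2)[OF assms(1)] c] show thesis
      using that by (auto simp: t2_def[abs_def])
  qed
  obtain S3 where S3: "(\<lambda>k. (1 / (real k + 2)\<^sup>2) *\<^sub>R ((det X * det Y) \<cdot>\<^sub>c char_grad_left k X Y)) sums S3"
  proof -
    have "summable (\<lambda>k. cmod (((det X * det Y) \<cdot>\<^sub>c char_grad_left k X Y) $ i $ j))" for i j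
      using char_grad_summable(1)[OF assms(1), of i j] by (simp add: norm_mult summable_mult)
    from scaled[OF this, of "\<lambda>k. 1 / (real k + 2)\<^sup>2"] le1 show thesis using that by auto
  qed
  have t3: "t3 (k + 2) = (1 / (real k + 2)\<^sup>2) *\<^sub>R ((det X * det Y) \<cdot>\<^sub>c char_grad_left k X Y)" for k
    by (simp add: t3_def add.commute)
  have "t3 sums S3"
    using S3 sums_iff_shift[of t3 2 S3] unfolding t3 by (simp add: t3_def numeral_2_eq_2)
  have t2: "t2 (Suc k) = (1 / ((real k + 1)\<^sup>2 * (real k + 2)\<^sup>2)) *\<^sub>R char_grad_right (Suc k) X Y" for k
    by (simp add: t2_def add.commute)
  have "(\<lambda>k. t2 (Suc k)) sums S2" using S2 sums_Suc_iff[of t2 S2] by (simp add: t2_def)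
  have "mean_term k X Y = t1 k + t2 k + t3 k" for k
    by (simp add: mean_term_def t1_def t2_def t3_def scaleR_cscale cscale_simps)
  then have "(\<lambda>k. mean_term k X Y) sums (S1 + S2 + S3)"
    using sums_add[OF sums_add[OF S1 S2] \<open>t3 sums S3\<close>] by simp
  then have "(\<lambda>k. mean_term k X Y $ i $ l) sums ((S1 + S2 + S3) $ i $ l)" for i l
    by (intro sums_vec_nth)
  then have "- J $ i $ l = (S1 + S2 + S3) $ i $ l" for i l
    using assms(2) sums_unique2 by blast
  then have "J = - S1 - S2 - S3" by (simp add: vec_eq_iff) (metis add.inverse_inverse add_uminus_conv_diff minus_add_distrib)
  with S1 S3 \<open>(\<lambda>k. t2 (Suc k)) sums S2\<close> show thesis using that[of S1 S2 S3] by (simp add: t1_def[abs_def] t2)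
qed

lemma half_sumsI: "(\<And>k. a (l0 + real k / 2) = g k) \<Longrightarrow> g sums S \<Longrightarrow> half_sums l0 a S"
  by (simp add: half_sums_def)

lemma half_integer_shift:
  "0 + real k / 2 = real k / 2" "1/2 + real k / 2 = real (Suc k) / 2" "1 + real k / 2 = real k / 2 + 1"
  "real k / 2 + 1 - 1 = real k / 2" "real k / 2 + 1 - 1/2 = real k / 2 + 1/2"
  by simp_all

lemma three_half_sums:
  assumes R: "R > 0" and Z: "Z1 \<in> Dplus R" "Z2 \<in> Dminus R"
    and J: "\<And>i l. (\<lambda>k. mean_term k Z1 (matrix_inv Z2) $ i $ l) sums (- J $ i $ l)"
  shows "\<exists>S1 S2 S3.
      half_sums 0 (\<lambda>l. \<Sum>m\<in>hrange l. \<Sum>n\<in>hrange (l + 1/2).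
        (1 / (2 * l + 1)\<^sup>2) *\<^sub>R col_row (f1 l m n Z1) (g1_tilde l m n Z2)) S1 \<and>
      half_sums (1/2) (\<lambda>l. \<Sum>m\<in>hrange l. \<Sum>n\<in>hrange (l - 1/2).
        (1 / ((2 * l)\<^sup>2 * (2 * l + 1)\<^sup>2)) *\<^sub>R col_row (f2 l m n Z1) (g2_tilde l m n Z2)) S2 \<and>
      half_sums 1 (\<lambda>l. \<Sum>m\<in>hrange (l - 1). \<Sum>n\<in>hrange (l - 1/2).
        (1 / (2 * l)\<^sup>2) *\<^sub>R col_row (f3 l m n Z1) (g3_tilde l m n Z2)) S3 \<and>
      J = - S1 - S2 - S3"
   and "\<exists>S1 S2 S3.
      half_sums 0 (\<lambda>l. \<Sum>m\<in>hrange (l + 1/2). \<Sum>n\<in>hrange l.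
        (1 / (2 * l + 1)\<^sup>2) *\<^sub>R col_row (f1_tilde l m n Z2) (g1 l m n Z1)) S1 \<and>
      half_sums (1/2) (\<lambda>l. \<Sum>m\<in>hrange (l - 1/2). \<Sum>n\<in>hrange l.
        (1 / ((2 * l)\<^sup>2 * (2 * l + 1)\<^sup>2)) *\<^sub>R col_row (f2_tilde l m n Z2) (g2 l m n Z1)) S2 \<and>
      half_sums 1 (\<lambda>l. \<Sum>m\<in>hrange (l - 1/2). \<Sum>n\<in>hrange (l - 1).
        (1 / (2 * l)\<^sup>2) *\<^sub>R col_row (f3_tilde l m n Z2) (g3 l m n Z1)) S3 \<and>
      J = - S1 - S2 - S3"
proof -
  obtain S1 S2 S3 where S: "(\<lambda>k. (1 / (real k + 1)\<^sup>2) *\<^sub>R char_grad_left k Z1 (matrix_inv Z2)) sums S1"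
    "(\<lambda>k. (1 / ((real k + 1)\<^sup>2 * (real k + 2)\<^sup>2)) *\<^sub>R char_grad_right (Suc k) Z1 (matrix_inv Z2)) sums S2"
    "(\<lambda>k. (1 / (real k + 2)\<^sup>2) *\<^sub>R ((det Z1 * det (matrix_inv Z2)) \<cdot>\<^sub>c char_grad_left k Z1 (matrix_inv Z2))) sums S3"
    "J = - S1 - S2 - S3"
    using three_series_of_mean_terms[OF summable_lucas2_Dplus_Dminus[OF R Z] J] .
  have det: "det Z2 \<noteq> 0" by (rule Dminus_contraction(1)[OF Z(2) R])
  have c: "2 * (real k / 2) + 1 = real k + 1" "2 * (real (Suc k) / 2) = real k + 1"
    "real k + 1 + 1 = real k + 2" "2 * (real k / 2 + 1) = real k + 2" for k
    by simp_all
  note rewrite = half_integer_shift scaleR_sum_right[symmetric] c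
  show "\<exists>S1 S2 S3.
      half_sums 0 (\<lambda>l. \<Sum>m\<in>hrange l. \<Sum>n\<in>hrange (l + 1/2).
        (1 / (2 * l + 1)\<^sup>2) *\<^sub>R col_row (f1 l m n Z1) (g1_tilde l m n Z2)) S1 \<and>
      half_sums (1/2) (\<lambda>l. \<Sum>m\<in>hrange l. \<Sum>n\<in>hrange (l - 1/2).
        (1 / ((2 * l)\<^sup>2 * (2 * l + 1)\<^sup>2)) *\<^sub>R col_row (f2 l m n Z1) (g2_tilde l m n Z2)) S2 \<and>
      half_sums 1 (\<lambda>l. \<Sum>m\<in>hrange (l - 1). \<Sum>n\<in>hrange (l - 1/2).
        (1 / (2 * l)\<^sup>2) *\<^sub>R col_row (f3 l m n Z1) (g3_tilde l m n Z2)) S3 \<and>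
      J = - S1 - S2 - S3"
    by (rule exI[of _ S1], rule exI[of _ S2], rule exI[of _ S3], intro conjI S(4) half_sumsI[OF _ S(1)] half_sumsI[OF _ S(2)] half_sumsI[OF _ S(3)])
      (simp_all only: rewrite sum_f1_g1_tilde sum_f2_g2_tilde[OF det] sum_f3_g3_tilde[OF det])
  show "\<exists>S1 S2 S3.
      half_sums 0 (\<lambda>l. \<Sum>m\<in>hrange (l + 1/2). \<Sum>n\<in>hrange l.
        (1 / (2 * l + 1)\<^sup>2) *\<^sub>R col_row (f1_tilde l m n Z2) (g1 l m n Z1)) S1 \<and>
      half_sums (1/2) (\<lambda>l. \<Sum>m\<in>hrange (l - 1/2). \<Sum>n\<in>hrange l.
        (1 / ((2 * l)\<^sup>2 * (2 * l + 1)\<^sup>2)) *\<^sub>R col_row (f2_tilde l m n Z2) (g2 l m n Z1)) S2 \<and>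
      half_sums 1 (\<lambda>l. \<Sum>m\<in>hrange (l - 1/2). \<Sum>n\<in>hrange (l - 1).
        (1 / (2 * l)\<^sup>2) *\<^sub>R col_row (f3_tilde l m n Z2) (g3 l m n Z1)) S3 \<and>
      J = - S1 - S2 - S3"
    by (rule exI[of _ S1], rule exI[of _ S2], rule exI[of _ S3], intro conjI S(4) half_sumsI[OF _ S(1)] half_sumsI[OF _ S(2)] half_sumsI[OF _ S(3)])
      (simp_all only: rewrite sum_f1_tilde_g1 sum_f2_tilde_g2[OF det] sum_f3_tilde_g3[OF det])
qed

theorem proposition60:
  fixes R :: real
  assumes "R > 0"
  shows "(\<forall>Z1\<in>Dplus R. \<forall>Z2\<in>Dminus R. \<exists>S1 S2 S3.
      half_sums 0 (\<lambda>l. \<Sum>m\<in>hrange l. \<Sum>n\<in>hrange (l + 1/2).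
        (1 / (2 * l + 1)\<^sup>2) *\<^sub>R col_row (f1 l m n Z1) (g1_tilde l m n Z2)) S1 \<and>
      half_sums (1/2) (\<lambda>l. \<Sum>m\<in>hrange l. \<Sum>n\<in>hrange (l - 1/2).
        (1 / ((2 * l)\<^sup>2 * (2 * l + 1)\<^sup>2)) *\<^sub>R col_row (f2 l m n Z1) (g2_tilde l m n Z2)) S2 \<and>
      half_sums 1 (\<lambda>l. \<Sum>m\<in>hrange (l - 1). \<Sum>n\<in>hrange (l - 1/2).
        (1 / (2 * l)\<^sup>2) *\<^sub>R col_row (f3 l m n Z1) (g3_tilde l m n Z2)) S3 \<and>
      J' R (\<lambda>W. inverse ((det W)\<^sup>2) \<cdot>\<^sub>c adjugate W) Z1 Z2 = - S1 - S2 - S3)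
    \<and>
    (\<forall>Z1\<in>Dminus R. \<forall>Z2\<in>Dplus R. \<exists>S1 S2 S3.
      half_sums 0 (\<lambda>l. \<Sum>m\<in>hrange (l + 1/2). \<Sum>n\<in>hrange l.
        (1 / (2 * l + 1)\<^sup>2) *\<^sub>R col_row (f1_tilde l m n Z1) (g1 l m n Z2)) S1 \<and>
      half_sums (1/2) (\<lambda>l. \<Sum>m\<in>hrange (l - 1/2). \<Sum>n\<in>hrange l.
        (1 / ((2 * l)\<^sup>2 * (2 * l + 1)\<^sup>2)) *\<^sub>R col_row (f2_tilde l m n Z1) (g2 l m n Z2)) S2 \<and>
      half_sums 1 (\<lambda>l. \<Sum>m\<in>hrange (l - 1/2). \<Sum>n\<in>hrange (l - 1).
        (1 / (2 * l)\<^sup>2) *\<^sub>R col_row (f3_tilde l m n Z1) (g3 l m n Z2)) S3 \<and>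
      J' R (\<lambda>W. inverse ((det W)\<^sup>2) \<cdot>\<^sub>c adjugate W) Z1 Z2 = - S1 - S2 - S3)"
  by (intro conjI ballI; (rule three_half_sums(1)[OF assms _ _ J'_plus_minus_sums[OF assms]]
      | rule three_half_sums(2)[OF assms _ _ J'_minus_plus_sums[OF assms]]); assumption)

end
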